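(* Let $d\in\mathbb{N}$ and let $\Psi:\mathbb{R}_+\to\mathbb{R}_+$ be a nondecreasing function for which there is a constant $c$ with $\Psi(2t)\le c\,\Psi(t)$ for all $t>1$. Let $\lambda_{\mathbf k}=\Psi(|\mathbf k|_2)$ for all $\mathbf k\in\mathbb{Z}^d$, where $\lambda_{\mathbf k}\ne0$ for all $\mathbf k$ and $\varphi_{\lambda,d}\in L_2(\mathbb{T}^d)$. Then there exist positive constants $c'$ and $c''$ such that for all $n\in\mathbb{N}$ $$\frac{c'}{\Psi\big((n\log n)^{1/d}\big)}\le M_n(U_{\lambda,2}(\mathbb{T}^d))_2\le\frac{c''}{\Psi(n^{1/d})}.$$
   Context: $\mathbb{N}=\{1,2,\dots\}$; $\mathbb{R}_+=[0,\infty)$; $\mathbb{T}^d$ is the $d$-dimensional torus $[0,2\pi]^d$ with endpoints identified; $|\mathbf k|_2=(\sum_j k_j^2)^{1/2}$. Functions are real-valued. $\|f\|_2=(2\pi)^{-d/2}(\int_{\mathbb{T}^d}|f|^2)^{1/2}$; $(f_1*f_2)(\mathbf x)=(2\pi)^{-d}\int_{\mathbb{T}^d}f_1(\mathbf y)f_2(\mathbf x-\mathbf y)d\mathbf y$. For a sequence $\lambda=(\lambda_{\mathbf k})_{\mathbf k\in\mathbb{Z}^d}$ with nonzero components, $\varphi_{\lambda,d}=\sum_{\mathbf k\in\mathbb{Z}^d}\lambda_{\mathbf k}^{-1}e^{i(\mathbf k,\cdot)}$ in the distributional sense. $\Phi_{\lambda,2}(\mathbb{T}^d)=\{f=\varphi_{\lambda,d}*g:g\in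 L_2(\mathbb{T}^d)\}$ with norm $\|f\|_{\Phi_{\lambda,2}(\mathbb{T}^d)}=\|g\|_2$; $U_{\lambda,2}(\mathbb{T}^d)$ is its unit ball. For $\mathbb{W}\subset L_2(\mathbb{T}^d)$, $$M_n(\mathbb{W})_2=\inf_{\psi\in L_2(\mathbb{T}^d)}\ \sup_{f\in\mathbb{W}}\ \inf_{c_l\in\mathbb{R},\,\mathbf y_l\in\mathbb{T}^d}\Big\|f-\sum_{l=1}^n c_l\psi(\cdot-\mathbf y_l)\Big\|_2 .$$ *)

theory Defs
  imports "HOL-Analysis.Analysis"
begin

text \<open>
  The dimension is the cardinality of the index type \<open>'d\<close>.  A function on the torus is a function
  on \<open>real ^ 'd\<close> that is \<open>2 * pi\<close>-periodic in each coordinate; integrals over the torus are taken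
  over the cube \<open>torus\<close> below, and points of the torus are represented by points of this cube.
\<close>

definition torus :: "(real ^ 'd) set" where
  "torus = cbox 0 (\<chi> i. 2 * pi)"

definition torus_fun :: "(real ^ 'd \<Rightarrow> real) \<Rightarrow> bool" where
  "torus_fun f \<longleftrightarrow> (\<forall>x i. f (x + axis i (2 * pi)) = f x)"

text \<open>Elements of \<open>L2\<close> are representatives (Borel, everywhere defined and periodic) of the usual
  classes modulo null sets; equality of such classes is expressed by \<open>AE\<close> below.\<close>

definition L2 :: "(real ^ 'd \<Rightarrow> real) set" where
  "L2 = {f. torus_fun f \<and> f \<in> borel_measurable borel \<and>
            set_integrable lborel torus (\<lambda>x. (f x)\<^sup>2)}"

definition l2norm :: "(real ^ 'd \<Rightarrow> real) \<Rightarrow> real" where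
  "l2norm f = (2 * pi) powr (- real CARD('d) / 2) * sqrt (LINT x:torus|lborel. (f x)\<^sup>2)"

definition conv :: "(real ^ 'd \<Rightarrow> real) \<Rightarrow> (real ^ 'd \<Rightarrow> real) \<Rightarrow> real ^ 'd \<Rightarrow> real" where
  "conv f1 f2 x = (2 * pi) powr (- real CARD('d)) * (LINT y:torus|lborel. f1 y * f2 (x - y))"

definition freq :: "int ^ 'd \<Rightarrow> real ^ 'd" where
  "freq k = (\<chi> j. real_of_int (k $ j))"

text \<open>\<open>Ck m f\<close>: \<open>f\<close> is \<open>m\<close> times continuously differentiable, expressed through iterated partial
  derivatives.\<close>

primrec Ck :: "nat \<Rightarrow> (real ^ 'd \<Rightarrow> real) \<Rightarrow> bool" where
  "Ck 0 f \<longleftrightarrow> continuous_on UNIV f"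
| "Ck (Suc m) f \<longleftrightarrow> f differentiable_on UNIV \<and>
     (\<forall>i. Ck m (\<lambda>x. frechet_derivative f (at x) (axis i 1)))"

definition test_fun :: "(real ^ 'd \<Rightarrow> real) \<Rightarrow> bool" where
  "test_fun h \<longleftrightarrow> torus_fun h \<and> (\<forall>m. Ck m h)"

text \<open>\<open>is_kernel \<lambda> \<phi>\<close>: the (integrable) function \<open>\<phi>\<close> represents the distribution given by the series
  with terms \<open>1 / \<lambda> k\<close> times the character \<open>x \<mapsto> exp (i (k, x))\<close>, i.e. the series
  converges to \<open>\<phi>\<close> when paired with any smooth periodic test function.\<close>

definition is_kernel :: "(int ^ 'd \<Rightarrow> real) \<Rightarrow> (real ^ 'd \<Rightarrow> real) \<Rightarrow> bool" where
  "is_kernel lam \<phi> \<longleftrightarrow> (\<forall>h. test_fun h \<longrightarrow>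
     ((\<lambda>k. complex_of_real (1 / lam k) *
            (LINT x:torus|lborel. exp (\<i> * complex_of_real (freq k \<bullet> x)) * complex_of_real (h x)))
        has_sum complex_of_real (LINT x:torus|lborel. \<phi> x * h x)) UNIV)"

text \<open>The space of all convolutions of \<open>L2\<close> functions with the kernel \<open>\<phi>\<close> (for \<open>\<phi>\<close> in \<open>L2\<close>, so that
  the convolution integral converges everywhere), its norm and its unit ball.  If \<open>\<phi>\<close> is the kernel
  of a sequence \<open>\<lambda>\<close> then \<open>g\<close> is determined by \<open>f\<close> up to a null set, so the norm is well defined.\<close>

definition Phi_space :: "(real ^ 'd \<Rightarrow> real) \<Rightarrow> (real ^ 'd \<Rightarrow> real) set" where
  "Phi_space \<phi> = {f \<in> L2. \<exists>g \<in> L2. AE x in lborel. f x = conv \<phi> g x}"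

definition Phi_norm :: "(real ^ 'd \<Rightarrow> real) \<Rightarrow> (real ^ 'd \<Rightarrow> real) \<Rightarrow> real" where
  "Phi_norm \<phi> f = (THE r. \<exists>g \<in> L2. (AE x in lborel. f x = conv \<phi> g x) \<and> r = l2norm g)"

definition Phi_ball :: "(real ^ 'd \<Rightarrow> real) \<Rightarrow> (real ^ 'd \<Rightarrow> real) set" where
  "Phi_ball \<phi> = {f \<in> Phi_space \<phi>. Phi_norm \<phi> f \<le> 1}"

text \<open>The values are taken in \<open>ennreal\<close> because the supremum may be infinite for a general \<open>W\<close>.\<close>

definition M :: "nat \<Rightarrow> (real ^ 'd \<Rightarrow> real) set \<Rightarrow> ennreal" where
  "M n W = (INF \<psi> \<in> L2. SUP f \<in> W. INF c :: nat \<Rightarrow> real. INF y \<in> {y. \<forall>l \<in> {1..n}. y l \<in> torus}.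
     ennreal (l2norm (\<lambda>x. f x - (\<Sum>l = 1..n. c l * \<psi> (x - y l)))))"

end

theory Submission
  imports Defs
begin

text \<open>
  Upper bound: the translates of the Dirichlet kernel of degree \<open>m\<close> by the points of the uniform grid
  with \<open>(2 m + 1) ^ d \<le> n\<close> nodes span the trigonometric polynomials of degree \<open>m\<close>, and truncating the
  Fourier series of \<open>\<phi> * g\<close> costs at most \<open>1 / \<Psi> (m + 1)\<close>.

  Lower bound: project onto \<open>N = m ^ d\<close> cosines.  The coefficients of \<open>\<Sum>l. c l * \<psi> (x - y l)\<close> are
  linear in \<open>c\<close> and trigonometric polynomials of degree \<open>m\<close> in \<open>y\<close>, so for a fixed polynomial \<open>q\<close> the
  products \<open>\<Prod>k. q (\<eta> k * F k (c, y))\<close>, over all sign vectors \<open>\<eta>\<close>, lie in a space of dimension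
  \<open>exp (O (n log N))\<close>, which is much smaller than \<open>2 ^ N\<close> once \<open>N\<close> is a large multiple of \<open>n log n\<close>.
  Hence for some sign vector \<open>\<epsilon>\<close> the \<open>\<epsilon>\<close>-coordinate of this \<open>2 ^ N\<close>-vector is always exponentially
  small compared with its norm.  Were \<open>F (c, y)\<close> close to \<open>\<epsilon>\<close>, that coordinate would dominate, so
  \<open>\<epsilon>\<close> stays at distance of order \<open>sqrt N\<close> from all \<open>F (c, y)\<close>.  This replaces Warren's bound on the
  number of sign patterns of polynomials.
\<close>

section \<open>Integration over the torus\<close>

text \<open>The function \<open>\<psi>\<close> is fixed before the target and the coefficients
  \<open>c\<close> are unbounded, so what limits the approximating family is algebraic rather than
  metric. Each \<open>c l\<close> enters the products with degree at most \<open>2 * N\<close>,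
  while each shift \<open>y l\<close> enters with frequencies up to \<open>2 * N * m\<close> in
  every coordinate. One translate thus contributes a factor polynomial in \<open>N\<close> to the
  dimension, and \<open>n\<close> translates give its \<open>n\<close>-th power; this is the source
  of the logarithm.

  Once the kernel has been identified, no infinite Fourier series is summed. Identities are verified
  on trigonometric polynomials and extended by density, the passage being controlled by a
  Cauchy-Schwarz bound for convolutions that holds at every point. Density is proved on a product of
  unit circles in \<open>complex ^ 'd\<close>, where compactness, Stone-Weierstrass and inner
  regularity are at hand.

  The numerical constants share one margin: \<open>2/5\<close> for the dimension and
  \<open>3/20\<close> for the values of the fixed polynomial add up to less than \<open>2/3\<close>,
  a lower bound for \<open>ln 2\<close>.\<close>

definition periodic :: "(real ^ 'd \<Rightarrow> 'b) \<Rightarrow> bool" where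
  "periodic f \<longleftrightarrow> (\<forall>x i. f (x + axis i (2 * pi)) = f x)"

text \<open>Normalised Haar measure, realised as a probability measure on the whole space carried by
  the closed cube. The factor absorbs the powers of \<open>2 * pi\<close> in \<open>l2norm\<close>
  and \<open>conv\<close>.\<close>

definition tmeas :: "(real ^ 'd) measure" where
  "tmeas = density lborel (\<lambda>x. ennreal (indicator torus x / (2 * pi) ^ CARD('d)))"

text \<open>The quotient map onto the torus, seen as a product of unit circles;
  \<open>torus_arg\<close> is a Borel inverse on that product.\<close>

definition torus_map :: "real ^ 'd \<Rightarrow> complex ^ 'd" where
  "torus_map x = (\<chi> i. cis (x $ i))"

definition torus_arg :: "complex ^ 'd \<Rightarrow> real ^ 'd" where
  "torus_arg z = (\<chi> i. Arg (z $ i))"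

lemma torus_fun_iff_periodic: "torus_fun f \<longleftrightarrow> periodic f"
  by (simp add: torus_fun_def periodic_def)

lemma sets_tmeas [simp, measurable_cong]: "sets tmeas = sets borel"
  and space_tmeas [simp]: "space tmeas = UNIV"
  by (simp_all add: tmeas_def)

lemma torus_sets [measurable]: "torus \<in> sets borel"
  by (simp add: torus_def)

lemma periodic_shift_int:
  assumes "periodic f"
  shows "f (x + (2 * pi) *\<^sub>R freq k) = f x"
proof -
  have 1: "f (x + axis i (2 * pi * of_int m)) = f x" for x i m
  proof (induction m rule: int_induct[of _ 0])
    case base
    show ?case by (simp add: axis_def zero_vec_def[symmetric])
  next
    case (step1 m)
    have "x + axis i (2 * pi * of_int (m + 1)) = (x + axis i (2 * pi * of_int m)) + axis i (2*pi)"
      by (simp add: vec_eq_iff axis_def algebra_simps)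
    with step1 assms show ?case by (metis periodic_def)
  next
    case (step2 m)
    have "x + axis i (2 * pi * of_int m) = (x + axis i (2 * pi * of_int (m - 1))) + axis i (2*pi)"
      by (simp add: vec_eq_iff axis_def algebra_simps)
    with step2 assms show ?case by (metis periodic_def)
  qed
  have 2: "f (x + (\<Sum>i\<in>A. axis i (2 * pi * of_int (k $ i)))) = f x" if "finite A" for A
    using that
  proof (induction A)
    case (insert a A)
    have "f (x + (\<Sum>i\<in>insert a A. axis i (2 * pi * of_int (k $ i))))
        = f ((x + (\<Sum>i\<in>A. axis i (2 * pi * of_int (k $ i)))) + axis a (2 * pi * of_int (k $ a)))"
      using insert by (simp add: algebra_simps)
    then show ?case using insert 1 by simp
  qed simp
  have "(2 * pi) *\<^sub>R freq k = (\<Sum>i\<in>UNIV. axis i (2 * pi * of_int (k $ i)))"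
    by (simp add: vec_eq_iff axis_def freq_def sum.delta' if_distrib cong: if_cong)
  with 2[of UNIV] show ?thesis by simp
qed

text \<open>The round trip changes each coordinate by a multiple of \<open>2 * pi\<close>. Hence a
  periodic Borel function is a Borel function of \<open>torus_map x\<close>, and its integrals
  depend only on the image measure under \<open>torus_map\<close>.\<close>

lemma periodic_torus_arg:
  assumes "periodic f"
  shows "f (torus_arg (torus_map x)) = f x"
proof -
  have "\<exists>m::int. Arg (cis t) = t + 2 * pi * of_int m" for t :: real
  proof -
    have "cis (Arg (cis t)) = cis t"
      by (subst cis_Arg) (auto simp: sgn_div_norm)
    then have "cos (Arg (cis t)) = cos t" "sin (Arg (cis t)) = sin t"
      by (metis cis.simps)+
    then obtain n where "Arg (cis t) = t + 2 * pi * real_of_int n"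
      by (smt (verit, best) sin_cos_eq_iff)
    then show ?thesis by blast
  qed
  then obtain m :: "real \<Rightarrow> int" where m: "\<And>t. Arg (cis t) = t + 2 * pi * of_int (m t)"
    by metis
  have "torus_arg (torus_map x) = x + (2 * pi) *\<^sub>R freq (\<chi> i. m (x $ i))"
    by (simp add: vec_eq_iff torus_arg_def torus_map_def freq_def m)
  then show ?thesis by (simp add: periodic_shift_int assms)
qed

lemma borel_measurable_vecI:
  fixes f :: "'a \<Rightarrow> 'b::euclidean_space ^ 'd"
  assumes "\<And>i. (\<lambda>x. f x $ i) \<in> borel_measurable N"
  shows "f \<in> borel_measurable N"
proof (subst borel_measurable_euclidean_space, safe)
  fix b :: "'b ^ 'd" assume "b \<in> Basis"
  then show "(\<lambda>x. f x \<bullet> b) \<in> borel_measurable N"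
    using assms by (simp add: inner_vec_def)
qed

lemma borel_measurable_vec_nth [measurable]:
  "(\<lambda>x::'b::euclidean_space ^ 'd. x $ i) \<in> borel_measurable borel"
  by (intro borel_measurable_continuous_onI continuous_intros)

text \<open>Continuity covers the plane slit along the nonpositive reals; on the slit
  \<open>Arg\<close> equals \<open>pi\<close>, except for the value 0 at the origin.\<close>

lemma Arg_measurable [measurable]: "Arg \<in> borel_measurable borel"
proof -
  have 1: "(\<lambda>z. indicator (-\<real>\<^sub>\<le>\<^sub>0) z *\<^sub>R Arg z) \<in> borel_measurable borel"
    by (intro borel_measurable_continuous_on_indicator continuous_on_Arg) auto
  have 2: "(\<lambda>z::complex. indicator (\<real>\<^sub>\<le>\<^sub>0 - {0}) z *\<^sub>R pi) \<in> borel_measurable borel"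
    using borel_closed[OF closed_nonpos_Reals_complex] by measurable
  have "Arg z = indicator (-\<real>\<^sub>\<le>\<^sub>0) z *\<^sub>R Arg z + indicator (\<real>\<^sub>\<le>\<^sub>0 - {0}) z *\<^sub>R pi" for z
    by (auto simp: indicator_def Arg_zero elim!: nonpos_Reals_cases)
  then have "Arg = (\<lambda>z. indicator (-\<real>\<^sub>\<le>\<^sub>0) z *\<^sub>R Arg z + indicator (\<real>\<^sub>\<le>\<^sub>0 - {0}) z *\<^sub>R pi)"
    by auto
  with borel_measurable_add[OF 1 2] show ?thesis by simp
qed

lemma torus_arg_measurable [measurable]: "torus_arg \<in> borel_measurable borel"
  by (rule borel_measurable_vecI) (simp add: torus_arg_def)

lemma continuous_on_torus_map [continuous_intros]:
  "continuous_on S torus_map"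
  unfolding torus_map_def cis_conv_exp
  by (intro continuous_intros continuous_on_vec_lambda)

lemma torus_map_shift [simp]: "torus_map (x + axis i (2 * pi)) = torus_map x"
  by (simp add: torus_map_def vec_eq_iff axis_def complex_eq_iff)

lemma torus_map_measurable [measurable]: "torus_map \<in> borel_measurable borel"
  by (intro borel_measurable_continuous_onI continuous_intros)

section \<open>The normalised measure on the cube\<close>

lemma integral_tmeas:
  fixes f :: "real ^ 'd \<Rightarrow> 'b::{banach, second_countable_topology}"
  assumes [measurable]: "f \<in> borel_measurable borel"
  shows "(LINT x|tmeas. f x) = (1 / (2 * pi) ^ CARD('d)) *\<^sub>R (LINT x:torus|lborel. f x)"
proof -
  have "(LINT x|tmeas. f x) = (LINT x|lborel. (indicator torus x / (2 * pi) ^ CARD('d)) *\<^sub>R f x)"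
    unfolding tmeas_def by (subst integral_density) auto
  also have "\<dots> = (LINT x|lborel. (1 / (2 * pi) ^ CARD('d)) *\<^sub>R (indicator torus x *\<^sub>R f x))"
    by (simp add: field_simps)
  also have "\<dots> = (1 / (2 * pi) ^ CARD('d)) *\<^sub>R (LINT x|lborel. indicator torus x *\<^sub>R f x)"
    by (rule integral_scaleR_right)
  finally show ?thesis unfolding set_lebesgue_integral_def .
qed

lemma integrable_tmeas:
  fixes f :: "real ^ 'd \<Rightarrow> 'b::{banach, second_countable_topology}"
  assumes [measurable]: "f \<in> borel_measurable borel"
  shows "integrable tmeas f \<longleftrightarrow> set_integrable lborel torus f"
proof -
  have "integrable tmeas f = integrable lborel (\<lambda>x. (indicator torus x / (2 * pi) ^ CARD('d)) *\<^sub>R f x)"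
    unfolding tmeas_def by (subst integrable_density) auto
  also have "(\<lambda>x. (indicator torus x / (2 * pi) ^ CARD('d)) *\<^sub>R f x)
     = (\<lambda>x. (1 / (2 * pi) ^ CARD('d)) *\<^sub>R (indicator torus x *\<^sub>R f x))"
    by (auto simp: field_simps)
  also have "integrable lborel \<dots> \<longleftrightarrow> integrable lborel (\<lambda>x. indicator torus x *\<^sub>R f x)"
  proof
    assume "integrable lborel (\<lambda>x. (1 / (2 * pi) ^ CARD('d)) *\<^sub>R (indicator torus x *\<^sub>R f x))"
    then have "integrable lborel (\<lambda>x. (2 * pi) ^ CARD('d) *\<^sub>R ((1 / (2 * pi) ^ CARD('d)) *\<^sub>R (indicator torus x *\<^sub>R f x)))"
      by (rule integrable_scaleR_right)
    then show "integrable lborel (\<lambda>x. indicator torus x *\<^sub>R f x)" by simp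
  qed (rule integrable_scaleR_right)
  finally show ?thesis unfolding set_integrable_def .
qed

lemma emeasure_tmeas: "emeasure (tmeas :: (real ^ 'd) measure) UNIV = 1"
proof -
  have 1: "emeasure lborel (torus :: (real^'d) set) = ennreal ((2 * pi) ^ CARD('d))"
  proof -
    have "cbox 0 (\<chi> i. 2 * pi) \<noteq> ({} :: (real^'d) set)"
      using mem_box_cart(2)[of 0 0 "(\<chi> i. 2 * pi) :: real^'d"] by auto
    then have "measure lborel (torus :: (real^'d) set) = (2 * pi) ^ CARD('d)"
      unfolding torus_def by (subst content_cbox_cart) auto
    then show ?thesis
      unfolding torus_def using emeasure_lborel_cbox_finite[of 0 "(\<chi> i. 2 * pi) :: real^'d"]
      by (subst emeasure_eq_ennreal_measure) auto
  qed
  have "emeasure (tmeas :: (real ^ 'd) measure) UNIV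
      = (\<integral>\<^sup>+x. ennreal (1 / (2 * pi) ^ CARD('d)) * indicator torus (x::real^'d) \<partial>lborel)"
    unfolding tmeas_def by (simp add: emeasure_density, intro nn_integral_cong) (auto simp: indicator_def)
  also have "\<dots> = ennreal (1 / (2 * pi) ^ CARD('d)) * ennreal ((2 * pi) ^ CARD('d))"
    by (subst nn_integral_cmult_indicator) (auto simp: 1)
  also have "\<dots> = 1"
    by (subst ennreal_mult[symmetric]) auto
  finally show ?thesis .
qed

interpretation tm: finite_measure "tmeas :: (real ^ 'd) measure"
  by (rule finite_measureI) (simp add: emeasure_tmeas)

lemma measure_tmeas [simp]: "measure tmeas UNIV = 1"
  by (simp add: measure_def emeasure_tmeas)

section \<open>Invariance of the integral under translation and reflection\<close>

definition tcell :: "(real ^ 'd) set" where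
  "tcell = {x. \<forall>i. 0 \<le> x $ i \<and> x $ i < 2 * pi}"

lemma tcell_sets [measurable]: "tcell \<in> sets borel"
  unfolding tcell_def by measurable

lemma AE_tcell: "AE x in lborel. x \<in> (tcell :: (real^'d) set) \<longleftrightarrow> x \<in> torus"
proof (rule AE_I')
  let ?b = "(\<chi> i. 2 * pi) :: real ^ 'd"
  have "emeasure lborel (cbox 0 ?b - box 0 ?b) = 0"
    using emeasure_lborel_cbox_eq[of 0 ?b] emeasure_lborel_box_eq[of 0 ?b]
      emeasure_lborel_box_finite[of 0 ?b]
    by (subst emeasure_Diff) (auto simp: box_subset_cbox)
  then show "cbox 0 ?b - box 0 ?b \<in> null_sets lborel" by auto
  show "{x \<in> space lborel. \<not> (x \<in> (tcell :: (real^'d) set) \<longleftrightarrow> x \<in> torus)} \<subseteq> cbox 0 ?b - box 0 ?b"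
    by (auto simp: tcell_def torus_def mem_box_cart) (meson less_eq_real_def)+
qed

lemma nn_integral_tmeas:
  fixes f :: "real ^ 'd \<Rightarrow> ennreal"
  assumes [measurable]: "f \<in> borel_measurable borel"
  shows "(\<integral>\<^sup>+x. f x \<partial>tmeas) = ennreal (1 / (2 * pi) ^ CARD('d)) * (\<integral>\<^sup>+x. f x * indicator tcell x \<partial>lborel)"
proof -
  have "(\<integral>\<^sup>+x. f x \<partial>tmeas) = (\<integral>\<^sup>+x. ennreal (indicator torus x / (2 * pi) ^ CARD('d)) * f x \<partial>lborel)"
    unfolding tmeas_def by (subst nn_integral_density) auto
  also have "\<dots> = (\<integral>\<^sup>+x. ennreal (1 / (2 * pi) ^ CARD('d)) * (f x * indicator tcell x) \<partial>lborel)"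
    using AE_tcell
    by (intro nn_integral_cong_AE) (auto elim!: eventually_mono simp: indicator_def)
  finally show ?thesis by (simp add: nn_integral_cmult)
qed

text \<open>The half-open cell meets each lattice orbit exactly once, whereas the closed cube can
  meet it several times on its boundary.\<close>

lemma tcell_unique:
  fixes x :: "real ^ 'd"
  shows "\<exists>k0. \<forall>k. x + (2 * pi) *\<^sub>R freq k \<in> tcell \<longleftrightarrow> k = k0"
proof (intro exI allI)
  fix k :: "int ^ 'd"
  have eq: "0 \<le> x $ i + 2 * pi * of_int j \<and> x $ i + 2 * pi * of_int j < 2 * pi \<longleftrightarrow>
        j = - \<lfloor>x $ i / (2 * pi)\<rfloor>" for i and j :: int
  proof -
    have "(0 \<le> x $ i + 2 * pi * of_int j \<and> x $ i + 2 * pi * of_int j < 2 * pi)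
      \<longleftrightarrow> (of_int (- j) \<le> x $ i / (2 * pi) \<and> x $ i / (2 * pi) < of_int (- j) + 1)"
      using pi_gt_zero by (auto simp: field_simps)
    also have "\<dots> \<longleftrightarrow> \<lfloor>x $ i / (2 * pi)\<rfloor> = - j"
      by (auto simp: floor_eq_iff)
    finally show ?thesis by auto
  qed
  then show "x + (2 * pi) *\<^sub>R freq k \<in> tcell \<longleftrightarrow> k = (\<chi> i. - \<lfloor>x $ i / (2 * pi)\<rfloor>)"
    by (simp add: tcell_def freq_def vec_eq_iff eq)
qed

text \<open>The lattice translates of the cell form a partition of unity. Written as an integral
  over a counting measure, it can be inserted into another integral and the order exchanged.\<close>

lemma nn_integral_count_tcell:
  "(\<integral>\<^sup>+k. indicator tcell (x + (2 * pi) *\<^sub>R freq k) \<partial>count_space UNIV) = 1"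
proof -
  obtain k0 where "\<forall>k. x + (2 * pi) *\<^sub>R freq k \<in> tcell \<longleftrightarrow> k = k0"
    using tcell_unique by blast
  then have "(\<lambda>k. indicator tcell (x + (2 * pi) *\<^sub>R freq k) :: ennreal) = indicator {k0}"
    by (auto simp: indicator_def)
  then show ?thesis by simp
qed

lemma nn_integral_lborel_affine:
  fixes f :: "'a::euclidean_space \<Rightarrow> ennreal"
  assumes [measurable]: "f \<in> borel_measurable borel" and "\<bar>s\<bar> = 1"
  shows "(\<integral>\<^sup>+x. f (t + s *\<^sub>R x) \<partial>lborel) = (\<integral>\<^sup>+x. f x \<partial>lborel)"
proof -
  have "s \<noteq> 0" using assms by auto
  have "(\<integral>\<^sup>+x. f x \<partial>lborel) = (\<integral>\<^sup>+x. f x \<partial>density (distr lborel borel (\<lambda>x. t + s *\<^sub>R x)) (\<lambda>_. \<bar>s\<bar>^DIM('a)))"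
    by (rule arg_cong2[where f=nn_integral]) (rule lborel_affine[OF \<open>s \<noteq> 0\<close>], simp)
  also have "\<dots> = (\<integral>\<^sup>+x. f (t + s *\<^sub>R x) \<partial>lborel)"
    using assms by (simp add: density_1 nn_integral_distr)
  finally show ?thesis by simp
qed

text \<open>Both sides count the pairs of a point and an integer translation that carries it back into
  the cell; exchanging the two roles is the substitution \<open>x \<mapsto> t + s x + 2 \<pi> k\<close>.\<close>

lemma nn_integral_tmeas_affine:
  fixes f :: "real ^ 'd \<Rightarrow> ennreal"
  assumes [measurable]: "f \<in> borel_measurable borel" and p: "periodic f" and s: "s = 1 \<or> s = - 1"
  shows "(\<integral>\<^sup>+x. f (t + s *\<^sub>R x) \<partial>tmeas) = (\<integral>\<^sup>+x. f x \<partial>tmeas)"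
proof -
  let ?k = "\<lambda>k::int^'d. (2 * pi) *\<^sub>R freq k"
  let ?c = "count_space (UNIV :: (int ^ 'd) set)"
  have "(\<integral>\<^sup>+x. f (t + s *\<^sub>R x) * indicator tcell x \<partial>lborel)
     = (\<integral>\<^sup>+x. \<integral>\<^sup>+k. f (t + s *\<^sub>R x) * indicator tcell x * indicator tcell (t + s *\<^sub>R x + ?k k) \<partial>?c \<partial>lborel)"
    by (simp add: nn_integral_cmult nn_integral_count_tcell)
  also have "\<dots> = (\<integral>\<^sup>+k. \<integral>\<^sup>+x. f (t + s *\<^sub>R x) * indicator tcell x * indicator tcell (t + s *\<^sub>R x + ?k k) \<partial>lborel \<partial>?c)"
    by (subst nn_integral_count_space_nn_integral) auto
  \<comment> \<open>The translation has to be expressed in the new variable: for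
    \<open>s = 1\<close> the inverse substitution shifts by \<open>- k\<close>, while for
    \<open>s = - 1\<close> the reflection has already reversed the sign.\<close>
  also have "\<dots> = (\<integral>\<^sup>+k. \<integral>\<^sup>+x. f x * indicator tcell x * indicator tcell ((- s) *\<^sub>R t + s *\<^sub>R x + ?k ((if s = 1 then -1 else 1) * k)) \<partial>lborel \<partial>?c)"
  proof (rule nn_integral_cong)
    fix k :: "int ^ 'd"
    have eq: "- s *\<^sub>R t + s *\<^sub>R ((t + ?k k) + s *\<^sub>R x) + ?k ((if s = 1 then -1 else 1) * k) = x" for x
      using s by (auto simp: freq_def vec_eq_iff algebra_simps)
    have f: "f ((t + ?k k) + s *\<^sub>R x) = f (t + s *\<^sub>R x)" for x
      using periodic_shift_int[OF p, of "t + s *\<^sub>R x" k] by (simp add: add_ac)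
    have "(\<integral>\<^sup>+x. f x * indicator tcell x * indicator tcell ((- s) *\<^sub>R t + s *\<^sub>R x + ?k ((if s = 1 then -1 else 1) * k)) \<partial>lborel)
      = (\<integral>\<^sup>+x. f ((t + ?k k) + s *\<^sub>R x) * indicator tcell ((t + ?k k) + s *\<^sub>R x) * indicator tcell ((- s) *\<^sub>R t + s *\<^sub>R ((t + ?k k) + s *\<^sub>R x) + ?k ((if s = 1 then -1 else 1) * k)) \<partial>lborel)"
      using s by (subst nn_integral_lborel_affine[symmetric, of _ s "t + ?k k"]) auto
    also have "\<dots> = (\<integral>\<^sup>+x. f (t + s *\<^sub>R x) * indicator tcell x * indicator tcell (t + s *\<^sub>R x + ?k k) \<partial>lborel)"
      unfolding eq f by (simp add: ac_simps)
    finally show "(\<integral>\<^sup>+x. f (t + s *\<^sub>R x) * indicator tcell x * indicator tcell (t + s *\<^sub>R x + ?k k) \<partial>lborel)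
      = (\<integral>\<^sup>+x. f x * indicator tcell x * indicator tcell ((- s) *\<^sub>R t + s *\<^sub>R x + ?k ((if s = 1 then -1 else 1) * k)) \<partial>lborel)"
      by simp
  qed
  also have "\<dots> = (\<integral>\<^sup>+x. \<integral>\<^sup>+k. f x * indicator tcell x * indicator tcell ((- s) *\<^sub>R t + s *\<^sub>R x + ?k ((if s = 1 then -1 else 1) * k)) \<partial>?c \<partial>lborel)"
    by (subst nn_integral_count_space_nn_integral) auto
  also have "\<dots> = (\<integral>\<^sup>+x. \<integral>\<^sup>+k. f x * indicator tcell x * indicator tcell ((- s) *\<^sub>R t + s *\<^sub>R x + ?k k) \<partial>?c \<partial>lborel)"
  proof (rule nn_integral_cong)
    fix x :: "real ^ 'd"
    \<comment> \<open>The sign disappears because \<open>k\<close> runs over the whole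
      lattice.\<close>
    have "bij (\<lambda>k::int^'d. (if s = 1 then -1 else 1) * k)"
      by (rule o_bij[of "\<lambda>k::int^'d. (if s = 1 then -1 else 1) * k"]) auto
    then show "(\<integral>\<^sup>+k. f x * indicator tcell x * indicator tcell ((- s) *\<^sub>R t + s *\<^sub>R x + ?k ((if s = 1 then -1 else 1) * k)) \<partial>?c)
      = (\<integral>\<^sup>+k. f x * indicator tcell x * indicator tcell ((- s) *\<^sub>R t + s *\<^sub>R x + ?k k) \<partial>?c)"
      by (rule nn_integral_bij_count_space)
  qed
  also have "\<dots> = (\<integral>\<^sup>+x. f x * indicator tcell x \<partial>lborel)"
    by (simp add: nn_integral_cmult nn_integral_count_tcell)
  finally show ?thesis by (simp add: nn_integral_tmeas)
qed

text \<open>Indicators of Borel sets pulled back by \<open>torus_map\<close> are periodic, so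
  invariance for nonnegative functions turns into an equality of image measures.\<close>

lemma distr_torus_map_affine:
  fixes t :: "real ^ 'd"
  assumes "s = 1 \<or> s = - 1"
  shows "distr tmeas borel (\<lambda>x. torus_map (t + s *\<^sub>R x)) = distr tmeas borel torus_map"
proof (rule measure_eqI)
  fix A :: "(complex ^ 'd) set" assume "A \<in> sets (distr tmeas borel (\<lambda>x. torus_map (t + s *\<^sub>R x)))"
  then have [measurable]: "A \<in> sets borel" by simp
  let ?f = "\<lambda>x. indicator A (torus_map x) :: ennreal"
  have "periodic ?f"
    by (simp add: periodic_def)
  from nn_integral_tmeas_affine[OF _ this assms, of t]
  have "(\<integral>\<^sup>+x. ?f (t + s *\<^sub>R x) \<partial>tmeas) = (\<integral>\<^sup>+x. ?f x \<partial>tmeas)" by simp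
  moreover have "emeasure (distr tmeas borel g) A = (\<integral>\<^sup>+x. indicator A (g x) \<partial>tmeas)"
    if [measurable]: "g \<in> borel_measurable borel" for g :: "real ^ 'd \<Rightarrow> _"
    by (subst nn_integral_indicator[symmetric], simp) (subst nn_integral_distr, auto)
  ultimately show "emeasure (distr tmeas borel (\<lambda>x. torus_map (t + s *\<^sub>R x))) A = emeasure (distr tmeas borel torus_map) A"
    by simp
qed simp

text \<open>Both sides integrate the function \<open>f (torus_arg z)\<close> against image measures
  that agree, so the Banach-valued case follows without returning to simple functions. Convolution
  needs the case \<open>s = - 1\<close>.\<close>

lemma
  fixes f :: "real ^ 'd \<Rightarrow> 'b::{banach, second_countable_topology}"
  assumes [measurable]: "f \<in> borel_measurable borel" and p: "periodic f" and s: "s = 1 \<or> s = - 1"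
  shows integral_tmeas_affine: "(LINT x|tmeas. f (t + s *\<^sub>R x)) = (LINT x|tmeas. f x)"
    and integrable_tmeas_affine: "integrable tmeas (\<lambda>x. f (t + s *\<^sub>R x)) \<longleftrightarrow> integrable tmeas f"
proof -
  let ?F = "\<lambda>z. f (torus_arg z)"
  have F: "f = (\<lambda>x. ?F (torus_map x))" by (simp add: periodic_torus_arg[OF p])
  have "(LINT x|tmeas. ?F (torus_map (t + s *\<^sub>R x))) = (LINT z|distr tmeas borel (\<lambda>x. torus_map (t + s *\<^sub>R x)). ?F z)"
    by (subst integral_distr) auto
  also have "\<dots> = (LINT x|tmeas. ?F (torus_map x))"
    unfolding distr_torus_map_affine[OF s] by (subst integral_distr) auto
  finally show "(LINT x|tmeas. f (t + s *\<^sub>R x)) = (LINT x|tmeas. f x)"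
    by (simp add: periodic_torus_arg[OF p])
  have "integrable tmeas (\<lambda>x. ?F (torus_map (t + s *\<^sub>R x))) = integrable (distr tmeas borel (\<lambda>x. torus_map (t + s *\<^sub>R x))) ?F"
    by (subst integrable_distr_eq) auto
  also have "\<dots> = integrable tmeas (\<lambda>x. ?F (torus_map x))"
    unfolding distr_torus_map_affine[OF s] by (subst integrable_distr_eq) auto
  finally show "integrable tmeas (\<lambda>x. f (t + s *\<^sub>R x)) \<longleftrightarrow> integrable tmeas f"
    by (simp add: periodic_torus_arg[OF p])
qed

section \<open>Density of trigonometric polynomials\<close>

lemma integrable_bounded_tmeas:
  fixes f :: "real ^ 'd \<Rightarrow> 'b::{banach, second_countable_topology}"
  assumes "f \<in> borel_measurable borel" "\<And>x. norm (f x) \<le> B"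
  shows "integrable tmeas f"
  by (rule tm.integrable_const_bound[of _ B]) (use assms in auto)

definition chr :: "int ^ 'd \<Rightarrow> real ^ 'd \<Rightarrow> complex" where
  "chr k x = cis (freq k \<bullet> x)"

lemma freq_add: "freq (k + l) = freq k + freq l"
  and freq_minus: "freq (- k) = - freq k"
  and freq_zero: "freq 0 = 0"
  by (simp_all add: freq_def vec_eq_iff)

lemma chr_add_freq: "chr (k + l) x = chr k x * chr l x"
  and chr_add: "chr k (x + y) = chr k x * chr k y"
  and chr_minus: "chr k (- x) = chr (- k) x"
  and chr_minus_freq: "chr (- k) x = cnj (chr k x)"
  and chr_zero [simp]: "chr 0 x = 1"
  by (simp_all add: chr_def freq_add freq_minus freq_zero inner_add_left inner_add_right cis_mult cis_cnj)

lemma norm_chr [simp]: "norm (chr k x) = 1"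
  by (simp add: chr_def)

lemma periodic_chr: "periodic (chr k)"
proof -
  have "cis (2 * pi * of_int m) = 1" for m
    by (simp add: complex_eq_iff cos_int_2pin sin_int_2pin)
  moreover have "chr k (axis i (2 * pi)) = cis (2 * pi * of_int (k $ i))" for i
    by (simp add: chr_def inner_axis freq_def ac_simps)
  ultimately show ?thesis by (simp add: periodic_def chr_add)
qed

lemma continuous_on_chr [continuous_intros]: "continuous_on S (chr k)"
  unfolding chr_def cis_conv_exp by (intro continuous_intros)

lemma chr_measurable [measurable]: "chr k \<in> borel_measurable borel"
  by (intro borel_measurable_continuous_onI continuous_intros)

lemma integral_chr: "(LINT x|tmeas. chr k x) = (if k = 0 then 1 else 0)"
proof (cases "k = 0")
  case False
  then obtain i where i: "k $ i \<noteq> 0" by (auto simp: vec_eq_iff)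
  \<comment> \<open>A shift by half a wavelength, along a coordinate in which \<open>k\<close> is
    nonzero, negates the character but preserves its integral.\<close>
  let ?t = "axis i (pi / k $ i)"
  have "chr k ?t = - 1"
    using i unfolding chr_def inner_axis freq_def by simp
  moreover have "(LINT x|tmeas. chr k (?t + 1 *\<^sub>R x)) = (LINT x|tmeas. chr k x)"
    by (rule integral_tmeas_affine) (auto simp: periodic_chr)
  ultimately show ?thesis using False by (simp add: chr_add)
qed simp

definition trig_poly :: "(real ^ 'd \<Rightarrow> complex) \<Rightarrow> bool" where
  "trig_poly f \<longleftrightarrow> (\<exists>S a. finite S \<and> f = (\<lambda>x. \<Sum>k\<in>S. a k * chr k x))"

lemma trig_poly_chr: "trig_poly (\<lambda>x. c * chr k x)"
  unfolding trig_poly_def by (intro exI[of _ "{k}"] exI[of _ "\<lambda>_. c"]) simp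

lemma trig_poly_const: "trig_poly (\<lambda>x. c)"
  using trig_poly_chr[of c 0] by simp

lemma trig_poly_add:
  assumes "trig_poly f" "trig_poly g"
  shows "trig_poly (\<lambda>x. f x + g x)"
proof -
  obtain S a where S: "finite S" "f = (\<lambda>x. \<Sum>k\<in>S. a k * chr k x)" using assms by (auto simp: trig_poly_def)
  obtain T b where T: "finite T" "g = (\<lambda>x. \<Sum>k\<in>T. b k * chr k x)" using assms by (auto simp: trig_poly_def)
  have "(\<Sum>k\<in>S. a k * chr k x) = (\<Sum>k\<in>S \<union> T. (if k \<in> S then a k else 0) * chr k x)" for x
    using S T by (intro sum.mono_neutral_cong_left) auto
  moreover have "(\<Sum>k\<in>T. b k * chr k x) = (\<Sum>k\<in>S \<union> T. (if k \<in> T then b k else 0) * chr k x)" for x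
    using S T by (intro sum.mono_neutral_cong_left) auto
  ultimately have "f x + g x = (\<Sum>k\<in>S \<union> T. ((if k \<in> S then a k else 0) + (if k \<in> T then b k else 0)) * chr k x)" for x
    unfolding S T by (simp add: sum.distrib ring_distribs)
  then show ?thesis unfolding trig_poly_def using S T
    by (intro exI[of _ "S \<union> T"] exI[of _ "\<lambda>k. (if k \<in> S then a k else 0) + (if k \<in> T then b k else 0)"]) auto
qed

lemma trig_poly_sum: "(\<And>i. i \<in> I \<Longrightarrow> trig_poly (f i)) \<Longrightarrow> trig_poly (\<lambda>x. \<Sum>i\<in>I. f i x)"
  by (induction I rule: infinite_finite_induct) (auto intro: trig_poly_add trig_poly_const)

lemma trig_poly_mult:
  assumes "trig_poly f" "trig_poly g"
  shows "trig_poly (\<lambda>x. f x * g x)"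
proof -
  obtain S a where S: "finite S" "f = (\<lambda>x. \<Sum>k\<in>S. a k * chr k x)" using assms by (auto simp: trig_poly_def)
  obtain T b where T: "finite T" "g = (\<lambda>x. \<Sum>k\<in>T. b k * chr k x)" using assms by (auto simp: trig_poly_def)
  have "f x * g x = (\<Sum>k\<in>S. \<Sum>l\<in>T. a k * b l * chr (k + l) x)" for x
    unfolding S T by (simp add: sum_product chr_add_freq algebra_simps)
  then have eq: "(\<lambda>x. f x * g x) = (\<lambda>x. \<Sum>k\<in>S. \<Sum>l\<in>T. a k * b l * chr (k + l) x)" by auto
  show ?thesis unfolding eq by (intro trig_poly_sum trig_poly_chr)
qed

lemma trig_poly_continuous: "trig_poly f \<Longrightarrow> continuous_on UNIV f"
  by (auto simp: trig_poly_def intro!: continuous_intros)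

lemma trig_poly_periodic: "trig_poly f \<Longrightarrow> periodic f"
  by (auto simp: trig_poly_def periodic_def periodic_chr[unfolded periodic_def, rule_format])

lemma trig_poly_bounded: "trig_poly f \<Longrightarrow> \<exists>B. \<forall>x. norm (f x) \<le> B"
proof -
  assume "trig_poly f"
  then obtain S a where "finite S" "f = (\<lambda>x. \<Sum>k\<in>S. a k * chr k x)" by (auto simp: trig_poly_def)
  then have "norm (f x) \<le> (\<Sum>k\<in>S. norm (a k))" for x
    by (auto intro!: sum_norm_le simp: norm_mult)
  then show ?thesis by blast
qed

section \<open>Square integrable functions on the torus\<close>

lemma sq_add_le: "(a + b)\<^sup>2 \<le> 2 * a\<^sup>2 + 2 * (b::real)\<^sup>2"
  using sum_squares_bound[of a b] by (simp add: power2_sum)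

text \<open>The analytic half of \<open>L2\<close>. Periodicity is recorded separately, since norms
  and inner products see only the cube.\<close>

definition sqint :: "(real ^ 'd \<Rightarrow> real) \<Rightarrow> bool" where
  "sqint f \<longleftrightarrow> f \<in> borel_measurable borel \<and> integrable tmeas (\<lambda>x. (f x)\<^sup>2)"

lemma sqint_measurable: "sqint f \<Longrightarrow> f \<in> borel_measurable borel"
  by (simp add: sqint_def)

lemma sqint_integrable_sq: "sqint f \<Longrightarrow> integrable tmeas (\<lambda>x. (f x)\<^sup>2)"
  by (simp add: sqint_def)

lemma sqint_integrable_mult:
  assumes "sqint f" "sqint g"
  shows "integrable tmeas (\<lambda>x. f x * g x)"
proof (rule Bochner_Integration.integrable_bound)
  show "integrable tmeas (\<lambda>x. (f x)\<^sup>2 + (g x)\<^sup>2)" using assms by (auto simp: sqint_def)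
  show "(\<lambda>x. f x * g x) \<in> borel_measurable tmeas" using assms by (auto simp: sqint_def)
  have "\<bar>a * b\<bar> \<le> a\<^sup>2 + b\<^sup>2" for a b :: real
    using sum_squares_bound[of a b] sum_squares_bound[of a "- b"] zero_le_power2[of a] zero_le_power2[of b]
    unfolding abs_le_iff by (simp add: power2_eq_square)
  then show "AE x in tmeas. norm (f x * g x) \<le> norm ((f x)\<^sup>2 + (g x)\<^sup>2)" by auto
qed

lemma sqint_add: assumes "sqint f" "sqint g" shows "sqint (\<lambda>x. f x + g x)"
proof -
  have "integrable tmeas (\<lambda>x. (f x)\<^sup>2 + (g x)\<^sup>2 + 2 * (f x * g x))"
    by (intro Bochner_Integration.integrable_add integrable_mult_right sqint_integrable_mult sqint_integrable_sq assms)
  then show ?thesis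
    using assms by (auto simp: sqint_def power2_sum mult.assoc)
qed

lemma sqint_scale: "sqint f \<Longrightarrow> sqint (\<lambda>x. c * f x)"
  unfolding sqint_def by (auto simp: power_mult_distrib)

lemma sqint_diff: assumes "sqint f" "sqint g" shows "sqint (\<lambda>x. f x - g x)"
  using sqint_add[OF assms(1) sqint_scale[OF assms(2), of "- 1"]] by simp

lemma sqint_zero: "sqint (\<lambda>x. 0)"
  by (simp add: sqint_def)

lemma sqint_sum: "(\<And>i. i \<in> I \<Longrightarrow> sqint (f i)) \<Longrightarrow> sqint (\<lambda>x. \<Sum>i\<in>I. f i x)"
  by (induction I rule: infinite_finite_induct) (auto intro: sqint_add sqint_zero)

lemma sqint_bounded:
  assumes [measurable]: "f \<in> borel_measurable borel" and "\<And>x. \<bar>f x\<bar> \<le> B"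
  shows "sqint f"
  unfolding sqint_def
proof (intro conjI assms(1) integrable_bounded_tmeas[of _ "B\<^sup>2"])
  show "norm ((f x)\<^sup>2) \<le> B\<^sup>2" for x
    using power_mono[OF assms(2)[of x] abs_ge_zero, of 2] by simp
qed measurable

definition trig_poly_real :: "(real ^ 'd \<Rightarrow> real) \<Rightarrow> bool" where
  "trig_poly_real p \<longleftrightarrow> trig_poly (\<lambda>x. complex_of_real (p x))"

lemma trig_poly_real_add: "trig_poly_real f \<Longrightarrow> trig_poly_real g \<Longrightarrow> trig_poly_real (\<lambda>x. f x + g x)"
  and trig_poly_real_mult: "trig_poly_real f \<Longrightarrow> trig_poly_real g \<Longrightarrow> trig_poly_real (\<lambda>x. f x * g x)"
  and trig_poly_real_const: "trig_poly_real (\<lambda>x. c)"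
  by (simp_all add: trig_poly_real_def trig_poly_add trig_poly_mult trig_poly_const)

lemma trig_poly_real_sum: "(\<And>i. i \<in> I \<Longrightarrow> trig_poly_real (f i)) \<Longrightarrow> trig_poly_real (\<lambda>x. \<Sum>i\<in>I. f i x)"
  unfolding trig_poly_real_def by (auto intro: trig_poly_sum)

lemma trig_poly_Re: 
  assumes "trig_poly f"
  shows "trig_poly_real (\<lambda>x. Re (f x))"
proof -
  obtain S a where S: "finite S" "f = (\<lambda>x. \<Sum>k\<in>S. a k * chr k x)" using assms by (auto simp: trig_poly_def)
  have "complex_of_real (Re (f x)) = (1/2) * f x + (1/2) * cnj (f x)" for x
    by (simp add: complex_eq_iff)
  also have "(1/2) * f x + (1/2) * cnj (f x)
      = (\<Sum>k\<in>S. (a k / 2) * chr k x) + (\<Sum>k\<in>S. (cnj (a k) / 2) * chr (- k) x)" for x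
    unfolding S by (simp add: chr_minus_freq sum_distrib_left)
  finally show ?thesis unfolding trig_poly_real_def
    by (simp only:) (intro trig_poly_add trig_poly_sum trig_poly_chr)
qed

lemma trig_poly_real_cases:
  assumes "trig_poly_real p"
  shows "periodic p" "continuous_on UNIV p" "p \<in> borel_measurable borel" "sqint p"
proof -
  have p: "p = (\<lambda>x. Re (complex_of_real (p x)))" by simp
  note t = assms[unfolded trig_poly_real_def]
  show "periodic p" using trig_poly_periodic[OF t] by (simp add: periodic_def)
  show c: "continuous_on UNIV p" by (subst p) (intro continuous_intros trig_poly_continuous[OF t])
  then show m: "p \<in> borel_measurable borel" by (rule borel_measurable_continuous_onI)
  from trig_poly_bounded[OF t] obtain B where "\<And>x. \<bar>p x\<bar> \<le> B" by auto
  then show "sqint p" by (rule sqint_bounded[OF m])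
qed

text \<open>A linear functional on \<open>complex ^ 'd\<close>, restricted to the product of
  circles, combines \<open>cos (x $ i)\<close> and \<open>sin (x $ i)\<close>, hence real parts of
  multiples of first-order characters. The class is closed under sums and products, so the
  polynomials supplied by Stone-Weierstrass become trigonometric.\<close>

lemma trig_poly_real_polynomial:
  fixes q :: "complex ^ 'd \<Rightarrow> real"
  assumes "real_polynomial_function q"
  shows "trig_poly_real (\<lambda>x. q (torus_map x))"
  using assms
proof induction
  case (linear f)
  interpret bounded_linear f by fact
  have "torus_map x = (\<Sum>i\<in>UNIV. cos (x $ i) *\<^sub>R axis i 1 + sin (x $ i) *\<^sub>R axis i \<i>)" for x :: "real ^ 'd"
    by (simp add: vec_eq_iff torus_map_def axis_def complex_eq_iff if_distrib sum.distrib sum.delta' cong: if_cong)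
  then have 1: "f (torus_map x) = (\<Sum>i\<in>UNIV. cos (x $ i) * f (axis i 1) + sin (x $ i) * f (axis i \<i>))" for x :: "real ^ 'd"
    by (simp add: sum add scaleR)
  have "freq (axis i 1) \<bullet> x = x $ i" for i and x :: "real ^ 'd"
    by (simp add: freq_def inner_vec_def axis_def if_distrib if_distribR sum.delta' cong: if_cong)
  then have 2: "f (torus_map x) = (\<Sum>i\<in>UNIV. Re (complex_of_real (f (axis i 1)) * chr (axis i 1) x)
      + Re ((- \<i> * complex_of_real (f (axis i \<i>))) * chr (axis i 1) x))" for x :: "real ^ 'd"
    unfolding 1 by (simp add: chr_def algebra_simps)
  show ?case
    unfolding 2 by (intro trig_poly_real_sum trig_poly_real_add trig_poly_Re trig_poly_chr)
next
  case (const c) show ?case by (rule trig_poly_real_const)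
next
  case (add f g) then show ?case by (auto intro: trig_poly_real_add)
next
  case (mult f g) then show ?case by (auto intro: trig_poly_real_mult)
qed

section \<open>Mean square closure of the trigonometric polynomials\<close>

definition trig_approx :: "(real ^ 'd \<Rightarrow> real) \<Rightarrow> bool" where
  "trig_approx f \<longleftrightarrow> sqint f \<and> (\<forall>e>0. \<exists>p. trig_poly_real p \<and> (LINT x|tmeas. (f x - p x)\<^sup>2) < e)"

lemma integral_sq_add_le:
  assumes "sqint f" "sqint g"
  shows "(LINT x|tmeas. (f x + g x)\<^sup>2) \<le> 2 * (LINT x|tmeas. (f x)\<^sup>2) + 2 * (LINT x|tmeas. (g x)\<^sup>2)"
proof -
  have "(LINT x|tmeas. (f x + g x)\<^sup>2) \<le> (LINT x|tmeas. 2 * (f x)\<^sup>2 + 2 * (g x)\<^sup>2)"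
    using sqint_add[OF assms] assms
    by (intro integral_mono) (auto simp: sqint_def sq_add_le)
  also have "\<dots> = 2 * (LINT x|tmeas. (f x)\<^sup>2) + 2 * (LINT x|tmeas. (g x)\<^sup>2)"
    using assms by (simp add: sqint_def)
  finally show ?thesis .
qed

lemma trig_approx_limit:
  assumes "sqint f" "\<And>e. e > 0 \<Longrightarrow> \<exists>g. trig_approx g \<and> (LINT x|tmeas. (f x - g x)\<^sup>2) < e"
  shows "trig_approx f"
  unfolding trig_approx_def
proof (intro conjI allI impI assms(1))
  fix e :: real assume "e > 0"
  \<comment> \<open>Quarters, because \<open>integral_sq_add_le\<close> bounds the mean square of a
    sum with the factor 2 on each of two terms.\<close>
  then obtain g where g: "trig_approx g" "(LINT x|tmeas. (f x - g x)\<^sup>2) < e / 4"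
    using assms(2)[of "e / 4"] by auto
  then obtain p where p: "trig_poly_real p" "(LINT x|tmeas. (g x - p x)\<^sup>2) < e / 4"
    using \<open>e > 0\<close> unfolding trig_approx_def by (meson divide_pos_pos zero_less_numeral)
  have "(LINT x|tmeas. (f x - p x)\<^sup>2) = (LINT x|tmeas. ((f x - g x) + (g x - p x))\<^sup>2)" by simp
  also have "\<dots> \<le> 2 * (LINT x|tmeas. (f x - g x)\<^sup>2) + 2 * (LINT x|tmeas. (g x - p x)\<^sup>2)"
    using g p assms by (intro integral_sq_add_le sqint_diff) (auto simp: trig_approx_def trig_poly_real_cases)
  finally show "\<exists>p. trig_poly_real p \<and> (LINT x|tmeas. (f x - p x)\<^sup>2) < e"
    using g p by (intro exI[of _ p]) auto
qed

lemma trig_approx_trig_poly: "trig_poly_real p \<Longrightarrow> trig_approx p"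
  unfolding trig_approx_def by (auto simp: trig_poly_real_cases intro!: exI[of _ p])

lemma trig_approx_add:
  assumes "trig_approx f" "trig_approx g"
  shows "trig_approx (\<lambda>x. f x + g x)"
  unfolding trig_approx_def
proof (intro conjI allI impI)
  show "sqint (\<lambda>x. f x + g x)" using assms by (auto simp: trig_approx_def intro: sqint_add)
  fix e :: real assume "e > 0"
  obtain p where p: "trig_poly_real p" "(LINT x|tmeas. (f x - p x)\<^sup>2) < e / 4"
    using assms(1) \<open>e > 0\<close> unfolding trig_approx_def by (meson divide_pos_pos zero_less_numeral)
  obtain q where q: "trig_poly_real q" "(LINT x|tmeas. (g x - q x)\<^sup>2) < e / 4"
    using assms(2) \<open>e > 0\<close> unfolding trig_approx_def by (meson divide_pos_pos zero_less_numeral)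
  have "(LINT x|tmeas. (f x + g x - (p x + q x))\<^sup>2) = (LINT x|tmeas. ((f x - p x) + (g x - q x))\<^sup>2)"
    by (simp add: algebra_simps)
  also have "\<dots> \<le> 2 * (LINT x|tmeas. (f x - p x)\<^sup>2) + 2 * (LINT x|tmeas. (g x - q x)\<^sup>2)"
    using p q assms by (intro integral_sq_add_le sqint_diff) (auto simp: trig_approx_def trig_poly_real_cases)
  finally show "\<exists>p. trig_poly_real p \<and> (LINT x|tmeas. (f x + g x - p x)\<^sup>2) < e"
    using p q by (intro exI[of _ "\<lambda>x. p x + q x"]) (auto intro: trig_poly_real_add)
qed

lemma trig_approx_scale:
  assumes "trig_approx f"
  shows "trig_approx (\<lambda>x. c * f x)"
  unfolding trig_approx_def
proof (intro conjI allI impI)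
  show "sqint (\<lambda>x. c * f x)" using assms by (auto simp: trig_approx_def intro: sqint_scale)
  fix e :: real assume "e > 0"
  \<comment> \<open>The summand 1 keeps the denominator positive when \<open>c = 0\<close>.\<close>
  have "e / (c\<^sup>2 + 1) > 0" using \<open>e > 0\<close> by (intro divide_pos_pos) (auto intro: add_nonneg_pos)
  then obtain p where p: "trig_poly_real p" "(LINT x|tmeas. (f x - p x)\<^sup>2) < e / (c\<^sup>2 + 1)"
    using assms(1) unfolding trig_approx_def by meson
  have "(LINT x|tmeas. (c * f x - c * p x)\<^sup>2) = c\<^sup>2 * (LINT x|tmeas. (f x - p x)\<^sup>2)"
    by (simp add: power_mult_distrib flip: right_diff_distrib)
  also have "\<dots> \<le> (c\<^sup>2 + 1) * (LINT x|tmeas. (f x - p x)\<^sup>2)"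
    by (intro mult_right_mono) auto
  also have "\<dots> < e"
    using p(2) by (subst (asm) pos_less_divide_eq) (auto simp: mult.commute add_nonneg_pos)
  finally show "\<exists>p. trig_poly_real p \<and> (LINT x|tmeas. (c * f x - p x)\<^sup>2) < e"
    using p by (intro exI[of _ "\<lambda>x. c * p x"]) (auto intro: trig_poly_real_mult trig_poly_real_const)
qed

lemma trig_approx_zero: "trig_approx (\<lambda>x. 0)"
  by (intro trig_approx_trig_poly trig_poly_real_const)

lemma trig_approx_sum: "(\<And>i. i \<in> I \<Longrightarrow> trig_approx (f i)) \<Longrightarrow> trig_approx (\<lambda>x. \<Sum>i\<in>I. f i x)"
  by (induction I rule: infinite_finite_induct) (auto intro: trig_approx_add trig_approx_zero)

lemma compact_torus_map: "compact (torus_map ` torus)"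
  unfolding torus_def by (intro compact_continuous_image continuous_intros compact_cbox)

lemma AE_tmeas_torus: "AE x in tmeas. x \<in> torus"
  unfolding tmeas_def by (subst AE_density) (auto simp: indicator_def)

text \<open>The approximation is uniform on the compact image of the cube, and almost every point
  for \<open>tmeas\<close> lies in the cube. Boundedness of \<open>u\<close> gives square
  integrability.\<close>

lemma trig_approx_continuous:
  fixes u :: "complex ^ 'd \<Rightarrow> real"
  assumes u: "continuous_on UNIV u" and b: "\<And>z. \<bar>u z\<bar> \<le> B"
  shows "trig_approx (\<lambda>x. u (torus_map x))"
  unfolding trig_approx_def
proof (intro conjI allI impI)
  have [measurable]: "u \<in> borel_measurable borel" using u by (rule borel_measurable_continuous_onI)
  show s: "sqint (\<lambda>x. u (torus_map x))"
    by (rule sqint_bounded[of _ B]) (use b in auto)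
  fix e :: real assume "e > 0"
  \<comment> \<open>A uniform error of \<open>sqrt (e / 2)\<close> gives a mean square of at most
    \<open>e / 2\<close>, which leaves the final inequality strict.\<close>
  then have "sqrt (e / 2) > 0" by simp
  then obtain q where q: "polynomial_function q" "\<And>z. z \<in> torus_map ` torus \<Longrightarrow> norm (u z - q z) < sqrt (e / 2)"
    using Stone_Weierstrass_polynomial_function[OF compact_torus_map continuous_on_subset[OF u subset_UNIV]] by metis
  then have "real_polynomial_function q"
    using real_polynomial_function_eq by auto
  then have t: "trig_poly_real (\<lambda>x. q (torus_map x))" by (rule trig_poly_real_polynomial)
  have "(LINT x|tmeas. (u (torus_map x) - q (torus_map x))\<^sup>2) \<le> (LINT x|(tmeas :: (real ^ 'd) measure). e / 2)"
  proof (intro integral_mono_AE)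
    show "integrable tmeas (\<lambda>x. (u (torus_map x) - q (torus_map x))\<^sup>2)"
      using sqint_diff[OF s trig_poly_real_cases(4)[OF t]] by (simp add: sqint_def)
    show "AE x in tmeas. (u (torus_map x) - q (torus_map x))\<^sup>2 \<le> e / 2"
      using AE_tmeas_torus
    proof eventually_elim
      case (elim x)
      then have "\<bar>u (torus_map x) - q (torus_map x)\<bar> \<le> sqrt (e / 2)"
        using q(2)[of "torus_map x"] by (auto simp: less_imp_le)
      then have "\<bar>u (torus_map x) - q (torus_map x)\<bar>\<^sup>2 \<le> (sqrt (e / 2))\<^sup>2"
        by (intro power_mono) auto
      then show ?case using \<open>e > 0\<close> by simp
    qed
  qed auto
  also have "\<dots> < e" using \<open>e > 0\<close> by simp
  finally show "\<exists>p. trig_poly_real p \<and> (LINT x|tmeas. (u (torus_map x) - p x)\<^sup>2) < e"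
    using t by auto
qed

lemma trig_approx_dominated:
  assumes f: "sqint f" and g: "\<And>n. trig_approx (g n)" and w: "sqint w"
    and lim: "\<And>x. (\<lambda>n. g n x) \<longlonglongrightarrow> f x" and dom: "\<And>n x. \<bar>g n x\<bar> \<le> w x"
  shows "trig_approx f"
proof (rule trig_approx_limit[OF f])
  fix e :: real assume "e > 0"
  have [measurable]: "f \<in> borel_measurable borel" "g n \<in> borel_measurable borel" for n
    using f g by (auto simp: sqint_def trig_approx_def)
  have bf: "\<bar>f x\<bar> \<le> w x" for x
    by (rule LIMSEQ_le_const2[OF tendsto_rabs[OF lim]]) (use dom in auto)
  have "(\<lambda>n. LINT x|tmeas. (f x - g n x)\<^sup>2) \<longlonglongrightarrow> (LINT x|(tmeas :: (real ^ 'a) measure). 0)"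
  proof (rule integral_dominated_convergence)
    \<comment> \<open>The limit inherits the bound \<open>w\<close>, so the difference is at most
      \<open>2 * w x\<close>, and this is the square of that.\<close>
    show "integrable tmeas (\<lambda>x. 4 * (w x)\<^sup>2)" using w by (auto simp: sqint_def)
    have "(\<lambda>n. (f x - g n x)\<^sup>2) \<longlonglongrightarrow> (f x - f x)\<^sup>2" for x
      by (intro tendsto_intros lim)
    then show "AE x in tmeas. (\<lambda>n. (f x - g n x)\<^sup>2) \<longlonglongrightarrow> 0" by simp
    show "AE x in tmeas. norm ((f x - g n x)\<^sup>2) \<le> 4 * (w x)\<^sup>2" for n
    proof (rule AE_I2)
      fix x
      have "\<bar>f x - g n x\<bar> \<le> 2 * w x" using bf[of x] dom[of n x] by linarith
      then have "\<bar>f x - g n x\<bar>\<^sup>2 \<le> (2 * w x)\<^sup>2" by (intro power_mono) auto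
      then show "norm ((f x - g n x)\<^sup>2) \<le> 4 * (w x)\<^sup>2" by (simp add: power_mult_distrib)
    qed
  qed auto
  then have "\<forall>\<^sub>F n in sequentially. (LINT x|tmeas. (f x - g n x)\<^sup>2) < e"
    using \<open>e > 0\<close> by (auto dest: order_tendstoD(2))
  then obtain n where "(LINT x|tmeas. (f x - g n x)\<^sup>2) < e"
    by (auto simp: eventually_sequentially)
  with g show "\<exists>g. trig_approx g \<and> (LINT x|tmeas. (f x - g x)\<^sup>2) < e" by blast
qed

lemma trig_approx_closed:
  fixes C :: "(complex ^ 'd) set"
  assumes C: "closed C"
  shows "trig_approx (\<lambda>x. indicator C (torus_map x))"
\<comment> \<open>\<open>infdist\<close> to the empty set is 0, so the tent functions below would
  tend to 1 instead of 0.\<close>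
proof (cases "C = {}")
  case True
  then show ?thesis using trig_approx_zero by simp
next
  case False
  have [measurable]: "C \<in> sets borel" using C by auto
  show ?thesis
  proof (rule trig_approx_dominated[where w="\<lambda>_. 1" and g="\<lambda>n x. max 0 (1 - real n * infdist (torus_map x) C)"])
    show "trig_approx (\<lambda>x. max 0 (1 - real n * infdist (torus_map x) C))" for n
      by (rule trig_approx_continuous[of "\<lambda>z. max 0 (1 - real n * infdist z C)" 1])
         (auto intro!: continuous_intros simp: infdist_nonneg)
    show "(\<lambda>n. max 0 (1 - real n * infdist (torus_map x) C)) \<longlonglongrightarrow> indicator C (torus_map x)" for x
    proof (cases "torus_map x \<in> C")
      case False
      then have "infdist (torus_map x) C > 0"
        using C \<open>C \<noteq> {}\<close> infdist_pos_not_in_closed by blast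
      then obtain N where N: "1 < real N * infdist (torus_map x) C"
        using reals_Archimedean3 by blast
      have "max 0 (1 - real n * infdist (torus_map x) C) = 0" if "n \<ge> N" for n
      proof -
        have "real N * infdist (torus_map x) C \<le> real n * infdist (torus_map x) C"
          using that by (intro mult_right_mono) (auto simp: infdist_nonneg)
        with N show ?thesis by simp
      qed
      then have "\<forall>\<^sub>F n in sequentially. max 0 (1 - real n * infdist (torus_map x) C) = 0"
        by (auto simp: eventually_sequentially)
      then show ?thesis using False by (auto intro: tendsto_eventually)
    qed auto
    show "\<bar>max 0 (1 - real n * infdist (torus_map x) C)\<bar> \<le> 1" for n x
      by (auto simp: infdist_nonneg)
    show "sqint (\<lambda>x. indicator C (torus_map x))" by (rule sqint_bounded[of _ 1]) auto
    show "sqint (\<lambda>_. 1)" by (rule sqint_bounded[of _ 1]) auto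
  qed
qed

text \<open>Inner regularity of the image measure replaces a Borel set by a compact subset; the mean
  square distance of the two indicators is the measure of the difference.\<close>

lemma trig_approx_borel:
  fixes A :: "(complex ^ 'd) set"
  assumes [measurable]: "A \<in> sets borel"
  shows "trig_approx (\<lambda>x. indicator A (torus_map x))"
proof (rule trig_approx_limit)
  show "sqint (\<lambda>x. indicator A (torus_map x))" by (rule sqint_bounded[of _ 1]) auto
  fix e :: real assume e: "e > 0"
  let ?\<nu> = "distr tmeas borel torus_map :: (complex ^ 'd) measure"
  interpret \<nu>: finite_measure ?\<nu> by (rule tm.finite_measure_distr) simp
  have "\<exists>K. K \<subseteq> A \<and> compact K \<and> measure ?\<nu> A < measure ?\<nu> K + e"
  \<comment> \<open>In \<open>ennreal\<close>, subtracting \<open>e\<close> from 0 gives 0 again, so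
    a null set offers no strict inequality to start from; the empty compact set serves
    there.\<close>
  proof (cases "emeasure ?\<nu> A = 0")
    case True
    then show ?thesis using e by (intro exI[of _ "{}"]) (auto simp: measure_def)
  next
    case False
    have "emeasure ?\<nu> A - e < emeasure ?\<nu> A"
    proof (rule ennreal_between)
      show "emeasure ?\<nu> A < top" using \<nu>.emeasure_finite[of A] top.not_eq_extremum by blast
    qed (use e False in \<open>simp_all add: zero_less_iff_neq_zero\<close>)
    also have "emeasure ?\<nu> A = (SUP K \<in> {K. K \<subseteq> A \<and> compact K}. emeasure ?\<nu> K)"
      by (rule inner_regular) auto
    finally obtain K where K: "K \<subseteq> A" "compact K" "emeasure ?\<nu> A - e < emeasure ?\<nu> K"
      unfolding less_SUP_iff by auto
    then have "ennreal (measure ?\<nu> A - e) < ennreal (measure ?\<nu> K)"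
      using e by (simp only: \<nu>.emeasure_eq_measure ennreal_minus)
    then have "measure ?\<nu> A - e < measure ?\<nu> K"
      by (meson ennreal_leI not_less)
    then show ?thesis
      using K by (intro exI[of _ K]) auto
  qed
  then obtain K where K: "K \<subseteq> A" "compact K" "measure ?\<nu> A < measure ?\<nu> K + e" by blast
  then have [measurable]: "K \<in> sets borel" by (intro borel_closed compact_imp_closed)
  have "measure ?\<nu> (A - K) < e"
    using K by (subst \<nu>.finite_measure_Diff) auto
  have "(LINT x|tmeas. (indicator A (torus_map x) - indicator K (torus_map x))\<^sup>2)
      = (LINT x|tmeas. (indicator (A - K) (torus_map x) :: real))"
    using K by (intro Bochner_Integration.integral_cong) (auto simp: indicator_def)
  also have "\<dots> = (LINT z|?\<nu>. indicator (A - K) z)"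
    by (subst integral_distr) auto
  also have "\<dots> = measure ?\<nu> (A - K)"
    by simp
  finally show "\<exists>g. trig_approx g \<and> (LINT x|tmeas. (indicator A (torus_map x) - g x)\<^sup>2) < e"
    using \<open>measure ?\<nu> (A - K) < e\<close> trig_approx_closed[OF compact_imp_closed[OF K(2)]]
    by (intro exI[of _ "\<lambda>x. indicator K (torus_map x)"]) simp
qed

text \<open>Simple functions converging to \<open>f (torus_arg z)\<close> can be kept below twice
  its modulus, and their level sets are Borel sets in \<open>complex ^ 'd\<close>, which makes
  dominated convergence available.\<close>

theorem trig_poly_dense:
  assumes f: "sqint f" and p: "periodic f"
  shows "trig_approx f"
proof -
  let ?F = "\<lambda>z. f (torus_arg z)"
  have [measurable]: "f \<in> borel_measurable borel" using f by (simp add: sqint_def)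
  obtain s where s: "\<And>i. simple_function borel (s i)" "\<And>z. (\<lambda>i. s i z) \<longlonglongrightarrow> ?F z"
      "\<And>i z. \<bar>s i z\<bar> \<le> 2 * \<bar>?F z\<bar>"
  proof -
    have "?F \<in> borel_measurable borel" by measurable
    from borel_measurable_implies_sequence_metric[OF this, of 0]
    obtain F where F: "\<forall>i. simple_function borel (F i)" "\<forall>z\<in>space borel. (\<lambda>i. F i z) \<longlonglongrightarrow> ?F z"
      "\<forall>i. \<forall>z\<in>space borel. dist (F i z) 0 \<le> 2 * dist (?F z) 0" by blast
    show ?thesis
      by (rule that[of F]) (use F in simp_all)
  qed
  show ?thesis
  proof (rule trig_approx_dominated[where w="\<lambda>x. 2 * \<bar>f x\<bar>" and g="\<lambda>n x. s n (torus_map x)"])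
    show "sqint (\<lambda>x. 2 * \<bar>f x\<bar>)" using f by (intro sqint_scale) (auto simp: sqint_def)
    show "trig_approx (\<lambda>x. s n (torus_map x))" for n
    proof -
      have "s n z = (\<Sum>y\<in>range (s n). y * indicator (s n -` {y}) z)" for z
        by (rule trans[OF simple_function_indicator_representation_banach[OF s(1), of z n]])
           (simp_all add: mult.commute)
      then have eq: "(\<lambda>x. s n (torus_map x)) = (\<lambda>x. \<Sum>y\<in>range (s n). y * indicator (s n -` {y}) (torus_map x))"
        by (intro ext)
      have "s n -` {y} \<in> sets borel" for y
        using simple_functionD(2)[OF s(1), of n "{y}"] by simp
      then show ?thesis unfolding eq
        by (intro trig_approx_sum trig_approx_scale trig_approx_borel)
    qed
    show "(\<lambda>n. s n (torus_map x)) \<longlonglongrightarrow> f x" for x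
      using s(2)[of "torus_map x"] by (simp add: periodic_torus_arg[OF p])
    show "\<bar>s n (torus_map x)\<bar> \<le> 2 * \<bar>f x\<bar>" for n x
      using s(3)[of n "torus_map x"] by (simp add: periodic_torus_arg[OF p])
  qed (rule f)
qed

section \<open>Convolution with a kernel\<close>

lemma L2_iff: "f \<in> L2 \<longleftrightarrow> periodic f \<and> sqint f"
proof (cases "f \<in> borel_measurable borel")
  case True
  then have "(\<lambda>x. (f x)\<^sup>2) \<in> borel_measurable borel" by measurable
  with True show ?thesis by (simp add: L2_def torus_fun_iff_periodic sqint_def integrable_tmeas)
qed (simp add: L2_def sqint_def)

lemma L2_D: assumes "f \<in> L2" shows "periodic f" "sqint f" "f \<in> borel_measurable borel"
  using assms by (auto simp: L2_iff sqint_def)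

lemma trig_poly_real_L2: "trig_poly_real p \<Longrightarrow> p \<in> L2"
  by (simp add: L2_iff trig_poly_real_cases)

lemma L2_diff: "f \<in> L2 \<Longrightarrow> g \<in> L2 \<Longrightarrow> (\<lambda>x. f x - g x) \<in> L2"
  by (auto simp: L2_iff periodic_def intro: sqint_diff)

lemma L2_scale: "f \<in> L2 \<Longrightarrow> (\<lambda>x. c * f x) \<in> L2"
  by (auto simp: L2_iff periodic_def intro: sqint_scale)

lemma L2_sum: "(\<And>i. i \<in> I \<Longrightarrow> f i \<in> L2) \<Longrightarrow> (\<lambda>x. \<Sum>i\<in>I. f i x) \<in> L2"
  by (auto simp: L2_iff periodic_def intro: sqint_sum)

lemma l2norm_eq:
  fixes f :: "real ^ 'd \<Rightarrow> real"
  assumes "f \<in> borel_measurable borel"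
  shows "l2norm f = sqrt (LINT x|tmeas. (f x)\<^sup>2)"
proof -
  let ?c = "(2 * pi) ^ CARD('d)"
  have "(2 * pi) powr (- real CARD('d) / 2) = sqrt ((2 * pi) powr (- real CARD('d)))"
    by (simp add: powr_half_sqrt[symmetric] powr_powr)
  also have "\<dots> = sqrt (1 / ?c)"
    by (simp add: powr_minus powr_realpow divide_simps)
  finally have "l2norm f = sqrt ((1 / ?c) * (LINT x:torus|lborel. (f x)\<^sup>2))"
    by (simp only: l2norm_def real_sqrt_mult)
  also have "(1 / ?c) * (LINT x:torus|lborel. (f x)\<^sup>2) = (LINT x|tmeas. (f x)\<^sup>2)"
    using assms by (subst integral_tmeas) auto
  finally show ?thesis .
qed

lemma conv_eq:
  fixes f g :: "real ^ 'd \<Rightarrow> real"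
  assumes [measurable]: "f \<in> borel_measurable borel" "g \<in> borel_measurable borel"
  shows "conv f g x = (LINT y|tmeas. f y * g (x - y))"
  by (subst integral_tmeas) (auto simp: conv_def powr_minus powr_realpow divide_simps)

lemma integral_mult_le_l2norm:
  assumes "sqint f" "sqint g"
  shows "\<bar>LINT x|tmeas. f x * g x\<bar> \<le> l2norm f * l2norm g"
proof -
  let ?a = "LINT x|tmeas. (f x)\<^sup>2" and ?b = "LINT x|tmeas. f x * g x" and ?c = "LINT x|tmeas. (g x)\<^sup>2"
  have "0 \<le> ?a * t\<^sup>2 + 2 * ?b * t + ?c" for t
  proof -
    have "0 \<le> (LINT x|tmeas. (t * f x + g x)\<^sup>2)" by simp
    also have "(LINT x|tmeas. (t * f x + g x)\<^sup>2) = (LINT x|tmeas. t\<^sup>2 * (f x)\<^sup>2 + 2 * t * (f x * g x) + (g x)\<^sup>2)"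
      by (rule Bochner_Integration.integral_cong) (auto simp: power2_sum power_mult_distrib algebra_simps)
    also have "\<dots> = t\<^sup>2 * ?a + 2 * t * ?b + ?c"
      using sqint_integrable_mult[OF assms] assms[THEN sqint_integrable_sq] by simp
    finally show ?thesis by (simp add: algebra_simps)
  qed
  note q = this
  have a0: "0 \<le> ?a" and c0: "0 \<le> ?c" by auto
  have "?b\<^sup>2 \<le> ?a * ?c"
  proof (cases "?a = 0")
    case True
    have "?b = 0"
    proof (rule ccontr)
      assume "?b \<noteq> 0"
      \<comment> \<open>With a vanishing leading coefficient the quadratic is affine in
        \<open>t\<close>, and this value of \<open>t\<close> would make it equal to -1.\<close>
      then show False using q[of "- (?c + 1) / (2 * ?b)"] True by (simp add: field_simps)
    qed
    then show ?thesis using True by simp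
  next
    case False
    with a0 have "?a > 0" by linarith
    \<comment> \<open>Evaluation at the vertex of the parabola.\<close>
    have "0 \<le> (?a * (- ?b / ?a)\<^sup>2 + 2 * ?b * (- ?b / ?a) + ?c) * ?a"
      using q[of "- ?b / ?a"] a0 by (rule mult_nonneg_nonneg)
    also have "\<dots> = ?a * ?c - ?b\<^sup>2"
      using \<open>?a > 0\<close> by (simp add: field_simps power2_eq_square)
    finally show ?thesis by simp
  qed
  then have "sqrt (?b\<^sup>2) \<le> sqrt (?a * ?c)" by (rule real_sqrt_le_mono)
  then show ?thesis using assms by (simp add: l2norm_eq sqint_measurable real_sqrt_mult)
qed

lemma l2norm_nonneg: "l2norm f \<ge> 0"
  unfolding l2norm_def set_lebesgue_integral_def by (intro mult_nonneg_nonneg) (auto intro!: integral_nonneg_AE)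

lemma l2norm_sq:
  assumes "f \<in> borel_measurable borel"
  shows "(l2norm f)\<^sup>2 = (LINT x|tmeas. (f x)\<^sup>2)"
  using assms by (simp add: l2norm_eq)

lemma l2norm_triangle:
  assumes "sqint f" "sqint g"
  shows "l2norm (\<lambda>x. f x + g x) \<le> l2norm f + l2norm g"
proof (rule power2_le_imp_le)
  have [measurable]: "f \<in> borel_measurable borel" "g \<in> borel_measurable borel"
    using assms by (auto simp: sqint_def)
  have "(l2norm (\<lambda>x. f x + g x))\<^sup>2 = (LINT x|tmeas. (f x)\<^sup>2 + (g x)\<^sup>2 + 2 * (f x * g x))"
    by (subst l2norm_sq) (auto simp: power2_sum mult.assoc)
  also have "\<dots> = (l2norm f)\<^sup>2 + (l2norm g)\<^sup>2 + 2 * (LINT x|tmeas. f x * g x)"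
    using assms sqint_integrable_mult[OF assms] assms[THEN sqint_integrable_sq] by (simp add: l2norm_sq)
  also have "\<dots> \<le> (l2norm f + l2norm g)\<^sup>2"
    using integral_mult_le_l2norm[OF assms] by (simp add: power2_sum)
  finally show "(l2norm (\<lambda>x. f x + g x))\<^sup>2 \<le> (l2norm f + l2norm g)\<^sup>2" .
qed (simp add: l2norm_nonneg)

lemma l2norm_le_bound:
  fixes f :: "real ^ 'd \<Rightarrow> real"
  assumes "f \<in> borel_measurable borel" "AE x in tmeas. \<bar>f x\<bar> \<le> B"
  shows "l2norm f \<le> B"
proof -
  have "AE x in (tmeas :: (real ^ 'd) measure). 0 \<le> B"
    using assms(2) by eventually_elim linarith
  then have B: "0 \<le> B"
    using AE_iff_measurable[of UNIV "tmeas :: (real ^ 'd) measure" "\<lambda>_. 0 \<le> B"] emeasure_tmeas[where 'd='d] 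
    by (cases "0 \<le> B") auto
  have sq: "AE x in tmeas. (f x)\<^sup>2 \<le> B\<^sup>2"
    using assms(2) by eventually_elim (metis abs_ge_zero power2_abs power_mono)
  have "(LINT x|tmeas. (f x)\<^sup>2) \<le> (LINT x|(tmeas :: (real ^ 'd) measure). B\<^sup>2)"
    using sq assms(1)
    by (intro integral_mono_AE tm.integrable_const_bound[of _ "B\<^sup>2"]) auto
  then show ?thesis using assms(1) B by (simp add: l2norm_eq real_le_lsqrt)
qed

lemma trig_poly_dense_l2norm:
  assumes "g \<in> L2" "e > 0"
  obtains p where "trig_poly_real p" "l2norm (\<lambda>x. g x - p x) < e"
proof -
  have "trig_approx g" using assms by (intro trig_poly_dense) (auto simp: L2_D)
  then obtain p where p: "trig_poly_real p" "(LINT x|tmeas. (g x - p x)\<^sup>2) < e\<^sup>2"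
    using assms(2) unfolding trig_approx_def by (meson zero_less_power)
  have "l2norm (\<lambda>x. g x - p x) < e"
    using L2_D(3)[OF L2_diff[OF assms(1) trig_poly_real_L2[OF p(1)]]] p assms(2)
    by (simp add: l2norm_eq real_less_lsqrt)
  with p that show ?thesis by blast
qed

section \<open>Fourier coefficients, translation and continuity of convolution\<close>

definition coef :: "(real ^ 'd \<Rightarrow> real) \<Rightarrow> int ^ 'd \<Rightarrow> complex" where
  "coef f k = (LINT x|tmeas. complex_of_real (f x) * chr k x)"

lemma sqint_integrable: "sqint f \<Longrightarrow> integrable tmeas f"
  using sqint_integrable_mult[of f "\<lambda>_. 1"] sqint_bounded[of "\<lambda>_. 1" 1] by simp

lemma integrable_mult_chr:
  assumes "sqint f"
  shows "integrable tmeas (\<lambda>x. complex_of_real (f x) * chr k x)"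
proof (rule Bochner_Integration.integrable_bound)
  show "integrable tmeas f" using assms by (rule sqint_integrable)
  show "(\<lambda>x. complex_of_real (f x) * chr k x) \<in> borel_measurable tmeas"
    using sqint_measurable[OF assms] by measurable
qed (auto simp: norm_mult)

lemma coef_diff:
  "sqint f \<Longrightarrow> sqint g \<Longrightarrow> coef (\<lambda>x. f x - g x) k = coef f k - coef g k"
  by (simp add: coef_def integrable_mult_chr left_diff_distrib)

lemma norm_coef_le:
  fixes f :: "real ^ 'd \<Rightarrow> real"
  assumes "sqint f"
  shows "norm (coef f k) \<le> l2norm f"
proof -
  have one: "sqint (\<lambda>_. 1 :: real)" by (rule sqint_bounded[of _ 1]) auto
  have abs: "sqint (\<lambda>x. \<bar>f x\<bar>)" using assms by (auto simp: sqint_def)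
  have "norm (coef f k) \<le> (LINT x|tmeas. norm (complex_of_real (f x) * chr k x))"
    unfolding coef_def by (rule integral_norm_bound)
  also have "\<dots> = (LINT x|tmeas. \<bar>f x\<bar> * 1)" by (simp add: norm_mult)
  also have "\<dots> \<le> l2norm (\<lambda>x. \<bar>f x\<bar>) * l2norm (\<lambda>_::real ^ 'd. 1)"
    using integral_mult_le_l2norm[OF abs one] by simp
  also have "\<dots> = l2norm f"
    using assms abs by (simp add: l2norm_eq sqint_measurable)
  finally show ?thesis .
qed

text \<open>The frequency changes sign because \<open>coef\<close> integrates against
  \<open>chr m\<close> itself and not against its conjugate.\<close>

lemma coef_trig_poly:
  fixes p :: "real ^ 'd \<Rightarrow> real"
  assumes "finite S" "\<And>x. complex_of_real (p x) = (\<Sum>k\<in>S. a k * chr k x)"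
  shows "coef p m = (if - m \<in> S then a (- m) else 0)"
proof -
  have i: "integrable tmeas (\<lambda>x. chr k x)" for k :: "int ^ 'd"
    by (rule integrable_bounded_tmeas[of _ 1]) auto
  have "coef p m = (LINT x|tmeas. (\<Sum>k\<in>S. a k * chr (k + m) x))"
    by (simp add: coef_def assms(2) sum_distrib_right chr_add_freq mult.assoc)
  also have "\<dots> = (\<Sum>k\<in>S. a k * (if k = - m then 1 else 0))"
    by (simp add: i integral_chr eq_neg_iff_add_eq_0)
  also have "\<dots> = (if - m \<in> S then a (- m) else 0)"
    using assms(1) by (simp add: if_distrib sum.delta cong: if_cong)
  finally show ?thesis .
qed

lemma integral_norm_trig_poly:
  fixes a :: "int ^ 'd \<Rightarrow> complex"
  assumes "finite S"
  shows "(LINT x|tmeas. (norm (\<Sum>k\<in>S. a k * chr k x))\<^sup>2) = (\<Sum>k\<in>S. (norm (a k))\<^sup>2)"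
proof -
  have i: "integrable tmeas (\<lambda>x. chr k x)" for k :: "int ^ 'd"
    by (rule integrable_bounded_tmeas[of _ 1]) auto
  have "complex_of_real ((norm (\<Sum>k\<in>S. a k * chr k x))\<^sup>2) = (\<Sum>k\<in>S. \<Sum>l\<in>S. a k * cnj (a l) * chr (k + - l) x)" for x
    unfolding complex_norm_square cnj_sum sum_product chr_add_freq chr_minus_freq
    by (simp add: mult_ac)
  then have "complex_of_real (LINT x|tmeas. (norm (\<Sum>k\<in>S. a k * chr k x))\<^sup>2)
     = (LINT x|tmeas. (\<Sum>k\<in>S. \<Sum>l\<in>S. a k * cnj (a l) * chr (k + - l) x))"
    by (simp only: integral_complex_of_real[symmetric])
  also have "\<dots> = (\<Sum>k\<in>S. \<Sum>l\<in>S. a k * cnj (a l) * (if k = l then 1 else 0))"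
    by (simp add: i integral_chr)
  also have "\<dots> = (\<Sum>k\<in>S. a k * cnj (a k))"
    using assms by (simp add: if_distrib sum.delta' cong: if_cong)
  also have "\<dots> = complex_of_real (\<Sum>k\<in>S. (norm (a k))\<^sup>2)"
    by (simp only: of_real_sum complex_norm_square)
  finally show ?thesis using of_real_eq_iff by blast
qed

lemma sqint_reflect:
  assumes "g \<in> L2"
  shows "sqint (\<lambda>y. g (x - y))" "l2norm (\<lambda>y. g (x - y)) = l2norm g"
proof -
  have [measurable]: "g \<in> borel_measurable borel" using assms by (rule L2_D)
  have p: "periodic (\<lambda>y. (g y)\<^sup>2)" using L2_D(1)[OF assms] by (simp add: periodic_def)
  show "sqint (\<lambda>y. g (x - y))"
    using integrable_tmeas_affine[OF _ p, of "- 1" x] sqint_integrable_sq[OF L2_D(2)[OF assms]] by (simp add: sqint_def)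
  show "l2norm (\<lambda>y. g (x - y)) = l2norm g"
    using integral_tmeas_affine[OF _ p, of "- 1" x] by (simp add: l2norm_eq)
qed

lemma L2_translate:
  assumes "g \<in> L2"
  shows "(\<lambda>x. g (x - y)) \<in> L2"
proof -
  have [measurable]: "g \<in> borel_measurable borel" using assms by (rule L2_D)
  have p: "periodic (\<lambda>y. (g y)\<^sup>2)" using L2_D(1)[OF assms] by (simp add: periodic_def)
  have "sqint (\<lambda>x. g (x - y))"
    using integrable_tmeas_affine[OF _ p, of 1 "- y"] sqint_integrable_sq[OF L2_D(2)[OF assms]]
    by (simp add: sqint_def)
  moreover have "g (x + axis i (2 * pi) - y) = g (x - y)" for x i
    using L2_D(1)[OF assms, unfolded periodic_def, rule_format, of "x - y" i] by (simp add: algebra_simps)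
  ultimately show ?thesis by (simp add: L2_iff periodic_def)
qed

text \<open>Cauchy-Schwarz, with the reflection \<open>y \<mapsto> x - y\<close> preserving the
  norm. As the bound holds at every \<open>x\<close>, convolution turns mean square approximation of
  \<open>g\<close> into uniform approximation.\<close>

lemma abs_conv_diff_le:
  assumes "\<phi> \<in> L2" "g \<in> L2" "h \<in> L2"
  shows "\<bar>conv \<phi> g x - conv \<phi> h x\<bar> \<le> l2norm \<phi> * l2norm (\<lambda>x. g x - h x)"
proof -
  note m = assms[THEN L2_D(3)]
  note d = L2_diff[OF assms(2,3)]
  have "conv \<phi> g x - conv \<phi> h x = (LINT y|tmeas. \<phi> y * g (x - y)) - (LINT y|tmeas. \<phi> y * h (x - y))"
    by (simp add: conv_eq m)
  also have "\<dots> = (LINT y|tmeas. \<phi> y * (g (x - y) - h (x - y)))"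
    using assms by (simp add: sqint_integrable_mult sqint_reflect L2_D right_diff_distrib)
  finally show ?thesis
    using integral_mult_le_l2norm[OF L2_D(2)[OF assms(1)] sqint_reflect(1)[OF d, of x]]
    by (simp add: sqint_reflect(2)[OF d])
qed

lemma l2norm_diff_conv_le:
  assumes \<phi>: "\<phi> \<in> L2" and f: "f \<in> L2" and g: "g \<in> L2" and p: "p \<in> L2" and h: "conv \<phi> p \<in> L2"
    and eq: "AE x in lborel. f x = conv \<phi> g x"
  shows "l2norm (\<lambda>x. f x - conv \<phi> p x) \<le> l2norm \<phi> * l2norm (\<lambda>x. g x - p x)"
proof (rule l2norm_le_bound)
  show "(\<lambda>x. f x - conv \<phi> p x) \<in> borel_measurable borel" using L2_diff[OF f h] by (rule L2_D)
  have "AE x in lborel. \<bar>f x - conv \<phi> p x\<bar> \<le> l2norm \<phi> * l2norm (\<lambda>x. g x - p x)"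
    using eq by eventually_elim (simp add: abs_conv_diff_le[OF \<phi> g p])
  then show "AE x in tmeas. \<bar>f x - conv \<phi> p x\<bar> \<le> l2norm \<phi> * l2norm (\<lambda>x. g x - p x)"
    unfolding tmeas_def by (subst AE_density) auto
qed

text \<open>A kernel enters only through its Fourier coefficients; their reality and symmetry make the
  sign of the frequency in \<open>coef\<close> irrelevant.\<close>

locale torus_kernel =
  fixes lam :: "int ^ 'd \<Rightarrow> real" and \<phi> :: "real ^ 'd \<Rightarrow> real"
  assumes \<phi>: "\<phi> \<in> L2" and coef_\<phi>: "coef \<phi> k = complex_of_real (1 / lam k)"
    and lam_minus: "lam (- k) = lam k" and lam_pos: "lam k > 0"
begin

text \<open>The integral over \<open>y\<close> leaves \<open>coef \<phi> (- k)\<close>, which the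
  symmetry of \<open>lam\<close> turns into the reciprocal of \<open>lam k\<close>.\<close>

lemma conv_trig_poly:
  assumes "finite S" and p: "\<And>x. complex_of_real (p x) = (\<Sum>k\<in>S. a k * chr k x)"
  shows "complex_of_real (conv \<phi> p x) = (\<Sum>k\<in>S. (a k / lam k) * chr k x)"
proof -
  have t: "trig_poly_real p"
    unfolding trig_poly_real_def trig_poly_def using assms by (intro exI[of _ S] exI[of _ a]) auto
  have "complex_of_real (conv \<phi> p x) = complex_of_real (LINT y|tmeas. \<phi> y * p (x - y))"
    using t \<phi> by (simp add: conv_eq L2_D trig_poly_real_cases)
  also have "\<dots> = (LINT y|tmeas. (\<Sum>k\<in>S. a k * chr k x * (complex_of_real (\<phi> y) * chr (- k) y)))"
  proof -
    have "complex_of_real (\<phi> y * p (x - y)) = (\<Sum>k\<in>S. a k * chr k x * (complex_of_real (\<phi> y) * chr (- k) y))" for y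
      using chr_add[of _ x "- y"] by (simp add: p sum_distrib_left chr_minus mult_ac)
    then show ?thesis by (simp only: integral_complex_of_real[symmetric])
  qed
  also have "\<dots> = (\<Sum>k\<in>S. a k * chr k x * coef \<phi> (- k))"
    using L2_D(2)[OF \<phi>] by (simp add: integrable_mult_chr coef_def)
  finally show ?thesis by (simp add: coef_\<phi> lam_minus mult_ac)
qed

text \<open>For trigonometric polynomials in place of \<open>g\<close> this follows from
  \<open>conv_trig_poly\<close>. Both sides depend continuously on \<open>g\<close> in the mean
  square norm, so density finishes the argument and no double integral has to be exchanged.\<close>

lemma coef_conv:
  assumes f: "f \<in> L2" and g: "g \<in> L2" and eq: "AE x in lborel. f x = conv \<phi> g x"
  shows "coef f m = coef g m / lam m"
proof -
  have "norm (coef f m - coef g m / lam m) \<le> e * (l2norm \<phi> + 1 / lam m)" if "e > 0" for e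
  proof -
    obtain p where p: "trig_poly_real p" "l2norm (\<lambda>x. g x - p x) < e"
      using trig_poly_dense_l2norm[OF g \<open>e > 0\<close>] by blast
    note pL = trig_poly_real_L2[OF p(1)]
    obtain S a where S: "finite S" "\<And>x. complex_of_real (p x) = (\<Sum>k\<in>S. a k * chr k x)"
      using p(1) unfolding trig_poly_real_def trig_poly_def fun_eq_iff by blast
    let ?h = "\<lambda>x. conv \<phi> p x"
    note h = conv_trig_poly[OF S]
    have ht: "trig_poly_real ?h"
      unfolding trig_poly_real_def trig_poly_def using S(1) h by (intro exI[of _ S] exI[of _ "\<lambda>k. a k / lam k"]) auto
    note hL = trig_poly_real_L2[OF ht]
    have "coef ?h m = coef p m / lam m"
      using coef_trig_poly[OF S] coef_trig_poly[OF S(1) h] by (simp add: lam_minus)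
    then have "coef f m - coef g m / lam m = coef (\<lambda>x. f x - ?h x) m - coef (\<lambda>x. g x - p x) m / lam m"
      using f g hL pL by (simp add: coef_diff L2_D diff_divide_distrib)
    also have "norm \<dots> \<le> norm (coef (\<lambda>x. f x - ?h x) m) + norm (coef (\<lambda>x. g x - p x) m) / lam m"
      using lam_pos[of m] norm_triangle_ineq4[of "coef (\<lambda>x. f x - ?h x) m" "coef (\<lambda>x. g x - p x) m / lam m"]
      by (simp add: norm_divide)
    also have "\<dots> \<le> l2norm (\<lambda>x. f x - ?h x) + l2norm (\<lambda>x. g x - p x) / lam m"
      using f g hL pL lam_pos[of m]
      by (intro add_mono divide_right_mono norm_coef_le sqint_diff) (auto simp: L2_D)
    also have "l2norm (\<lambda>x. f x - ?h x) \<le> l2norm \<phi> * e"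
      using l2norm_diff_conv_le[OF \<phi> f g pL hL eq] p(2) mult_left_mono[OF _ l2norm_nonneg[of \<phi>]]
      by (meson less_imp_le order_trans)
    also have "l2norm (\<lambda>x. g x - p x) / lam m \<le> e / lam m"
      using p(2) lam_pos[of m] by (intro divide_right_mono) auto
    finally show ?thesis by (simp add: algebra_simps)
  qed
  note * = this
  have pos: "l2norm \<phi> + 1 / lam m > 0" using lam_pos[of m] l2norm_nonneg[of \<phi>] by (simp add: add_nonneg_pos)
  have "norm (coef f m - coef g m / lam m) \<le> 0"
  proof (rule field_le_epsilon)
    fix e :: real assume "e > 0"
    then show "norm (coef f m - coef g m / lam m) \<le> 0 + e"
      using *[of "e / (l2norm \<phi> + 1 / lam m)"] pos by simp
  qed
  then show ?thesis by simp
qed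

text \<open>Gives the definite description in \<open>Phi_norm\<close> its value. Two functions with
  the same convolution have equal Fourier coefficients, so their difference is orthogonal to all
  trigonometric polynomials and, by density, to itself.\<close>

lemma Phi_norm_eq:
  assumes f: "f \<in> L2" and g: "g \<in> L2" and eq: "AE x in lborel. f x = conv \<phi> g x"
  shows "Phi_norm \<phi> f = l2norm g"
  unfolding Phi_norm_def
proof (rule the_equality)
  show "\<exists>g'\<in>L2. (AE x in lborel. f x = conv \<phi> g' x) \<and> l2norm g = l2norm g'" using g eq by blast
  fix r assume "\<exists>g'\<in>L2. (AE x in lborel. f x = conv \<phi> g' x) \<and> r = l2norm g'"
  then obtain g' where g': "g' \<in> L2" "AE x in lborel. f x = conv \<phi> g' x" "r = l2norm g'" by blast
  let ?u = "\<lambda>x. g x - g' x"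
  have u: "?u \<in> L2" using g g' by (intro L2_diff)
  have "coef g m = coef g' m" for m
    using coef_conv[OF f g eq, of m] coef_conv[OF f g'(1,2), of m] lam_pos[of m] by simp
  then have cu: "coef ?u m = 0" for m using g g' by (simp add: coef_diff L2_D)
  have "(l2norm ?u)\<^sup>2 \<le> l2norm ?u * e" if "e > 0" for e
  proof -
    obtain p where p: "trig_poly_real p" "l2norm (\<lambda>x. ?u x - p x) < e"
      using trig_poly_dense_l2norm[OF u \<open>e > 0\<close>] by blast
    note pL = trig_poly_real_L2[OF p(1)]
    obtain S a where S: "finite S" "\<And>x. complex_of_real (p x) = (\<Sum>k\<in>S. a k * chr k x)"
      using p(1) unfolding trig_poly_real_def trig_poly_def fun_eq_iff by blast
    have "complex_of_real (LINT x|tmeas. ?u x * p x) = (LINT x|tmeas. (\<Sum>k\<in>S. a k * (complex_of_real (?u x) * chr k x)))"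
    proof -
      have "complex_of_real (?u x * p x) = (\<Sum>k\<in>S. a k * (complex_of_real (?u x) * chr k x))" for x
        by (simp only: of_real_mult S(2) sum_distrib_left mult_ac)
      then show ?thesis by (simp only: integral_complex_of_real[symmetric])
    qed
    also have "\<dots> = (\<Sum>k\<in>S. a k * coef ?u k)"
      unfolding coef_def using integrable_mult_chr[OF L2_D(2)[OF u]] by (subst Bochner_Integration.integral_sum) simp_all
    also have "\<dots> = 0" by (simp add: cu)
    finally have "(LINT x|tmeas. ?u x * p x) = 0" by simp
    then have "(l2norm ?u)\<^sup>2 = (LINT x|tmeas. ?u x * ?u x) - (LINT x|tmeas. ?u x * p x)"
      using l2norm_sq[OF L2_D(3)[OF u]] by (simp only: power2_eq_square diff_0_right)
    also have "\<dots> = (LINT x|tmeas. ?u x * (?u x - p x))"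
      using sqint_integrable_mult[OF L2_D(2)[OF u] L2_D(2)[OF u]] sqint_integrable_mult[OF L2_D(2)[OF u] L2_D(2)[OF pL]]
      by (subst Bochner_Integration.integral_diff[symmetric]) (simp_all add: right_diff_distrib)
    also have "\<dots> \<le> l2norm ?u * l2norm (\<lambda>x. ?u x - p x)"
      using integral_mult_le_l2norm[OF L2_D(2)[OF u] L2_D(2)[OF L2_diff[OF u pL]]] by linarith
    also have "\<dots> \<le> l2norm ?u * e" using p(2) by (intro mult_left_mono) (auto simp: l2norm_nonneg)
    finally show ?thesis .
  qed
  note * = this
  have "l2norm ?u = 0"
  proof (rule ccontr)
    assume "l2norm ?u \<noteq> 0"
    then have "l2norm ?u > 0" using l2norm_nonneg[of ?u] by simp
    \<comment> \<open>At accuracy half the norm, the square of a positive norm would be at most half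
      of itself.\<close>
    then show False using *[of "l2norm ?u / 2"] by (simp add: power2_eq_square)
  qed
  then have "(LINT x|tmeas. (?u x)\<^sup>2) = 0" using l2norm_sq[OF L2_D(3)[OF u]] by simp
  then have "AE x in tmeas. (?u x)\<^sup>2 = 0"
    using sqint_integrable_sq[OF L2_D(2)[OF u]] by (subst (asm) integral_nonneg_eq_0_iff_AE) auto
  then have "AE x in tmeas. (g x)\<^sup>2 = (g' x)\<^sup>2" by eventually_elim simp
  then have "(LINT x|tmeas. (g x)\<^sup>2) = (LINT x|tmeas. (g' x)\<^sup>2)"
    using L2_D(3)[OF g] L2_D(3)[OF g'(1)] by (intro integral_cong_AE) auto
  then show "r = l2norm g" using g' g by (simp add: l2norm_eq L2_D)
qed

lemma Phi_ballE:
  assumes "f \<in> Phi_ball \<phi>"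
  obtains g where "f \<in> L2" "g \<in> L2" "AE x in lborel. f x = conv \<phi> g x" "l2norm g \<le> 1"
  using assms Phi_norm_eq unfolding Phi_ball_def Phi_space_def by fastforce

lemma Phi_ballI:
  assumes "f \<in> L2" "g \<in> L2" "\<And>x. f x = conv \<phi> g x" "l2norm g \<le> 1"
  shows "f \<in> Phi_ball \<phi>"
  using assms Phi_norm_eq[of f g] unfolding Phi_ball_def Phi_space_def by auto

text \<open>Replacing \<open>g\<close> by a trigonometric polynomial first reduces the truncation to
  a finite sum with an elementary Parseval identity; \<open>e\<close> pays for the replacement.
  Outside \<open>K\<close> each coefficient is divided by at least \<open>B\<close>.\<close>

lemma Phi_ball_approx:
  assumes f: "f \<in> Phi_ball \<phi>" and e: "e > 0" and B: "B > 0" "\<And>k. k \<notin> K \<Longrightarrow> B \<le> lam k"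
  obtains S a where "finite S" "S \<subseteq> K" "l2norm (\<lambda>x. f x - Re (\<Sum>k\<in>S. a k * chr k x)) \<le> 1 / B + e"
proof -
  obtain g where fL: "f \<in> L2" and g: "g \<in> L2" and eq: "AE x in lborel. f x = conv \<phi> g x" and g1: "l2norm g \<le> 1"
    using Phi_ballE[OF f] .
  \<comment> \<open>The accuracy \<open>d\<close> is paid for twice: through the convolution, with
    factor \<open>l2norm \<phi>\<close>, and in the norm of the discarded tail, with factor
    \<open>1 / B\<close>.\<close>
  define d where "d = e / (l2norm \<phi> + 1 / B)"
  have pos: "l2norm \<phi> + 1 / B > 0" using B l2norm_nonneg[of \<phi>] by (simp add: add_nonneg_pos)
  then have d: "d > 0" using e by (simp add: d_def)
  obtain p where p: "trig_poly_real p" "l2norm (\<lambda>x. g x - p x) < d"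
    using trig_poly_dense_l2norm[OF g d] by blast
  note pL = trig_poly_real_L2[OF p(1)]
  obtain S a where S: "finite S" "\<And>x. complex_of_real (p x) = (\<Sum>k\<in>S. a k * chr k x)"
    using p(1) unfolding trig_poly_real_def trig_poly_def fun_eq_iff by blast
  let ?h = "\<lambda>x. conv \<phi> p x"
  note h = conv_trig_poly[OF S]
  have ht: "trig_poly_real ?h"
    unfolding trig_poly_real_def trig_poly_def using S(1) h by (intro exI[of _ S] exI[of _ "\<lambda>k. a k / lam k"]) auto
  note hL = trig_poly_real_L2[OF ht]
  define b where "b k = a k / lam k" for k
  \<comment> \<open>\<open>S \<inter> K\<close> need not be closed under negation, so the truncated
    sum may be complex. Since \<open>?h\<close> is real, passing to real parts is harmless: it
    cannot increase the norm of the tail.\<close>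
  let ?t = "\<lambda>x. Re (\<Sum>k\<in>S \<inter> K. b k * chr k x)"
  let ?w = "\<lambda>x. (\<Sum>k\<in>S - K. b k * chr k x)"
  have tt: "trig_poly_real ?t" by (intro trig_poly_Re trig_poly_sum trig_poly_chr)
  have wt: "trig_poly_real (\<lambda>x. Re (?w x))" by (intro trig_poly_Re trig_poly_sum trig_poly_chr)
  note tL = trig_poly_real_L2[OF tt] and wL = trig_poly_real_L2[OF wt]
  have ht_eq: "?h x - ?t x = Re (?w x)" for x
  proof -
    have "?h x = Re (complex_of_real (?h x))" by simp
    also have "\<dots> = Re (\<Sum>k\<in>S. b k * chr k x)" unfolding h b_def ..
    also have "(\<Sum>k\<in>S. b k * chr k x) = (\<Sum>k\<in>S \<inter> K. b k * chr k x) + ?w x"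
      using S(1) by (subst sum.union_disjoint[symmetric]) (auto simp: Int_Diff_Un)
    finally show ?thesis by simp
  qed
  have "(l2norm (\<lambda>x. Re (?w x)))\<^sup>2 \<le> (LINT x|tmeas. (norm (?w x))\<^sup>2)"
  proof (subst l2norm_sq)
    show "(LINT x|tmeas. (Re (?w x))\<^sup>2) \<le> (LINT x|tmeas. (norm (?w x))\<^sup>2)"
    proof (rule integral_mono)
      show "integrable tmeas (\<lambda>x. (Re (?w x))\<^sup>2)" using wL by (simp add: L2_D sqint_integrable_sq)
      have "trig_poly ?w" by (intro trig_poly_sum trig_poly_chr)
      then obtain Bw where Bw: "\<And>x. norm (?w x) \<le> Bw" using trig_poly_bounded by blast
      show "integrable tmeas (\<lambda>x. (norm (?w x))\<^sup>2)"
        by (rule integrable_bounded_tmeas[of _ "Bw\<^sup>2"]) (auto intro!: power_mono Bw)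
      have "(Re z)\<^sup>2 \<le> (norm z)\<^sup>2" for z by (simp add: cmod_power2)
      then show "(Re (?w x))\<^sup>2 \<le> (norm (?w x))\<^sup>2" for x .
    qed
  qed (rule L2_D(3)[OF wL])
  also have "\<dots> = (\<Sum>k\<in>S - K. (norm (b k))\<^sup>2)"
    using S(1) by (intro integral_norm_trig_poly) auto
  also have "\<dots> \<le> (\<Sum>k\<in>S - K. (norm (a k))\<^sup>2 / B\<^sup>2)"
  proof (rule sum_mono)
    fix k assume "k \<in> S - K"
    then have "norm (b k) \<le> norm (a k) / B"
      using B(2)[of k] B(1) by (auto simp: b_def norm_divide intro!: divide_left_mono)
    then have "(norm (b k))\<^sup>2 \<le> (norm (a k) / B)\<^sup>2" by (intro power_mono) auto
    then show "(norm (b k))\<^sup>2 \<le> (norm (a k))\<^sup>2 / B\<^sup>2" by (simp add: power_divide)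
  qed
  also have "\<dots> \<le> (\<Sum>k\<in>S. (norm (a k))\<^sup>2 / B\<^sup>2)"
    using S(1) by (intro sum_mono2) auto
  also have "\<dots> = (LINT x|tmeas. (norm (\<Sum>k\<in>S. a k * chr k x))\<^sup>2) / B\<^sup>2"
    by (simp add: integral_norm_trig_poly[OF S(1)] sum_divide_distrib)
  also have "\<dots> = (l2norm p)\<^sup>2 / B\<^sup>2"
    using L2_D(3)[OF pL] by (simp add: l2norm_sq flip: S(2))
  finally have "(l2norm (\<lambda>x. Re (?w x)))\<^sup>2 \<le> (l2norm p / B)\<^sup>2" by (simp add: power_divide)
  then have w: "l2norm (\<lambda>x. Re (?w x)) \<le> l2norm p / B"
    by (rule power2_le_imp_le) (rule divide_nonneg_pos[OF l2norm_nonneg B(1)])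
  have "l2norm p \<le> 1 + d"
  proof -
    have "l2norm p = l2norm (\<lambda>x. g x + - 1 * (g x - p x))" by simp
    also have "\<dots> \<le> l2norm g + l2norm (\<lambda>x. - 1 * (g x - p x))"
      using g L2_diff[OF g pL] by (intro l2norm_triangle sqint_scale) (auto simp: L2_D)
    also have "l2norm (\<lambda>x. - 1 * (g x - p x)) = l2norm (\<lambda>x. g x - p x)"
      unfolding l2norm_def by (simp add: power2_commute)
    finally show ?thesis using p(2) g1 by linarith
  qed
  then have w': "l2norm (\<lambda>x. Re (?w x)) \<le> (1 + d) / B"
    using w B(1) by (meson divide_right_mono less_imp_le order_trans)
  have fh: "l2norm (\<lambda>x. f x - ?h x) \<le> l2norm \<phi> * d"
    using l2norm_diff_conv_le[OF \<phi> fL g pL hL eq] p(2) mult_left_mono[OF _ l2norm_nonneg[of \<phi>]]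
    by (meson less_imp_le order_trans)
  have "l2norm (\<lambda>x. f x - ?t x) = l2norm (\<lambda>x. (f x - ?h x) + (?h x - ?t x))" by simp
  also have "\<dots> \<le> l2norm (\<lambda>x. f x - ?h x) + l2norm (\<lambda>x. ?h x - ?t x)"
    by (rule l2norm_triangle[OF L2_D(2)[OF L2_diff[OF fL hL]] L2_D(2)[OF L2_diff[OF hL tL]]])
  also have "\<dots> \<le> l2norm \<phi> * d + (1 + d) / B"
    using fh w' by (simp only: ht_eq)
  also have "\<dots> = 1 / B + d * (l2norm \<phi> + 1 / B)"
    by (simp add: algebra_simps add_divide_distrib)
  also have "\<dots> = 1 / B + e" using pos by (simp add: d_def)
  finally show ?thesis using S(1) by (intro that[of "S \<inter> K" b]) auto
qed

end

section \<open>Dirichlet kernels and the upper bound\<close>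

text \<open>Combinations of this cosine and sine are closed under partial derivatives, hence the
  induction on the order with \<open>a\<close> and \<open>b\<close> arbitrary.\<close>

lemma test_fun_cos_sin:
  fixes k :: "int ^ 'd"
  shows "test_fun (\<lambda>x. a * cos (freq k \<bullet> x) + b * sin (freq k \<bullet> x))"
proof -
  let ?f = "\<lambda>a b x. a * cos (freq k \<bullet> x) + b * sin (freq k \<bullet> x)"
  have der: "(?f a b has_derivative (\<lambda>h. (b * cos (freq k \<bullet> x) + (- a) * sin (freq k \<bullet> x)) * (freq k \<bullet> h))) (at x)" for a b x
    by (auto intro!: derivative_eq_intros simp: algebra_simps)
  have Ck: "Ck m (?f a b)" for m
  proof (induction m arbitrary: a b)
    case 0
    show ?case by (auto intro!: continuous_intros)
  next
    case (Suc m)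
    have "(\<lambda>x. frechet_derivative (?f a b) (at x) (axis i 1)) = ?f (b * freq k $ i) (- a * freq k $ i)" for i
    proof
      fix x
      show "frechet_derivative (?f a b) (at x) (axis i 1) = ?f (b * freq k $ i) (- a * freq k $ i) x"
        using frechet_derivative_at[OF der[of a b x], symmetric] by (simp add: inner_axis algebra_simps)
    qed
    moreover have "?f a b differentiable_on UNIV"
      using der by (auto simp: differentiable_on_def differentiable_def)
    ultimately show ?case using Suc by (simp only: Ck.simps) blast
  qed
  have "cos (freq k \<bullet> x) = Re (chr k x)" "sin (freq k \<bullet> x) = Im (chr k x)" for x
    by (simp_all add: chr_def)
  then have "periodic (?f a b)"
    using periodic_chr[of k] by (simp add: periodic_def)
  with Ck show ?thesis by (simp add: test_fun_def torus_fun_iff_periodic)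
qed

text \<open>Test functions are real, so the series is paired with cosine and sine separately, and
  the combination with \<open>\<i>\<close> restores the character \<open>chr m\<close>.
  Orthogonality then leaves the single term at \<open>k = - m\<close>.\<close>

lemma is_kernel_coef:
  fixes lam :: "int ^ 'd \<Rightarrow> real"
  assumes k: "is_kernel lam \<phi>" and \<phi>: "\<phi> \<in> L2" and sym: "\<And>k. lam (- k) = lam k"
  shows "coef \<phi> m = complex_of_real (1 / lam m)"
proof -
  let ?c = "(2 * pi) ^ CARD('d)"
  have [measurable]: "\<phi> \<in> borel_measurable borel" using \<phi> by (rule L2_D)
  have sum: "((\<lambda>k. complex_of_real (1 / lam k) * (LINT x|tmeas. chr k x * complex_of_real (h x)))
        has_sum complex_of_real (LINT x|tmeas. \<phi> x * h x)) UNIV"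
    if h: "test_fun h" and [measurable]: "h \<in> borel_measurable borel" for h
  proof -
    have "((\<lambda>k. complex_of_real (1 / ?c) * (complex_of_real (1 / lam k) *
            (LINT x:torus|lborel. exp (\<i> * complex_of_real (freq k \<bullet> x)) * complex_of_real (h x))))
        has_sum complex_of_real (1 / ?c) * complex_of_real (LINT x:torus|lborel. \<phi> x * h x)) UNIV"
      using k h unfolding is_kernel_def by (intro has_sum_cmult_right) blast
    also have "complex_of_real (1 / ?c) * complex_of_real (LINT x:torus|lborel. \<phi> x * h x)
        = complex_of_real (LINT x|tmeas. \<phi> x * h x)"
      by (subst integral_tmeas) auto
    also have "(\<lambda>k. complex_of_real (1 / ?c) * (complex_of_real (1 / lam k) *
            (LINT x:torus|lborel. exp (\<i> * complex_of_real (freq k \<bullet> x)) * complex_of_real (h x))))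
        = (\<lambda>k. complex_of_real (1 / lam k) * (LINT x|tmeas. chr k x * complex_of_real (h x)))"
      by (subst integral_tmeas) (auto simp: chr_def cis_conv_exp scaleR_conv_of_real mult_ac)
    finally show ?thesis .
  qed
  let ?C = "\<lambda>x. cos (freq m \<bullet> x)" and ?S = "\<lambda>x. sin (freq m \<bullet> x)"
  have t: "test_fun ?C" "test_fun ?S"
    using test_fun_cos_sin[of 1 m 0] test_fun_cos_sin[of 0 m 1] by simp_all
  have [measurable]: "?C \<in> borel_measurable borel" "?S \<in> borel_measurable borel"
    by (intro borel_measurable_continuous_onI continuous_intros)+
  have euler: "complex_of_real (?C x) + \<i> * complex_of_real (?S x) = chr m x" for x
    by (simp add: chr_def complex_eq_iff)
  have CS: "sqint ?C" "sqint ?S" by (auto intro!: sqint_bounded[of _ 1])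
  have "((\<lambda>k. complex_of_real (1 / lam k) * (LINT x|tmeas. chr k x * complex_of_real (?C x))
         + \<i> * (complex_of_real (1 / lam k) * (LINT x|tmeas. chr k x * complex_of_real (?S x))))
        has_sum (complex_of_real (LINT x|tmeas. \<phi> x * ?C x) + \<i> * complex_of_real (LINT x|tmeas. \<phi> x * ?S x))) UNIV"
    by (intro has_sum_add has_sum_cmult_right sum t) measurable
  also have "(\<lambda>k. complex_of_real (1 / lam k) * (LINT x|tmeas. chr k x * complex_of_real (?C x))
         + \<i> * (complex_of_real (1 / lam k) * (LINT x|tmeas. chr k x * complex_of_real (?S x))))
      = (\<lambda>k. if k = - m then complex_of_real (1 / lam k) else 0)"
  proof
    fix k :: "int ^ 'd"
    have i: "integrable tmeas (\<lambda>x. chr k x * complex_of_real (?C x))" "integrable tmeas (\<lambda>x. chr k x * complex_of_real (?S x))"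
      using integrable_mult_chr[OF CS(1), of k] integrable_mult_chr[OF CS(2), of k] by (simp_all add: mult.commute)
    have "(LINT x|tmeas. chr k x * complex_of_real (?C x)) + \<i> * (LINT x|tmeas. chr k x * complex_of_real (?S x))
      = (LINT x|tmeas. chr k x * complex_of_real (?C x) + \<i> * (chr k x * complex_of_real (?S x)))"
      using i by simp
    also have "\<dots> = (LINT x|tmeas. chr (k + m) x)"
      by (intro Bochner_Integration.integral_cong) (simp_all add: chr_add_freq ring_distribs mult_ac flip: euler)
    also have "\<dots> = (if k = - m then 1 else 0)"
      by (simp add: integral_chr eq_neg_iff_add_eq_0)
    finally have e: "(LINT x|tmeas. chr k x * complex_of_real (?C x)) + \<i> * (LINT x|tmeas. chr k x * complex_of_real (?S x))
      = (if k = - m then 1 else 0)" .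
    have "a * b + \<i> * (a * c) = a * (b + \<i> * c)" for a b c :: complex by (simp add: algebra_simps)
    then show "complex_of_real (1 / lam k) * (LINT x|tmeas. chr k x * complex_of_real (?C x))
         + \<i> * (complex_of_real (1 / lam k) * (LINT x|tmeas. chr k x * complex_of_real (?S x)))
      = (if k = - m then complex_of_real (1 / lam k) else 0)"
      by (simp only: e) simp
  qed
  finally have 1: "((\<lambda>k. if k = - m then complex_of_real (1 / lam k) else 0) has_sum
      (complex_of_real (LINT x|tmeas. \<phi> x * ?C x) + \<i> * complex_of_real (LINT x|tmeas. \<phi> x * ?S x))) UNIV" .
  have "((\<lambda>k. if k = - m then complex_of_real (1 / lam k) else 0) has_sum complex_of_real (1 / lam (- m))) UNIV"
    by (rule has_sum_finite_neutralI[of "{- m}"]) auto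
  with 1 have 2: "complex_of_real (LINT x|tmeas. \<phi> x * ?C x) + \<i> * complex_of_real (LINT x|tmeas. \<phi> x * ?S x)
      = complex_of_real (1 / lam (- m))" by (rule has_sum_unique)
  have int: "integrable tmeas (\<lambda>x. complex_of_real (\<phi> x * ?C x))" "integrable tmeas (\<lambda>x. complex_of_real (\<phi> x * ?S x))"
    using sqint_integrable_mult[OF L2_D(2)[OF \<phi>]] CS by (auto simp del: of_real_mult)
  have "coef \<phi> m = (LINT x|tmeas. complex_of_real (\<phi> x * ?C x) + \<i> * complex_of_real (\<phi> x * ?S x))"
    unfolding coef_def by (intro Bochner_Integration.integral_cong) (simp_all add: ring_distribs mult_ac flip: euler)
  also have "\<dots> = complex_of_real (LINT x|tmeas. \<phi> x * ?C x) + \<i> * complex_of_real (LINT x|tmeas. \<phi> x * ?S x)"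
    using int by (simp del: of_real_mult)
  finally show ?thesis using 2 by (simp add: sym)
qed

section \<open>Dirichlet kernels and discrete orthogonality on a grid\<close>

definition freq_box :: "int \<Rightarrow> (int ^ 'd) set" where
  "freq_box m = {k. \<forall>i. \<bar>k $ i\<bar> \<le> m}"

lemma bij_betw_vec_PiE: "bij_betw vec_nth {v::'a ^ 'd. \<forall>i. v $ i \<in> A} (PiE UNIV (\<lambda>_. A))"
  by (rule bij_betw_byWitness[where f'="vec_lambda"]) auto

lemma finite_vec_set: "finite A \<Longrightarrow> finite {v::'a ^ 'd. \<forall>i. v $ i \<in> A}"
  by (subst bij_betw_finite[OF bij_betw_vec_PiE]) (auto intro: finite_PiE)

lemma card_vec_set: "card {v::'a ^ 'd. \<forall>i. v $ i \<in> A} = card A ^ CARD('d)"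
  by (subst bij_betw_same_card[OF bij_betw_vec_PiE]) (simp add: card_PiE)

lemma freq_box_altdef: "freq_box m = {k. \<forall>i. k $ i \<in> {- m..m}}"
  by (auto simp: freq_box_def abs_le_iff) (metis minus_le_iff)+

lemma finite_freq_box: "finite (freq_box m)"
  unfolding freq_box_altdef by (rule finite_vec_set) auto

lemma card_freq_box: "m \<ge> 0 \<Longrightarrow> card (freq_box m :: (int ^ 'd) set) = nat (2 * m + 1) ^ CARD('d)"
  unfolding freq_box_altdef by (subst card_vec_set) auto

definition dirichlet :: "int \<Rightarrow> real ^ 'd \<Rightarrow> real" where
  "dirichlet m x = (\<Sum>k\<in>freq_box m. cos (freq k \<bullet> x))"

lemma dirichlet_eq: "complex_of_real (dirichlet m x) = (\<Sum>k\<in>freq_box m. chr k x)"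
proof -
  have "(\<Sum>k\<in>freq_box m. sin (freq k \<bullet> x)) = (\<Sum>k\<in>freq_box m. sin (freq (- k) \<bullet> x))"
    by (rule sum.reindex_bij_witness[of _ uminus uminus]) (auto simp: freq_box_def)
  then have "(\<Sum>k\<in>freq_box m. sin (freq k \<bullet> x)) = 0"
    by (simp add: freq_minus sum_negf)
  then show ?thesis
    by (simp add: complex_eq_iff chr_def dirichlet_def)
qed

lemma dirichlet_L2: "dirichlet m \<in> L2"
proof (rule trig_poly_real_L2)
  have "trig_poly (\<lambda>x. \<Sum>k\<in>freq_box m. 1 * chr k x)"
    by (intro trig_poly_sum trig_poly_chr)
  then show "trig_poly_real (dirichlet m)" by (simp add: trig_poly_real_def dirichlet_eq)
qed

definition torus_grid :: "nat \<Rightarrow> (nat ^ 'd) set" where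
  "torus_grid N = {j. \<forall>i. j $ i \<in> {..<N}}"

definition grid_point :: "nat \<Rightarrow> nat ^ 'd \<Rightarrow> real ^ 'd" where
  "grid_point N j = (\<chi> i. 2 * pi * real (j $ i) / real N)"

text \<open>The bound on \<open>q\<close> makes 0 the only multiple of \<open>N\<close> in range, so
  every other \<open>q\<close> gives a full geometric sum with ratio different from 1.\<close>

lemma sum_roots_of_unity:
  fixes q :: int
  assumes "\<bar>q\<bar> < int N"
  shows "(\<Sum>t<N. cis (of_int q * (2 * pi * real t / real N))) = (if q = 0 then of_nat N else 0)"
proof (cases "q = 0")
  case False
  have N: "N > 0" using assms by auto
  let ?w = "cis (of_int q * (2 * pi / real N))"
  have "?w \<noteq> 1"
  proof
    assume "?w = 1"
    then have "cos (of_int q * (2 * pi / real N)) = 1" by (metis cis.simps(1) one_complex.simps(1))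
    then obtain n :: int where "of_int q * (2 * pi / real N) = of_int n * 2 * pi"
      unfolding cos_one_2pi_int by blast
    then have "real_of_int q = of_int n * real N" using N by (simp add: field_simps)
    then have q: "q = n * int N" by (metis of_int_eq_iff of_int_mult of_int_of_nat_eq)
    with False have "n \<noteq> 0" by auto
    then have "1 * int N \<le> \<bar>n\<bar> * int N" by (intro mult_right_mono) auto
    then have "int N \<le> \<bar>q\<bar>" by (simp add: q abs_mult)
    with assms show False by simp
  qed
  moreover have "?w ^ N = 1"
  proof -
    have "?w ^ N = cis (real N * (of_int q * (2 * pi / real N)))" by (rule Complex.DeMoivre)
    also have "real N * (of_int q * (2 * pi / real N)) = 2 * pi * of_int q" using N by simp
    also have "cis (2 * pi * of_int q) = 1" by (simp add: complex_eq_iff cos_int_2pin sin_int_2pin)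
    finally show ?thesis .
  qed
  moreover have "cis (of_int q * (2 * pi * real t / real N)) = ?w ^ t" for t
    by (subst Complex.DeMoivre) (simp add: mult_ac)
  ultimately show ?thesis using False by (simp add: sum_gp_strict)
qed simp

lemma cis_sum: "finite I \<Longrightarrow> cis (sum f I) = (\<Prod>i\<in>I. cis (f i))"
  by (induction I rule: finite_induct) (auto simp flip: cis_mult)

lemma sum_chr_grid:
  fixes q :: "int ^ 'd"
  assumes q: "\<And>i. \<bar>q $ i\<bar> < int N"
  shows "(\<Sum>j\<in>torus_grid N. chr q (grid_point N j)) = (if q = 0 then of_nat N ^ CARD('d) else 0)"
proof -
  have "(\<Sum>j\<in>torus_grid N. chr q (grid_point N j))
     = (\<Sum>j\<in>torus_grid N. \<Prod>i\<in>UNIV. cis (of_int (q $ i) * (2 * pi * real (j $ i) / real N)))"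
    by (simp add: chr_def inner_vec_def freq_def grid_point_def cis_sum)
  also have "\<dots> = (\<Sum>f\<in>PiE UNIV (\<lambda>_. {..<N}). \<Prod>i\<in>UNIV. cis (of_int (q $ i) * (2 * pi * real (f i) / real N)))"
    unfolding torus_grid_def by (rule sum.reindex_bij_betw[OF bij_betw_vec_PiE])
  also have "\<dots> = (\<Prod>i\<in>UNIV. \<Sum>t<N. cis (of_int (q $ i) * (2 * pi * real t / real N)))"
    by (rule prod_sum_PiE[symmetric]) auto
  also have "\<dots> = (\<Prod>i\<in>UNIV. if q $ i = 0 then of_nat N else 0)"
    by (simp only: sum_roots_of_unity[OF q])
  also have "\<dots> = (if q = 0 then of_nat N ^ CARD('d) else 0)"
    by (auto simp: vec_eq_iff)
  finally show ?thesis .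
qed

text \<open>\<open>2 * m + 1\<close> nodes per coordinate rule out aliasing: two frequencies in the
  box differ by at most \<open>2 * m\<close> in each coordinate, so their characters remain
  orthogonal on the grid.\<close>

lemma dirichlet_reproduces:
  fixes k :: "int ^ 'd"
  assumes k: "k \<in> freq_box (int m)" and N: "N = 2 * m + 1"
  shows "(\<Sum>j\<in>torus_grid N. chr k (grid_point N j) * complex_of_real (dirichlet (int m) (x - grid_point N j)))
      = of_nat N ^ CARD('d) * chr k x"
proof -
  have "(\<Sum>j\<in>torus_grid N. chr k (grid_point N j) * complex_of_real (dirichlet (int m) (x - grid_point N j)))
     = (\<Sum>j\<in>torus_grid N. \<Sum>l\<in>freq_box (int m). chr l x * chr (k - l) (grid_point N j))"
  proof (rule sum.cong)
    fix j
    have "chr l (x - y) = chr l x * chr (- l) y" for l and y :: "real ^ 'd"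
      using chr_add[of l x "- y"] by (simp add: chr_minus)
    moreover have "chr (k - l) y = chr k y * chr (- l) y" for l and y :: "real ^ 'd"
      using chr_add_freq[of k "- l" y] by simp
    ultimately show "chr k (grid_point N j) * complex_of_real (dirichlet (int m) (x - grid_point N j))
      = (\<Sum>l\<in>freq_box (int m). chr l x * chr (k - l) (grid_point N j))"
      by (simp add: dirichlet_eq sum_distrib_left mult_ac)
  qed simp
  also have "\<dots> = (\<Sum>l\<in>freq_box (int m). \<Sum>j\<in>torus_grid N. chr l x * chr (k - l) (grid_point N j))"
    by (rule sum.swap)
  also have "\<dots> = (\<Sum>l\<in>freq_box (int m). chr l x * (if l = k then of_nat N ^ CARD('d) else 0))"
  proof (rule sum.cong)
    fix l :: "int ^ 'd" assume l: "l \<in> freq_box (int m)"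
    have b: "\<bar>(k - l) $ i\<bar> < int N" for i
    proof -
      have "\<bar>k $ i\<bar> \<le> int m" "\<bar>l $ i\<bar> \<le> int m" using k l by (auto simp: freq_box_def)
      then show ?thesis unfolding N by simp
    qed
    show "(\<Sum>j\<in>torus_grid N. chr l x * chr (k - l) (grid_point N j))
       = chr l x * (if l = k then of_nat N ^ CARD('d) else 0)"
      unfolding sum_distrib_left[symmetric] sum_chr_grid[OF b] by auto
  qed simp
  also have "\<dots> = of_nat N ^ CARD('d) * chr k x"
    using k by (simp add: if_distrib sum.delta finite_freq_box mult.commute cong: if_cong)
  finally show ?thesis .
qed

context torus_kernel
begin

lemma M_upper:
  assumes B: "B > 0" "\<And>k. k \<notin> freq_box (int m) \<Longrightarrow> B \<le> lam k" and n: "(2 * m + 1) ^ CARD('d) \<le> n"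
  shows "M n (Phi_ball \<phi>) \<le> ennreal (1 / B)"
  unfolding M_def
proof (rule INF_lower2[OF dirichlet_L2[of "int m"]], rule SUP_least, rule ennreal_le_epsilon)
  fix f and e :: real assume f: "f \<in> Phi_ball \<phi>" and e: "e > 0"
  define N where "N = 2 * m + 1"
  obtain S a where S: "finite S" "S \<subseteq> freq_box (int m)" "l2norm (\<lambda>x. f x - Re (\<Sum>k\<in>S. a k * chr k x)) \<le> 1 / B + e"
    using Phi_ball_approx[OF f e B] .
  let ?w = "\<lambda>x. \<Sum>k\<in>S. a k * chr k x"
  let ?D = "\<lambda>x. dirichlet (int m) x"
  let ?G = "torus_grid N :: (nat ^ 'd) set"
  have cG: "card ?G = N ^ CARD('d)" unfolding torus_grid_def by (subst card_vec_set) auto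
  have fG: "finite ?G" unfolding torus_grid_def by (rule finite_vec_set) auto
  have rep: "of_nat N ^ CARD('d) * ?w x = (\<Sum>j\<in>?G. ?w (grid_point N j) * complex_of_real (?D (x - grid_point N j)))" for x
  proof -
    have "(\<Sum>j\<in>?G. ?w (grid_point N j) * complex_of_real (?D (x - grid_point N j)))
       = (\<Sum>k\<in>S. a k * (\<Sum>j\<in>?G. chr k (grid_point N j) * complex_of_real (?D (x - grid_point N j))))"
      unfolding sum_distrib_left sum_distrib_right by (subst sum.swap) (simp add: mult_ac)
    also have "\<dots> = (\<Sum>k\<in>S. a k * (of_nat N ^ CARD('d) * chr k x))"
      using S(2) by (intro sum.cong refl arg_cong2[where f="(*)"] dirichlet_reproduces) (auto simp: N_def)
    also have "\<dots> = of_nat N ^ CARD('d) * ?w x"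
      by (simp add: sum_distrib_left mult_ac)
    finally show ?thesis by simp
  qed
  obtain h where h: "bij_betw h {1..card ?G} ?G" using ex_bij_betw_nat_finite_1[OF fG] by blast
  have cn: "card ?G \<le> n" by (subst cG) (use n in \<open>simp add: N_def\<close>)
  \<comment> \<open>The grid may have fewer than \<open>n\<close> nodes; surplus translates receive
    coefficient 0 and the shift 0, a point of \<open>torus\<close>.\<close>
  define c where "c l = (if l \<le> card ?G then Re (?w (grid_point N (h l))) / real N ^ CARD('d) else 0)" for l
  define y where "y l = (if l \<le> card ?G then grid_point N (h l) else 0)" for l
  have y: "y \<in> {y. \<forall>l\<in>{1..n}. y l \<in> torus}"
  proof -
    have "grid_point N j \<in> torus" if "j \<in> ?G" for j
    proof -
      have "2 * pi * real (j $ i) / real N \<le> 2 * pi" for i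
      proof -
        have "j $ i < N" using that by (auto simp: torus_grid_def)
        then show ?thesis by (simp add: field_simps)
      qed
      then show ?thesis by (auto simp: torus_def mem_box_cart grid_point_def)
    qed
    moreover have "(0 :: real ^ 'd) \<in> torus" by (auto simp: torus_def mem_box_cart)
    moreover have "h l \<in> ?G" if "1 \<le> l" "l \<le> card ?G" for l
      using h that by (auto simp: bij_betw_def)
    ultimately show ?thesis by (auto simp: y_def)
  qed
  have t: "(\<Sum>l = 1..n. c l * ?D (x - y l)) = Re (?w x)" for x
  proof -
    have "(\<Sum>l = 1..n. c l * ?D (x - y l)) = (\<Sum>l = 1..card ?G. c l * ?D (x - y l))"
      using cn by (intro sum.mono_neutral_right) (auto simp: c_def)
    also have "\<dots> = (\<Sum>l = 1..card ?G. Re (?w (grid_point N (h l))) / real N ^ CARD('d) * ?D (x - grid_point N (h l)))"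
      by (intro sum.cong) (auto simp: c_def y_def)
    also have "\<dots> = (\<Sum>j\<in>?G. Re (?w (grid_point N j)) / real N ^ CARD('d) * ?D (x - grid_point N j))"
      by (rule sum.reindex_bij_betw[OF h])
    also have "\<dots> = (\<Sum>j\<in>?G. Re (?w (grid_point N j)) * ?D (x - grid_point N j)) / real N ^ CARD('d)"
      by (simp only: sum_divide_distrib times_divide_eq_left)
    also have "(\<Sum>j\<in>?G. Re (?w (grid_point N j)) * ?D (x - grid_point N j))
        = Re (\<Sum>j\<in>?G. ?w (grid_point N j) * complex_of_real (?D (x - grid_point N j)))"
      unfolding Re_sum[of _ ?G] by (intro sum.cong) auto
    also have "\<dots> = Re (of_nat N ^ CARD('d) * ?w x)" by (simp only: rep)
    also have "\<dots> = real N ^ CARD('d) * Re (?w x)"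
    proof -
      have "Re (of_nat N ^ CARD('d) * z) = real N ^ CARD('d) * Re z" for z
        using Re_divide_of_real[of z] by (simp add: complex_eq_iff flip: of_nat_power)
      then show ?thesis .
    qed
    finally show ?thesis by (simp add: N_def)
  qed
  have "(INF c. INF y\<in>{y. \<forall>l\<in>{1..n}. y l \<in> torus}. ennreal (l2norm (\<lambda>x. f x - (\<Sum>l = 1..n. c l * ?D (x - y l)))))
     \<le> ennreal (l2norm (\<lambda>x. f x - (\<Sum>l = 1..n. c l * ?D (x - y l))))"
    by (rule INF_lower2[of c], simp, rule INF_lower[OF y])
  also have "\<dots> \<le> ennreal (1 / B + e)"
    unfolding t using S(3) by (rule ennreal_leI)
  also have "\<dots> = ennreal (1 / B) + ennreal e"
    using B(1) e by (intro ennreal_plus) auto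
  finally show "(INF c. INF y\<in>{y. \<forall>l\<in>{1..n}. y l \<in> torus}. ennreal (l2norm (\<lambda>x. f x - (\<Sum>l = 1..n. c l * ?D (x - y l)))))
     \<le> ennreal (1 / B) + ennreal e" .
qed

end

section \<open>Sign vectors far from polynomial maps\<close>

text \<open>Gram-Schmidt for functions on \<open>X\<close>. A vector that depends on its
  predecessors is replaced by zero instead of being removed, so the index set stays \<open>T\<close>
  and no basis has to be selected.\<close>

lemma exists_orthonormal_system:
  fixes u :: "'t \<Rightarrow> 'x \<Rightarrow> real"
  assumes "finite X" "finite T"
  shows "\<exists>w :: 't \<Rightarrow> 'x \<Rightarrow> real.
     (\<forall>i\<in>T. \<forall>j\<in>T. i \<noteq> j \<longrightarrow> (\<Sum>x\<in>X. w i x * w j x) = 0) \<and>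
     (\<forall>i\<in>T. (\<Sum>x\<in>X. w i x * w i x) = 0 \<or> (\<Sum>x\<in>X. w i x * w i x) = 1) \<and>
     (\<forall>i\<in>T. \<exists>c. \<forall>x\<in>X. u i x = (\<Sum>j\<in>T. c j * w j x))"
  using assms(2)
proof (induction T rule: finite_induct)
  case (insert t T)
  obtain w :: "'t \<Rightarrow> 'x \<Rightarrow> real" where
    w: "(\<forall>i\<in>T. \<forall>j\<in>T. i \<noteq> j \<longrightarrow> (\<Sum>x\<in>X. w i x * w j x) = 0) \<and>
      (\<forall>i\<in>T. (\<Sum>x\<in>X. w i x * w i x) = 0 \<or> (\<Sum>x\<in>X. w i x * w i x) = 1) \<and>
      (\<forall>i\<in>T. \<exists>c. \<forall>x\<in>X. u i x = (\<Sum>j\<in>T. c j * w j x))"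
    using insert.IH ..
  from w have w0: "\<And>i j. i \<in> T \<Longrightarrow> j \<in> T \<Longrightarrow> i \<noteq> j \<Longrightarrow> (\<Sum>x\<in>X. w i x * w j x) = 0"
    by (elim conjE) blast
  from w have w1: "\<And>i. i \<in> T \<Longrightarrow> (\<Sum>x\<in>X. w i x * w i x) = 0 \<or> (\<Sum>x\<in>X. w i x * w i x) = 1"
    by (elim conjE) blast
  from w have wu: "\<And>i. i \<in> T \<Longrightarrow> \<exists>c. \<forall>x\<in>X. u i x = (\<Sum>j\<in>T. c j * w j x)"
    by (elim conjE) blast
  define p where "p j = (\<Sum>x\<in>X. u t x * w j x)" for j
  define v where "v x = u t x - (\<Sum>j\<in>T. p j * w j x)" for x
  define r where "r = sqrt (\<Sum>x\<in>X. v x * v x)"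
  define w' where "w' = w(t := (\<lambda>x. v x / r))"
  have vw: "(\<Sum>x\<in>X. v x * w j x) = 0" if j: "j \<in> T" for j
  proof -
    have "(\<Sum>x\<in>X. v x * w j x) = p j - (\<Sum>i\<in>T. p i * (\<Sum>x\<in>X. w i x * w j x))"
      unfolding v_def left_diff_distrib sum_subtractf p_def[of j] sum_distrib_left sum_distrib_right
      by (subst sum.swap) (simp add: mult_ac)
    also have "(\<Sum>i\<in>T. p i * (\<Sum>x\<in>X. w i x * w j x)) = (\<Sum>i\<in>T. if i = j then p j * (\<Sum>x\<in>X. w j x * w j x) else 0)"
      using w0 j by (intro sum.cong) auto
    also have "\<dots> = p j * (\<Sum>x\<in>X. w j x * w j x)"
      using insert.hyps j by simp
    also have "\<dots> = p j"
      using w1[OF j]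
    proof
      assume z: "(\<Sum>x\<in>X. w j x * w j x) = 0"
      then have "\<forall>x\<in>X. w j x * w j x = 0"
        using assms(1) by (subst (asm) sum_nonneg_eq_0_iff) auto
      then have "p j = 0" unfolding p_def by (intro sum.neutral) auto
      with z show ?thesis by simp
    qed simp
    finally show ?thesis by simp
  qed
  have r2: "r * r = (\<Sum>x\<in>X. v x * v x)"
    unfolding r_def by (simp add: sum_nonneg)
  \<comment> \<open>If \<open>r = 0\<close>, then \<open>v\<close> vanishes on \<open>X\<close>, in
    accordance with division by 0 giving 0.\<close>
  have vr: "v x = r * (v x / r)" if "x \<in> X" for x
  proof (cases "r = 0")
    case True
    then have "(\<Sum>x\<in>X. v x * v x) = 0" using r2 by simp
    then have "v x * v x = 0" using that assms(1) by (subst (asm) sum_nonneg_eq_0_iff) auto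
    then show ?thesis using True by simp
  qed simp
  have w't: "w' t = (\<lambda>x. v x / r)" and w'o: "\<And>j. j \<in> T \<Longrightarrow> w' j = w j"
    using insert.hyps by (auto simp: w'_def)
  have split: "(\<Sum>j\<in>insert t T. c j * w' j x) = c t * (v x / r) + (\<Sum>j\<in>T. c j * w j x)" for c x
    using insert.hyps by (simp add: w't w'o)
  show ?case
  proof (intro exI[of _ w'] conjI ballI impI)
    fix i j assume ij: "i \<in> insert t T" "j \<in> insert t T" "i \<noteq> j"
    have "(\<Sum>x\<in>X. (v x / r) * w k x) = 0" "(\<Sum>x\<in>X. w k x * (v x / r)) = 0" if "k \<in> T" for k
      using vw[OF that] by (simp_all add: sum_divide_distrib[symmetric] mult.commute)
    then show "(\<Sum>x\<in>X. w' i x * w' j x) = 0"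
      using ij w0 by (auto simp: w't w'o)
  next
    fix i assume i: "i \<in> insert t T"
    have "(\<Sum>x\<in>X. (v x / r) * (v x / r)) = (r * r) / (r * r)"
      by (simp only: times_divide_times_eq sum_divide_distrib[symmetric] r2[symmetric])
    then have "(\<Sum>x\<in>X. (v x / r) * (v x / r)) = 0 \<or> (\<Sum>x\<in>X. (v x / r) * (v x / r)) = 1"
      by (cases "r = 0") auto
    then show "(\<Sum>x\<in>X. w' i x * w' i x) = 0 \<or> (\<Sum>x\<in>X. w' i x * w' i x) = 1"
      using i w1 w't w'o by fastforce
  next
    fix i assume i: "i \<in> insert t T"
    show "\<exists>c. \<forall>x\<in>X. u i x = (\<Sum>j\<in>insert t T. c j * w' j x)"
    proof (cases "i = t")
      case True
      have "u t x = (\<Sum>j\<in>insert t T. (p(t := r)) j * w' j x)" if "x \<in> X" for x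
      proof -
        have "(\<Sum>j\<in>T. (p(t := r)) j * w j x) = (\<Sum>j\<in>T. p j * w j x)"
          using insert.hyps by (intro sum.cong) auto
        then show ?thesis unfolding split using vr[OF that] by (simp add: v_def)
      qed
      then show ?thesis using True by blast
    next
      case False
      then obtain c where c: "\<forall>x\<in>X. u i x = (\<Sum>j\<in>T. c j * w j x)" using wu i by blast
      have "u i x = (\<Sum>j\<in>insert t T. (c(t := 0)) j * w' j x)" if "x \<in> X" for x
      proof -
        have "(\<Sum>j\<in>T. (c(t := 0)) j * w j x) = (\<Sum>j\<in>T. c j * w j x)"
          using insert.hyps by (intro sum.cong) auto
        then show ?thesis unfolding split using c that by simp
      qed
      then show ?thesis by blast
    qed
  qed
qed simp

text \<open>The squared evaluation functionals at the points of \<open>X\<close>, restricted to a space of dimension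
  at most \<open>card T\<close>, have total norm at most \<open>card T\<close>; take the point where it is smallest.\<close>

lemma exists_small_evaluation:
  fixes u :: "'t \<Rightarrow> 'x \<Rightarrow> real"
  assumes X: "finite X" "X \<noteq> {}" and T: "finite T"
  obtains x where "x \<in> X"
    "\<And>v a. (\<And>y. y \<in> X \<Longrightarrow> v y = (\<Sum>i\<in>T. a i * u i y)) \<Longrightarrow>
       real (card X) * (v x)\<^sup>2 \<le> real (card T) * (\<Sum>y\<in>X. (v y)\<^sup>2)"
proof -
  obtain w :: "'t \<Rightarrow> 'x \<Rightarrow> real" where
    w: "(\<forall>i\<in>T. \<forall>j\<in>T. i \<noteq> j \<longrightarrow> (\<Sum>x\<in>X. w i x * w j x) = 0) \<and>
      (\<forall>i\<in>T. (\<Sum>x\<in>X. w i x * w i x) = 0 \<or> (\<Sum>x\<in>X. w i x * w i x) = 1) \<and>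
      (\<forall>i\<in>T. \<exists>c. \<forall>x\<in>X. u i x = (\<Sum>j\<in>T. c j * w j x))"
    using exists_orthonormal_system[OF X(1) T, of u] ..
  from w have w0: "\<And>i j. i \<in> T \<Longrightarrow> j \<in> T \<Longrightarrow> i \<noteq> j \<Longrightarrow> (\<Sum>x\<in>X. w i x * w j x) = 0"
    by (elim conjE) blast
  from w have w1: "\<And>i. i \<in> T \<Longrightarrow> (\<Sum>x\<in>X. w i x * w i x) = 0 \<or> (\<Sum>x\<in>X. w i x * w i x) = 1"
    by (elim conjE) blast
  from w have wu: "\<And>i. i \<in> T \<Longrightarrow> \<exists>c. \<forall>x\<in>X. u i x = (\<Sum>j\<in>T. c j * w j x)"
    by (elim conjE) blast
  define s where "s i = (\<Sum>x\<in>X. w i x * w i x)" for i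
  \<comment> \<open>Squared norm of the evaluation at \<open>x\<close> on the span of
    \<open>w\<close>: the diagonal of its reproducing kernel.\<close>
  define \<kappa> where "\<kappa> x = (\<Sum>i\<in>T. (w i x)\<^sup>2)" for x
  have s01: "s i = 0 \<or> s i = 1" if "i \<in> T" for i using w1[OF that] by (simp add: s_def)
  have "\<exists>x\<in>X. real (card X) * \<kappa> x \<le> real (card T)"
  proof (rule ccontr)
    assume "\<not> ?thesis"
    then have "(\<Sum>x\<in>X. real (card T)) < (\<Sum>x\<in>X. real (card X) * \<kappa> x)"
      using X by (intro sum_strict_mono) auto
    also have "\<dots> = real (card X) * (\<Sum>i\<in>T. s i)"
      unfolding \<kappa>_def s_def sum_distrib_left by (subst sum.swap) (simp add: power2_eq_square)
    also have "\<dots> \<le> real (card X) * (\<Sum>i\<in>T. 1)"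
      using s01 by (intro mult_left_mono sum_mono) fastforce+
    finally show False by simp
  qed
  then obtain x where x: "x \<in> X" "real (card X) * \<kappa> x \<le> real (card T)" by blast
  show thesis
  proof (rule that[OF x(1)])
    fix v and a :: "'t \<Rightarrow> real" assume v: "\<And>y. y \<in> X \<Longrightarrow> v y = (\<Sum>i\<in>T. a i * u i y)"
    obtain c where c: "\<And>i y. i \<in> T \<Longrightarrow> y \<in> X \<Longrightarrow> u i y = (\<Sum>j\<in>T. c i j * w j y)"
      using wu by metis
    define t where "t j = (\<Sum>i\<in>T. a i * c i j)" for j
    have vt: "v y = (\<Sum>j\<in>T. t j * w j y)" if "y \<in> X" for y
    proof -
      have "v y = (\<Sum>i\<in>T. \<Sum>j\<in>T. a i * c i j * w j y)"
        unfolding v[OF that] using c that by (simp add: sum_distrib_left mult.assoc)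
      also have "\<dots> = (\<Sum>j\<in>T. t j * w j y)"
        unfolding t_def sum_distrib_right by (rule sum.swap)
      finally show ?thesis .
    qed
    have norm: "(\<Sum>y\<in>X. (v y)\<^sup>2) = (\<Sum>i\<in>T. (t i)\<^sup>2 * s i)"
    proof -
      have "(\<Sum>y\<in>X. (v y)\<^sup>2) = (\<Sum>y\<in>X. \<Sum>i\<in>T. \<Sum>j\<in>T. t i * t j * (w i y * w j y))"
        using vt by (simp add: power2_eq_square sum_product mult_ac)
      also have "\<dots> = (\<Sum>i\<in>T. \<Sum>y\<in>X. \<Sum>j\<in>T. t i * t j * (w i y * w j y))"
        by (rule sum.swap)
      also have "\<dots> = (\<Sum>i\<in>T. \<Sum>j\<in>T. \<Sum>y\<in>X. t i * t j * (w i y * w j y))"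
        by (intro sum.cong refl sum.swap)
      also have "\<dots> = (\<Sum>i\<in>T. \<Sum>j\<in>T. if j = i then (t i)\<^sup>2 * s i else 0)"
        using w0 by (intro sum.cong refl) (auto simp: s_def power2_eq_square simp flip: sum_distrib_left)
      finally show ?thesis using T by simp
    qed
    \<comment> \<open>Inserting \<open>s i\<close> changes nothing, since \<open>w i\<close>
      vanishes on \<open>X\<close> when \<open>s i = 0\<close>; it makes Cauchy-Schwarz produce
      exactly the norm computed above.\<close>
    have "v x = (\<Sum>i\<in>T. (t i * s i) * w i x)"
      unfolding vt[OF x(1)]
    proof (intro sum.cong refl)
      fix i assume i: "i \<in> T"
      show "t i * w i x = t i * s i * w i x"
        using s01[OF i]
      proof
        assume z: "s i = 0"
        then have "w i x * w i x = 0"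
          unfolding s_def using X(1) x(1) by (subst (asm) sum_nonneg_eq_0_iff) auto
        then show ?thesis by simp
      qed simp
    qed
    then have "(v x)\<^sup>2 \<le> (\<Sum>i\<in>T. (t i * s i)\<^sup>2) * \<kappa> x"
      unfolding \<kappa>_def by (metis Cauchy_Schwarz_ineq_sum)
    also have "(\<Sum>i\<in>T. (t i * s i)\<^sup>2) = (\<Sum>i\<in>T. (t i)\<^sup>2 * s i)"
      using s01 by (intro sum.cong) (auto simp: power_mult_distrib power2_eq_square)
    finally have "real (card X) * (v x)\<^sup>2 \<le> real (card X) * ((\<Sum>i\<in>T. (t i)\<^sup>2 * s i) * \<kappa> x)"
      by (intro mult_left_mono) auto
    also have "\<dots> = (real (card X) * \<kappa> x) * (\<Sum>y\<in>X. (v y)\<^sup>2)" by (simp add: norm)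
    also have "\<dots> \<le> real (card T) * (\<Sum>y\<in>X. (v y)\<^sup>2)"
      using x(2) by (intro mult_right_mono sum_nonneg) auto
    finally show "real (card X) * (v x)\<^sup>2 \<le> real (card T) * (\<Sum>y\<in>X. (v y)\<^sup>2)" .
  qed
qed

text \<open>The values at 1 and -1 are 5 and 1. Being quadratic, it only doubles the degree of what
  is substituted for \<open>t\<close>.\<close>

definition bump :: "real \<Rightarrow> real" where
  "bump t = (t + 1)\<^sup>2 + 1"

lemma bump_pos: "bump t > 0"
  by (simp add: bump_def add_nonneg_pos)

text \<open>\<open>bump\<close> is much larger at \<open>1\<close> than at \<open>-1\<close>, and bounded below so that no coordinate can
  spoil a product of its values.\<close>

lemma bump_exp_bound: "(bump t)\<^sup>2 + (bump (- t))\<^sup>2 \<le> (bump t)\<^sup>2 * exp (3/20 + 144 * (t - 1)\<^sup>2)"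
proof -
  define v where "v = t - 1"
  have bm: "bump (- t) = v\<^sup>2 + 1" and bp: "bump t = (v + 2)\<^sup>2 + 1"
    by (simp_all add: bump_def v_def power2_eq_square algebra_simps)
  \<comment> \<open>For \<open>v\<close> in the middle range the squared ratio of the two values is
    at most \<open>(5/13)\<^sup>2\<close>, just below \<open>3/20\<close>. Beyond it the ratio is at
    most 6, and \<open>144 * (1/2)\<^sup>2 = 36\<close> pays for its square; this is where
    \<open>144\<close> comes from.\<close>
  have "(bump (- t))\<^sup>2 \<le> (3/20 + 144 * v\<^sup>2) * (bump t)\<^sup>2"
  proof (cases "\<bar>v\<bar> \<le> 1/2")
    case True
    have 1: "v\<^sup>2 \<le> (1/2)\<^sup>2" using True by (metis abs_ge_zero power2_abs power_mono)
    have "(v\<^sup>2 + 1)\<^sup>2 \<le> (5/4)\<^sup>2" using 1 by (intro power_mono) (auto simp: power2_eq_square)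
    also have "\<dots> \<le> 3/20 * (13/4)\<^sup>2" by (simp add: power2_eq_square)
    also have "(13/4)\<^sup>2 \<le> ((v + 2)\<^sup>2 + 1)\<^sup>2"
    proof (intro power_mono)
      have "(3/2)\<^sup>2 \<le> (v + 2)\<^sup>2" using True by (intro power_mono) (auto simp: abs_le_iff)
      then show "13/4 \<le> (v + 2)\<^sup>2 + 1" by (simp add: power2_eq_square)
    qed simp
    also have "3/20 * ((v + 2)\<^sup>2 + 1)\<^sup>2 \<le> (3/20 + 144 * v\<^sup>2) * ((v + 2)\<^sup>2 + 1)\<^sup>2"
      by (intro mult_right_mono) auto
    finally show ?thesis by (simp add: bm bp)
  next
    case False
    have "v\<^sup>2 \<ge> (1/2)\<^sup>2" using False by (metis abs_ge_zero power2_abs power_mono less_imp_le not_le zero_le_divide_1_iff zero_le_numeral)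
    then have v: "36 \<le> 3/20 + 144 * v\<^sup>2" by (simp add: power2_eq_square)
    \<comment> \<open>The completed square of
      \<open>6 * ((v + 2)\<^sup>2 + 1) - (v\<^sup>2 + 1)\<close>.\<close>
    have "0 \<le> 5 * (v + 12/5)\<^sup>2 + 1/5" by simp
    then have "v\<^sup>2 + 1 \<le> 6 * ((v + 2)\<^sup>2 + 1)" by (simp add: power2_eq_square algebra_simps)
    then have "(v\<^sup>2 + 1)\<^sup>2 \<le> (6 * ((v + 2)\<^sup>2 + 1))\<^sup>2" by (intro power_mono) auto
    also have "\<dots> = 36 * ((v + 2)\<^sup>2 + 1)\<^sup>2" unfolding power_mult_distrib by simp
    also have "\<dots> \<le> (3/20 + 144 * v\<^sup>2) * ((v + 2)\<^sup>2 + 1)\<^sup>2" using v by (intro mult_right_mono) auto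
    finally show ?thesis by (simp add: bm bp)
  qed
  then have "(bump t)\<^sup>2 + (bump (- t))\<^sup>2 \<le> (bump t)\<^sup>2 * (1 + (3/20 + 144 * v\<^sup>2))"
    by (simp add: algebra_simps)
  also have "\<dots> \<le> (bump t)\<^sup>2 * exp (3/20 + 144 * v\<^sup>2)"
    by (intro mult_left_mono exp_ge_add_one_self) auto
  finally show ?thesis by (simp add: v_def)
qed

text \<open>The roles of points and functions are interchanged: for fixed \<open>t\<close>, the
  vector of products indexed by \<open>\<eta>\<close> lies in the span of the functions
  \<open>\<lambda>\<eta>. a \<eta> j\<close>, with \<open>b j t\<close> as coefficients. This span
  does not depend on \<open>t\<close>, so one \<open>\<epsilon>\<close> serves all
  \<open>t\<close>.\<close>

lemma exists_far_sign_vector: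
  fixes F :: "'i \<Rightarrow> 't \<Rightarrow> real" and b :: "'j \<Rightarrow> 't \<Rightarrow> real"
  assumes I: "finite I" and T: "finite T" "real (card T) \<le> exp (2/5 * real (card I))"
    and span: "\<And>\<eta>. \<eta> \<in> PiE I (\<lambda>_. {-1, 1}) \<Longrightarrow> \<exists>a. \<forall>t. (\<Prod>i\<in>I. bump (\<eta> i * F i t)) = (\<Sum>j\<in>T. a j * b j t)"
  obtains \<epsilon> where "\<And>i. i \<in> I \<Longrightarrow> (\<epsilon> i)\<^sup>2 = 1" "\<And>t. real (card I) / 1600 \<le> (\<Sum>i\<in>I. (\<epsilon> i - F i t)\<^sup>2)"
proof -
  let ?X = "PiE I (\<lambda>_. {-1, 1 :: real})"
  have X: "finite ?X" "?X \<noteq> {}" using I by (auto simp: PiE_eq_empty_iff finite_PiE)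
  have cX: "card ?X = 2 ^ card I" using I by (simp add: card_PiE numeral_2_eq_2)
  obtain a where a: "\<And>\<eta> t. \<eta> \<in> ?X \<Longrightarrow> (\<Prod>i\<in>I. bump (\<eta> i * F i t)) = (\<Sum>j\<in>T. a \<eta> j * b j t)"
    using span by metis
  obtain \<epsilon> where \<epsilon>: "\<epsilon> \<in> ?X" and ev: "\<And>v c. (\<And>\<eta>. \<eta> \<in> ?X \<Longrightarrow> v \<eta> = (\<Sum>j\<in>T. c j * a \<eta> j)) \<Longrightarrow>
       real (card ?X) * (v \<epsilon>)\<^sup>2 \<le> real (card T) * (\<Sum>\<eta>\<in>?X. (v \<eta>)\<^sup>2)"
    using exists_small_evaluation[OF X T(1), of "\<lambda>j \<eta>. a \<eta> j"] by blast
  have e1: "\<epsilon> i = 1 \<or> \<epsilon> i = - 1" if "i \<in> I" for i using \<epsilon> that by (auto simp: PiE_iff)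
  show thesis
  proof (rule that)
    show "(\<epsilon> i)\<^sup>2 = 1" if "i \<in> I" for i using e1[OF that] by auto
    fix t
    let ?N = "real (card I)" and ?D = "\<Sum>i\<in>I. (\<epsilon> i - F i t)\<^sup>2"
    let ?G = "\<lambda>\<eta>. \<Prod>i\<in>I. bump (\<eta> i * F i t)"
    have Gpos: "?G \<epsilon> > 0" by (intro prod_pos) (simp add: bump_pos)
    have "2 ^ card I * (?G \<epsilon>)\<^sup>2 \<le> real (card T) * (\<Sum>\<eta>\<in>?X. (?G \<eta>)\<^sup>2)"
      using ev[of ?G "\<lambda>j. b j t"] a by (simp add: cX mult.commute)
    also have "(\<Sum>\<eta>\<in>?X. (?G \<eta>)\<^sup>2) = (\<Sum>\<eta>\<in>?X. \<Prod>i\<in>I. (bump (\<eta> i * F i t))\<^sup>2)"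
      by (simp add: prod_power_distrib)
    \<comment> \<open>The sum over all sign vectors factorises, so each coordinate contributes one
      instance of \<open>bump_exp_bound\<close>.\<close>
    also have "\<dots> = (\<Prod>i\<in>I. \<Sum>s\<in>{-1, 1}. (bump (s * F i t))\<^sup>2)"
      using I by (intro prod_sum_PiE[symmetric]) auto
    also have "\<dots> \<le> (\<Prod>i\<in>I. (bump (\<epsilon> i * F i t))\<^sup>2 * exp (3/20 + 144 * (\<epsilon> i - F i t)\<^sup>2))"
    proof (intro prod_mono conjI)
      fix i assume i: "i \<in> I"
      have "(\<Sum>s\<in>{-1, 1}. (bump (s * F i t))\<^sup>2) = (bump (\<epsilon> i * F i t))\<^sup>2 + (bump (- (\<epsilon> i * F i t)))\<^sup>2"
        using e1[OF i] by auto
      also have "\<dots> \<le> (bump (\<epsilon> i * F i t))\<^sup>2 * exp (3/20 + 144 * (\<epsilon> i * F i t - 1)\<^sup>2)"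
        by (rule bump_exp_bound)
      also have "(\<epsilon> i * F i t - 1)\<^sup>2 = (\<epsilon> i - F i t)\<^sup>2"
        using e1[OF i] by (auto simp: power2_eq_square algebra_simps)
      finally show "(\<Sum>s\<in>{-1, 1}. (bump (s * F i t))\<^sup>2) \<le> (bump (\<epsilon> i * F i t))\<^sup>2 * exp (3/20 + 144 * (\<epsilon> i - F i t)\<^sup>2)" .
    qed (auto intro: sum_nonneg)
    also have "\<dots> = (?G \<epsilon>)\<^sup>2 * exp (3/20 * ?N + 144 * ?D)"
      using I by (simp add: prod.distrib prod_power_distrib exp_sum[symmetric] sum.distrib sum_distrib_left)
    finally have "2 ^ card I * (?G \<epsilon>)\<^sup>2 \<le> real (card T) * ((?G \<epsilon>)\<^sup>2 * exp (3/20 * ?N + 144 * ?D))"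
      by (simp add: mult_left_mono)
    then have "2 ^ card I * (?G \<epsilon>)\<^sup>2 \<le> (real (card T) * exp (3/20 * ?N + 144 * ?D)) * (?G \<epsilon>)\<^sup>2"
      by (simp only: mult_ac)
    then have "2 ^ card I \<le> real (card T) * exp (3/20 * ?N + 144 * ?D)"
      using Gpos by (subst (asm) mult_le_cancel_right_pos) auto
    also have "\<dots> \<le> exp (2/5 * ?N) * exp (3/20 * ?N + 144 * ?D)"
      using T(2) by (intro mult_right_mono) auto
    also have "\<dots> = exp (11/20 * ?N + 144 * ?D)"
      by (simp flip: exp_add)
    finally have "ln (2 ^ card I) \<le> ln (exp (11/20 * ?N + 144 * ?D))"
      by (subst ln_le_cancel_iff) auto
    then have "?N * ln 2 \<le> 11/20 * ?N + 144 * ?D" by (simp add: ln_realpow)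
    moreover have "?N * (2/3) \<le> ?N * ln 2" using ln2_ge_two_thirds by (intro mult_left_mono) auto
    \<comment> \<open>The margin \<open>2/3 - 11/20 = 7/60\<close>, divided by 144, exceeds
      \<open>1/1600\<close>. The square \<open>1600 = 40\<^sup>2\<close> is the origin of the factor
      40 in \<open>M_lower\<close>.\<close>
    ultimately show "?N / 1600 \<le> ?D" by simp
  qed
qed

section \<open>Spans of monomials in the coefficients and the shifts\<close>

definition lspan :: "('j \<Rightarrow> 't \<Rightarrow> complex) \<Rightarrow> 'j set \<Rightarrow> ('t \<Rightarrow> complex) set" where
  "lspan b J = {f. \<exists>a. \<forall>t. f t = (\<Sum>j\<in>J. a j * b j t)}"

lemma lspan_zero: "(\<lambda>t. 0) \<in> lspan b J"
  unfolding lspan_def by (auto intro!: exI[of _ "\<lambda>_. 0"])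

lemma lspan_base: "finite J \<Longrightarrow> j \<in> J \<Longrightarrow> b j \<in> lspan b J"
proof -
  assume j: "finite J" "j \<in> J"
  have "(\<Sum>i\<in>J. (if i = j then 1 else 0) * b i t) = (\<Sum>i\<in>J. if i = j then b i t else 0)" for t
    by (intro sum.cong) auto
  then have "\<forall>t. b j t = (\<Sum>i\<in>J. (if i = j then 1 else 0) * b i t)"
    using j by simp
  then show "b j \<in> lspan b J"
    unfolding lspan_def by (intro CollectI exI[of _ "\<lambda>i. if i = j then 1 else 0"])
qed

lemma lspan_scale:
  assumes "f \<in> lspan b J" shows "(\<lambda>t. c * f t) \<in> lspan b J"
proof -
  obtain a where "\<forall>t. f t = (\<Sum>j\<in>J. a j * b j t)" using assms by (auto simp: lspan_def)
  then show ?thesis unfolding lspan_def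
    by (auto intro!: exI[of _ "\<lambda>j. c * a j"] simp: sum_distrib_left mult.assoc)
qed

lemma lspan_add:
  assumes "f \<in> lspan b J" "g \<in> lspan b J" shows "(\<lambda>t. f t + g t) \<in> lspan b J"
proof -
  obtain a a' where "\<forall>t. f t = (\<Sum>j\<in>J. a j * b j t)" "\<forall>t. g t = (\<Sum>j\<in>J. a' j * b j t)"
    using assms by (auto simp: lspan_def)
  then show ?thesis unfolding lspan_def
    by (auto intro!: exI[of _ "\<lambda>j. a j + a' j"] simp: ring_distribs sum.distrib)
qed

lemma lspan_sum: "(\<And>i. i \<in> I \<Longrightarrow> f i \<in> lspan b J) \<Longrightarrow> (\<lambda>t. \<Sum>i\<in>I. f i t) \<in> lspan b J"
proof (induction I rule: infinite_finite_induct)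
  case (insert i I)
  then show ?case by (simp add: lspan_add)
qed (simp_all add: lspan_zero)

lemma lspan_mult:
  assumes f: "f \<in> lspan b J" and g: "g \<in> lspan b J'"
    and b: "\<And>j j'. j \<in> J \<Longrightarrow> j' \<in> J' \<Longrightarrow> (\<lambda>t. b j t * b j' t) \<in> lspan b J''"
  shows "(\<lambda>t. f t * g t) \<in> lspan b J''"
proof -
  obtain a a' where a: "\<And>t. f t = (\<Sum>j\<in>J. a j * b j t)" "\<And>t. g t = (\<Sum>j\<in>J'. a' j * b j t)"
    using f g by (auto simp: lspan_def)
  have "f t * g t = (\<Sum>j\<in>J. \<Sum>j'\<in>J'. (a j * a' j') * (b j t * b j' t))" for t
    unfolding a sum_product by (simp only: mult_ac)
  then have eq: "(\<lambda>t. f t * g t) = (\<lambda>t. \<Sum>j\<in>J. \<Sum>j'\<in>J'. (a j * a' j') * (b j t * b j' t))" by auto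
  show ?thesis unfolding eq by (intro lspan_sum lspan_scale b)
qed

text \<open>Passes from complex to real spans at the price of doubling the family, which is the
  leading factor 2 in the count of \<open>M_lower\<close>. The minus sign in the witness is that of
  the real part of a product.\<close>

lemma lspan_real:
  assumes J: "finite J" and f: "(\<lambda>t. complex_of_real (f t)) \<in> lspan b J"
  shows "\<exists>a. \<forall>t. f t = (\<Sum>(j, r)\<in>J \<times> (UNIV :: bool set). a (j, r) * (if r then Re (b j t) else Im (b j t)))"
proof -
  obtain a where a: "\<And>t. complex_of_real (f t) = (\<Sum>j\<in>J. a j * b j t)" using f by (auto simp: lspan_def)
  have "f t = (\<Sum>j\<in>J. Re (a j) * Re (b j t) - Im (a j) * Im (b j t))" for t
    using arg_cong[OF a[of t], of Re] by simp
  then show ?thesis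
    by (intro exI[of _ "\<lambda>(j, r). if r then Re (a j) else - Im (a j)"] allI)
       (simp add: sum.cartesian_product[symmetric] UNIV_bool)
qed

definition shift_monom :: "nat \<Rightarrow> (nat \<Rightarrow> nat) \<times> (nat \<Rightarrow> int ^ 'd) \<Rightarrow> (nat \<Rightarrow> real) \<times> (nat \<Rightarrow> real ^ 'd) \<Rightarrow> complex" where
  "shift_monom n = (\<lambda>(\<alpha>, \<kappa>) (c, y). \<Prod>l\<in>{1..n}. complex_of_real (c l) ^ \<alpha> l * chr (\<kappa> l) (y l))"

text \<open>The degree is bounded for each translate separately, not in total, so that the count is
  an \<open>n\<close>-th power. The unit of frequency is \<open>m\<close>, the degree of one factor
  in the shifts, and extensional functions keep the set finite.\<close>

definition shift_index :: "nat \<Rightarrow> nat \<Rightarrow> nat \<Rightarrow> ((nat \<Rightarrow> nat) \<times> (nat \<Rightarrow> int ^ 'd)) set" where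
  "shift_index n m s = PiE {1..n} (\<lambda>_. {..s}) \<times> PiE {1..n} (\<lambda>_. freq_box (int (s * m)))"

lemma finite_shift_index: "finite (shift_index n m s)"
  unfolding shift_index_def by (intro finite_cartesian_product finite_PiE finite_freq_box) auto

lemma card_shift_index:
  "card (shift_index n m s :: ((nat \<Rightarrow> nat) \<times> (nat \<Rightarrow> int ^ 'd)) set)
    = ((s + 1) * (2 * s * m + 1) ^ CARD('d)) ^ n"
proof -
  have "nat (2 * int (s * m) + 1) = 2 * s * m + 1" by (simp add: nat_add_distrib nat_mult_distrib)
  then show ?thesis
    unfolding shift_index_def card_cartesian_product
    by (simp add: card_PiE card_freq_box flip: power_mult_distrib)
qed

abbreviation shift_span :: "nat \<Rightarrow> nat \<Rightarrow> nat \<Rightarrow> ((nat \<Rightarrow> real) \<times> (nat \<Rightarrow> real ^ 'd) \<Rightarrow> complex) set" where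
  "shift_span n m s \<equiv> lspan (shift_monom n) (shift_index n m s)"

lemma shift_span_mult:
  assumes "f \<in> shift_span n m s" "g \<in> shift_span n m s'"
  shows "(\<lambda>t. f t * g t) \<in> shift_span n m (s + s')"
proof (rule lspan_mult[OF assms])
  fix j j' :: "(nat \<Rightarrow> nat) \<times> (nat \<Rightarrow> int ^ 'a)"
  assume j: "j \<in> shift_index n m s" and j': "j' \<in> shift_index n m s'"
  obtain \<alpha> \<kappa> \<alpha>' \<kappa>' where jk: "j = (\<alpha>, \<kappa>)" "j' = (\<alpha>', \<kappa>')" by (metis surj_pair)
  let ?j = "(\<lambda>l\<in>{1..n}. \<alpha> l + \<alpha>' l, \<lambda>l\<in>{1..n}. \<kappa> l + \<kappa>' l)"
  have "?j \<in> shift_index n m (s + s')"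
  proof -
    have "\<alpha> l + \<alpha>' l \<le> s + s'" if "l \<in> {1..n}" for l
      using j j' that unfolding jk shift_index_def by (intro add_mono) (auto simp: PiE_iff)
    moreover have "\<kappa> l + \<kappa>' l \<in> freq_box (int ((s + s') * m))" if "l \<in> {1..n}" for l
    proof -
      have "\<kappa> l \<in> freq_box (int (s * m))" "\<kappa>' l \<in> freq_box (int (s' * m))"
        using j j' that unfolding jk shift_index_def by (auto simp: PiE_iff)
      then have "\<bar>(\<kappa> l + \<kappa>' l) $ i\<bar> \<le> int (s * m) + int (s' * m)" for i
        unfolding freq_box_def using abs_triangle_ineq[of "\<kappa> l $ i" "\<kappa>' l $ i"]
        by (simp add: add_mono order_trans[OF abs_triangle_ineq])
      then show ?thesis by (simp add: freq_box_def algebra_simps)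
    qed
    ultimately show ?thesis by (auto simp: shift_index_def)
  qed
  moreover have "(\<lambda>t. shift_monom n j t * shift_monom n j' t) = shift_monom n ?j"
    by (auto simp: shift_monom_def jk fun_eq_iff power_add chr_add_freq prod.distrib[symmetric] mult_ac intro!: prod.cong)
  ultimately show "(\<lambda>t. shift_monom n j t * shift_monom n j' t) \<in> shift_span n m (s + s')"
    by (simp add: lspan_base finite_shift_index)
qed

lemma shift_span_const: "(\<lambda>t. c) \<in> shift_span n m s"
proof -
  let ?j = "(\<lambda>l\<in>{1..n}. 0 :: nat, \<lambda>l\<in>{1..n}. 0 :: int ^ 'a)"
  have "?j \<in> shift_index n m s" by (auto simp: shift_index_def freq_box_def)
  then have "shift_monom n ?j \<in> shift_span n m s" by (simp add: lspan_base finite_shift_index)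
  moreover have "shift_monom n ?j = (\<lambda>t. 1)" by (auto simp: shift_monom_def fun_eq_iff)
  ultimately show ?thesis using lspan_scale[of "\<lambda>t. 1" "shift_monom n" _ c] by simp
qed

lemma shift_span_prod:
  "finite I \<Longrightarrow> (\<And>i. i \<in> I \<Longrightarrow> f i \<in> shift_span n m s) \<Longrightarrow> (\<lambda>t. \<Prod>i\<in>I. f i t) \<in> shift_span n m (card I * s)"
proof (induction I rule: finite_induct)
  case (insert i I)
  then have "(\<lambda>t. f i t * (\<Prod>i\<in>I. f i t)) \<in> shift_span n m (s + card I * s)"
    by (intro shift_span_mult) auto
  then show ?case using insert.hyps by simp
qed (simp add: shift_span_const)

lemma shift_span_single:
  assumes l: "l \<in> {1..n}" and k: "k \<in> freq_box (int m)"
  shows "(\<lambda>(c, y). complex_of_real (c l) * chr k (y l)) \<in> shift_span n m 1"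
proof -
  let ?j = "(\<lambda>i\<in>{1..n}. if i = l then 1 else 0 :: nat, \<lambda>i\<in>{1..n}. if i = l then k else 0)"
  have "?j \<in> shift_index n m 1" using k by (auto simp: shift_index_def freq_box_def)
  then have "shift_monom n ?j \<in> shift_span n m 1" by (rule lspan_base[OF finite_shift_index])
  also have "shift_monom n ?j = (\<lambda>(c, y). complex_of_real (c l) * chr k (y l))"
  proof (intro ext, clarify)
    fix c :: "nat \<Rightarrow> real" and y :: "nat \<Rightarrow> real ^ 'a"
    have "shift_monom n ?j (c, y) = (\<Prod>i\<in>{1..n}. if i = l then complex_of_real (c l) * chr k (y l) else 1)"
      unfolding shift_monom_def case_prod_conv by (rule prod.cong) auto
    then show "shift_monom n ?j (c, y) = complex_of_real (c l) * chr k (y l)"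
      using l by simp
  qed
  finally show ?thesis .
qed

section \<open>The lower bound\<close>

text \<open>Strictly positive coordinates ensure that two members never add up to 0, so the
  associated cosines are orthonormal.\<close>

definition freq_cube :: "nat \<Rightarrow> (int ^ 'd) set" where
  "freq_cube m = {k. \<forall>i. k $ i \<in> {1..int m}}"

lemma finite_freq_cube: "finite (freq_cube m)"
  unfolding freq_cube_def by (rule finite_vec_set) auto

lemma card_freq_cube: "card (freq_cube m :: (int ^ 'd) set) = m ^ CARD('d)"
  unfolding freq_cube_def by (subst card_vec_set) auto

lemma freq_cube_subset_box:
  assumes "k \<in> freq_cube m" shows "k \<in> freq_box (int m)"
proof -
  have "\<bar>k $ i\<bar> \<le> int m" for i
    using assms by (simp add: freq_cube_def abs_le_iff) (meson order_trans neg_le_0_iff_le of_nat_0_le_iff zero_le_one)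
  then show ?thesis by (simp add: freq_box_def)
qed

lemma freq_cube_add_nz: "k \<in> freq_cube m \<Longrightarrow> l \<in> freq_cube m \<Longrightarrow> k + l \<noteq> 0"
proof
  assume "k \<in> freq_cube m" "l \<in> freq_cube m" "k + l = 0"
  then have "k $ i \<ge> 1" "l $ i \<ge> 1" "k $ i + l $ i = 0" for i
    by (auto simp: freq_cube_def vec_eq_iff)
  then show False by (metis add_mono_thms_linordered_semiring(1) not_one_le_zero one_add_one order_trans zero_less_one_class.zero_le_one add_increasing2)
qed

section \<open>Orthonormal cosines and their pairing with translates\<close>

definition ecos :: "int ^ 'd \<Rightarrow> real ^ 'd \<Rightarrow> real" where
  "ecos k x = sqrt 2 * Re (chr k x)"

lemma ecos_L2: "ecos k \<in> L2"
proof (rule trig_poly_real_L2)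
  have "trig_poly_real (\<lambda>x. Re (complex_of_real (sqrt 2) * chr k x))"
    by (intro trig_poly_Re trig_poly_chr)
  then show "trig_poly_real (ecos k)" by (simp add: ecos_def[abs_def])
qed

lemma integral_ecos_mult:
  fixes k l :: "int ^ 'd"
  assumes "k \<in> freq_cube m" "l \<in> freq_cube m"
  shows "(LINT x|tmeas. ecos k x * ecos l x) = (if k = l then 1 else 0)"
proof -
  have i: "integrable tmeas (\<lambda>x. chr q x)" for q :: "int ^ 'd"
    by (rule integrable_bounded_tmeas[of _ 1]) auto
  have "ecos k x * ecos l x = Re (chr (k + l) x) + Re (chr (k + - l) x)" for x
  proof -
    have "ecos k x * ecos l x = (sqrt 2 * sqrt 2) * (Re (chr k x) * Re (chr l x))"
      unfolding ecos_def by (simp only: mult_ac)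
    then show ?thesis unfolding chr_add_freq chr_minus_freq by simp
  qed
  then have "(LINT x|tmeas. ecos k x * ecos l x) = Re (LINT x|tmeas. chr (k + l) x) + Re (LINT x|tmeas. chr (k + - l) x)"
    using i by simp
  then show ?thesis
    using freq_cube_add_nz[OF assms] by (simp add: integral_chr)
qed

lemma integral_ecos_sum_mult:
  fixes l :: "int ^ 'd"
  assumes "l \<in> freq_cube m"
  shows "(LINT x|tmeas. (\<Sum>k\<in>freq_cube m. \<beta> k * ecos k x) * ecos l x) = \<beta> l"
proof -
  have "(LINT x|tmeas. (\<Sum>k\<in>freq_cube m. \<beta> k * ecos k x) * ecos l x) = (LINT x|tmeas. (\<Sum>k\<in>freq_cube m. \<beta> k * (ecos k x * ecos l x)))"
    by (simp only: sum_distrib_right mult.assoc)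
  also have "\<dots> = (\<Sum>k\<in>freq_cube m. \<beta> k * (LINT x|tmeas. ecos k x * ecos l x))"
  proof -
    have "integrable tmeas (\<lambda>x. ecos k x * ecos l x)" for k
      by (rule sqint_integrable_mult[OF L2_D(2)[OF ecos_L2] L2_D(2)[OF ecos_L2]])
    then show ?thesis by simp
  qed
  also have "\<dots> = (\<Sum>k\<in>freq_cube m. if k = l then \<beta> k else 0)"
    using assms by (intro sum.cong) (auto simp: integral_ecos_mult)
  also have "\<dots> = \<beta> l" using assms by (simp add: finite_freq_cube)
  finally show ?thesis .
qed

lemma ecos_sum_L2: "(\<lambda>x. \<Sum>k\<in>freq_cube m. \<beta> k * ecos k x) \<in> L2"
  by (intro L2_sum L2_scale ecos_L2)

lemma integral_ecos_sum_inner: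
  fixes h :: "real ^ 'd \<Rightarrow> real"
  assumes "sqint h"
  shows "(LINT x|tmeas. h x * (\<Sum>k\<in>freq_cube m. \<beta> k * ecos k x)) = (\<Sum>k\<in>freq_cube m. \<beta> k * (LINT x|tmeas. h x * ecos k x))"
proof -
  have "(LINT x|tmeas. h x * (\<Sum>k\<in>freq_cube m. \<beta> k * ecos k x)) = (LINT x|tmeas. (\<Sum>k\<in>freq_cube m. \<beta> k * (h x * ecos k x)))"
    by (simp only: sum_distrib_left mult_ac)
  also have "\<dots> = (\<Sum>k\<in>freq_cube m. \<beta> k * (LINT x|tmeas. h x * ecos k x))"
    using sqint_integrable_mult[OF assms L2_D(2)[OF ecos_L2]] by simp
  finally show ?thesis .
qed

lemma integral_ecos_sum_sq:
  fixes \<beta> :: "int ^ 'd \<Rightarrow> real"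
  shows "(LINT x|tmeas. (\<Sum>k\<in>freq_cube m. \<beta> k * ecos k x)\<^sup>2) = (\<Sum>k\<in>freq_cube m. (\<beta> k)\<^sup>2)"
proof -
  let ?s = "\<lambda>x. \<Sum>k\<in>freq_cube m. \<beta> k * ecos k x"
  have "(LINT x|tmeas. (?s x)\<^sup>2) = (LINT x|tmeas. ?s x * ?s x)" by (simp only: power2_eq_square)
  also have "\<dots> = (\<Sum>k\<in>freq_cube m. \<beta> k * (LINT x|tmeas. ?s x * ecos k x))"
    by (rule integral_ecos_sum_inner[OF L2_D(2)[OF ecos_sum_L2]])
  also have "\<dots> = (\<Sum>k\<in>freq_cube m. (\<beta> k)\<^sup>2)"
    by (intro sum.cong) (simp_all add: integral_ecos_sum_mult power2_eq_square)
  finally show ?thesis .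
qed

lemma integral_sq_diff:
  assumes "sqint f" "sqint g"
  shows "(LINT x|tmeas. (f x - g x)\<^sup>2)
    = (LINT x|tmeas. (f x)\<^sup>2) + (LINT x|tmeas. (g x)\<^sup>2) - 2 * (LINT x|tmeas. f x * g x)"
proof -
  have "(LINT x|tmeas. (f x - g x)\<^sup>2) = (LINT x|tmeas. (f x)\<^sup>2 + (g x)\<^sup>2 - 2 * (f x * g x))"
    by (simp only: power2_diff mult.assoc)
  then show ?thesis
    using assms[THEN sqint_integrable_sq] sqint_integrable_mult[OF assms] by simp
qed

lemma ecos_bessel:
  fixes h :: "real ^ 'd \<Rightarrow> real"
  assumes h: "h \<in> L2"
  shows "(\<Sum>k\<in>freq_cube m. (LINT x|tmeas. h x * ecos k x)\<^sup>2) \<le> (LINT x|tmeas. (h x)\<^sup>2)"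
proof -
  define \<beta> where "\<beta> k = (LINT x|tmeas. h x * ecos k x)" for k
  let ?s = "\<lambda>x. \<Sum>k\<in>freq_cube m. \<beta> k * ecos k x"
  note sL = ecos_sum_L2[of \<beta> m]
  have "0 \<le> (LINT x|tmeas. (h x - ?s x)\<^sup>2)" by simp
  also have "\<dots> = (LINT x|tmeas. (h x)\<^sup>2) + (LINT x|tmeas. (?s x)\<^sup>2) - 2 * (LINT x|tmeas. h x * ?s x)"
    by (rule integral_sq_diff[OF L2_D(2)[OF h] L2_D(2)[OF sL]])
  also have "\<dots> = (LINT x|tmeas. (h x)\<^sup>2) - (\<Sum>k\<in>freq_cube m. (\<beta> k)\<^sup>2)"
    unfolding integral_ecos_sum_inner[OF L2_D(2)[OF h]] integral_ecos_sum_sq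
    by (simp add: \<beta>_def power2_eq_square)
  finally show ?thesis by (simp add: \<beta>_def)
qed

text \<open>As a function of the shift \<open>y\<close>, the pairing combines just the characters at
  \<open>k\<close> and \<open>- k\<close>, and \<open>\<psi>\<close> enters through the constant
  \<open>coef \<psi> k\<close>. However irregular \<open>\<psi>\<close> is, the dependence on
  \<open>y\<close> is thus a trigonometric polynomial.\<close>

lemma integral_translate_ecos:
  fixes \<psi> :: "real ^ 'd \<Rightarrow> real"
  assumes \<psi>: "\<psi> \<in> L2"
  shows "complex_of_real (LINT x|tmeas. \<psi> (x - y) * ecos k x)
    = sqrt 2 / 2 * coef \<psi> k * chr k y + sqrt 2 / 2 * cnj (coef \<psi> k) * chr (- k) y"
proof -
  have [measurable]: "\<psi> \<in> borel_measurable borel" "ecos k \<in> borel_measurable borel"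
    using L2_D(3)[OF \<psi>] L2_D(3)[OF ecos_L2] by auto
  have p: "periodic (\<lambda>x. \<psi> (x - y) * ecos k x)"
    using L2_D(1)[OF L2_translate[OF \<psi>, of y]] L2_D(1)[OF ecos_L2[of k]]
    by (simp only: periodic_def simp_thms)
  have "(LINT x|tmeas. \<psi> (x - y) * ecos k x) = (LINT x|tmeas. \<psi> x * ecos k (y + x))"
    using integral_tmeas_affine[OF _ p, of 1 y] by simp
  also have "\<dots> = (LINT x|tmeas. sqrt 2 * Re (chr k y * (complex_of_real (\<psi> x) * chr k x)))"
    by (intro Bochner_Integration.integral_cong) (auto simp: ecos_def chr_add algebra_simps)
  also have "\<dots> = sqrt 2 * Re (chr k y * coef \<psi> k)"
    using integrable_mult_chr[OF L2_D(2)[OF \<psi>], of k] unfolding coef_def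
    by (subst integral_mult_right_zero, subst integral_Re) (auto simp del: Re_complex_of_real times_complex.sel)
  also have "complex_of_real \<dots> = sqrt 2 / 2 * (chr k y * coef \<psi> k + cnj (chr k y * coef \<psi> k))"
  proof -
    have "complex_of_real (sqrt 2 * Re z) = sqrt 2 / 2 * (z + cnj z)" for z
      by (simp add: complex_eq_iff)
    then show ?thesis .
  qed
  finally show ?thesis by (simp add: chr_minus_freq algebra_simps)
qed

context torus_kernel
begin

lemma conv_ecos: "conv \<phi> (ecos k) x = ecos k x / lam k"
\<comment> \<open>For \<open>k = 0\<close> the two frequencies of the cosine coincide, and the sum
  over \<open>{k, - k}\<close> would lose one of its terms.\<close>
proof (cases "k = 0")
  case True
  have e: "complex_of_real (ecos k x) = (\<Sum>q\<in>{k}. complex_of_real (sqrt 2) * chr q x)" for x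
    using True by (simp add: ecos_def)
  have "complex_of_real (conv \<phi> (ecos k) x) = (\<Sum>q\<in>{k}. complex_of_real (sqrt 2) / lam q * chr q x)"
    by (rule conv_trig_poly[OF _ e]) auto
  also have "\<dots> = complex_of_real (ecos k x / lam k)" using True by (simp add: ecos_def)
  finally show ?thesis by (simp only: of_real_eq_iff)
next
  case False
  then have k: "k \<noteq> - k" by (auto simp: vec_eq_iff)
  have e: "complex_of_real (ecos k x) = (\<Sum>q\<in>{k, - k}. complex_of_real (sqrt 2 / 2) * chr q x)" for x
  proof -
    have "(\<Sum>q\<in>{k, - k}. complex_of_real (sqrt 2 / 2) * chr q x) = complex_of_real (sqrt 2 / 2) * (chr k x + cnj (chr k x))"
      using k by (simp add: chr_minus_freq distrib_left)
    also have "\<dots> = complex_of_real (ecos k x)"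
      unfolding complex_add_cnj of_real_mult[symmetric] by (simp add: ecos_def)
    finally show ?thesis ..
  qed
  have "complex_of_real (conv \<phi> (ecos k) x) = (\<Sum>q\<in>{k, - k}. complex_of_real (sqrt 2 / 2) / lam q * chr q x)"
    by (rule conv_trig_poly[OF _ e]) auto
  also have "\<dots> = (\<Sum>q\<in>{k, - k}. complex_of_real (sqrt 2 / 2) * chr q x) / lam k"
    using k by (simp add: lam_minus add_divide_distrib)
  also have "\<dots> = complex_of_real (ecos k x / lam k)" by (simp only: e of_real_divide)
  finally show ?thesis by (simp only: of_real_eq_iff)
qed

lemma conv_ecos_sum:
  "conv \<phi> (\<lambda>x. \<Sum>k\<in>freq_cube m. \<beta> k * ecos k x) x = (\<Sum>k\<in>freq_cube m. \<beta> k / lam k * ecos k x)"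
proof -
  note m = L2_D(3)[OF \<phi>] L2_D(3)[OF ecos_L2] L2_D(3)[OF ecos_sum_L2]
  have "conv \<phi> (\<lambda>x. \<Sum>k\<in>freq_cube m. \<beta> k * ecos k x) x = (LINT y|tmeas. (\<Sum>k\<in>freq_cube m. \<beta> k * (\<phi> y * ecos k (x - y))))"
    by (simp add: conv_eq m sum_distrib_left mult_ac)
  also have "\<dots> = (\<Sum>k\<in>freq_cube m. \<beta> k * conv \<phi> (ecos k) x)"
    using sqint_integrable_mult[OF L2_D(2)[OF \<phi>] sqint_reflect(1)[OF ecos_L2]]
    by (simp add: conv_eq m)
  finally show ?thesis by (simp add: conv_ecos)
qed

text \<open>The function that is hard to approximate has coefficients of equal modulus on the cube,
  with signs from \<open>exists_far_sign_vector\<close>. Bessel's inequality transfers the distance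
  of the coefficient vectors to the mean square distance. The assumption \<open>count\<close> is the
  dimension condition of the sign vector lemma.\<close>

lemma M_lower:
  fixes m :: nat
  defines "N \<equiv> m ^ CARD('d)"
  assumes m: "m \<ge> 1" and B: "B > 0" "\<And>k. k \<in> freq_cube m \<Longrightarrow> lam k \<le> B"
    and count: "2 * ((2 * real N + 1) * (4 * real N * real m + 1) ^ CARD('d)) ^ n \<le> exp (2/5 * real N)"
  shows "ennreal (1 / (40 * B)) \<le> M n (Phi_ball \<phi>)"
  unfolding M_def
proof (rule INF_greatest)
  fix \<psi> :: "real ^ 'd \<Rightarrow> real" assume \<psi>: "\<psi> \<in> L2"
  let ?I = "freq_cube m :: (int ^ 'd) set"
  have cI: "card ?I = N" by (simp add: card_freq_cube N_def)
  have N: "N \<ge> 1" using m by (simp add: N_def)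
  \<comment> \<open>Scaled so that every choice of signs has a preimage of norm at most 1, as
    \<open>lam k \<le> B\<close> on the cube. The resulting distance is
    \<open>\<rho> * sqrt (N / 1600)\<close>, that is, \<open>1 / (40 * B)\<close>.\<close>
  define \<rho> where "\<rho> = 1 / (sqrt N * B)"
  have \<rho>: "\<rho> > 0" using N B by (simp add: \<rho>_def)
  have \<rho>2: "\<rho>\<^sup>2 * N * B\<^sup>2 = 1" using N B by (simp add: \<rho>_def power_divide power_mult_distrib)
  \<comment> \<open>Division by \<open>\<rho>\<close> brings the target coefficients to 1 and -1,
    the scale on which \<open>bump\<close> separates signs.\<close>
  let ?P = "\<lambda>k (c :: nat \<Rightarrow> real, y :: nat \<Rightarrow> real ^ 'd). (\<Sum>l\<in>{1..n}. c l * (LINT x|tmeas. \<psi> (x - y l) * ecos k x)) / \<rho>"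
  \<comment> \<open>Each of the \<open>N\<close> frequencies contributes a quadratic factor, hence
    degree \<open>N * 2\<close>. The boolean selects real or imaginary part.\<close>
  let ?T = "(shift_index n m (N * 2) :: ((nat \<Rightarrow> nat) \<times> (nat \<Rightarrow> int ^ 'd)) set) \<times> (UNIV :: bool set)"
  have P: "(\<lambda>t. complex_of_real (?P k t)) \<in> shift_span n m 1" if k: "k \<in> ?I" for k
  proof -
    have kb: "k \<in> freq_box (int m)" "- k \<in> freq_box (int m)"
      using freq_cube_subset_box[OF k] by (auto simp: freq_box_def)
    define a where "a = sqrt 2 / 2 * coef \<psi> k / \<rho>"
    define b where "b = sqrt 2 / 2 * cnj (coef \<psi> k) / \<rho>"
    have "complex_of_real (?P k t) = (\<Sum>l\<in>{1..n}. a * (\<lambda>(c, y). complex_of_real (c l) * chr k (y l)) t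
            + b * (\<lambda>(c, y). complex_of_real (c l) * chr (- k) (y l)) t)" for t
    proof (cases t)
      case (Pair c y)
      show ?thesis
        unfolding Pair case_prod_conv of_real_divide of_real_sum of_real_mult integral_translate_ecos[OF \<psi>]
        by (simp add: a_def b_def sum_divide_distrib distrib_left add_divide_distrib mult_ac)
    qed
    then have eq: "(\<lambda>t. complex_of_real (?P k t)) = (\<lambda>t. \<Sum>l\<in>{1..n}. a * (\<lambda>(c, y). complex_of_real (c l) * chr k (y l)) t
            + b * (\<lambda>(c, y). complex_of_real (c l) * chr (- k) (y l)) t)" by blast
    show ?thesis unfolding eq
      by (intro lspan_sum lspan_add lspan_scale shift_span_single kb)
  qed
  have span: "\<exists>a. \<forall>t. (\<Prod>k\<in>?I. bump (\<eta> k * ?P k t)) = (\<Sum>j\<in>?T. a j * (\<lambda>(j, r) t. if r then Re (shift_monom n j t) else Im (shift_monom n j t)) j t)" for \<eta>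
  proof -
    have "(\<lambda>t. complex_of_real (bump (\<eta> k * ?P k t))) \<in> shift_span n m 2" if k: "k \<in> ?I" for k
    proof -
      let ?f = "\<lambda>t. complex_of_real (\<eta> k) * complex_of_real (?P k t) + 1"
      have f: "?f \<in> shift_span n m 1" by (intro lspan_add lspan_scale P[OF k] shift_span_const)
      have "(\<lambda>t. ?f t * ?f t + 1) \<in> shift_span n m (1 + 1)"
        by (intro lspan_add shift_span_mult f shift_span_const)
      also have "(\<lambda>t. ?f t * ?f t + 1) = (\<lambda>t. complex_of_real (bump (\<eta> k * ?P k t)))"
        by (simp add: bump_def power2_eq_square)
      finally show ?thesis by (simp add: numeral_2_eq_2)
    qed
    then have "(\<lambda>t. \<Prod>k\<in>?I. complex_of_real (bump (\<eta> k * ?P k t))) \<in> shift_span n m (card ?I * 2)"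
      by (intro shift_span_prod finite_freq_cube)
    then have "(\<lambda>t. complex_of_real (\<Prod>k\<in>?I. bump (\<eta> k * ?P k t))) \<in> shift_span n m (N * 2)"
      by (simp only: cI of_real_prod)
    from lspan_real[OF finite_shift_index this] show ?thesis
      by (simp add: case_prod_beta')
  qed
  have cT: "real (card ?T) \<le> exp (2/5 * real (card ?I))"
  proof -
    have "real (card ?T) = 2 * ((2 * real N + 1) * (4 * real N * real m + 1) ^ CARD('d)) ^ n"
      by (simp add: card_cartesian_product card_shift_index algebra_simps)
    then show ?thesis using count by (simp add: cI)
  qed
  have fT: "finite ?T" by (simp add: finite_shift_index)
  obtain \<epsilon> where \<epsilon>: "\<And>k. k \<in> ?I \<Longrightarrow> (\<epsilon> k)\<^sup>2 = 1"
      "\<And>t. real (card ?I) / 1600 \<le> (\<Sum>k\<in>?I. (\<epsilon> k - ?P k t)\<^sup>2)"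
    using exists_far_sign_vector[OF finite_freq_cube fT cT span] by blast
  define f where "f x = (\<Sum>k\<in>?I. (\<rho> * \<epsilon> k) * ecos k x)" for x
  define g where "g x = (\<Sum>k\<in>?I. (\<rho> * \<epsilon> k * lam k) * ecos k x)" for x
  have fL: "f \<in> L2" and gL: "g \<in> L2"
    unfolding f_def[abs_def] g_def[abs_def] by (rule ecos_sum_L2)+
  have "f \<in> Phi_ball \<phi>"
  proof (rule Phi_ballI[OF fL gL])
    show "f x = conv \<phi> g x" for x
      unfolding g_def[abs_def] conv_ecos_sum f_def using lam_pos by (intro sum.cong) (auto simp: less_imp_neq[symmetric])
    have "(l2norm g)\<^sup>2 = (\<Sum>k\<in>?I. (\<rho> * \<epsilon> k * lam k)\<^sup>2)"
      using L2_D(3)[OF gL] by (simp add: l2norm_sq) (simp add: g_def[abs_def] integral_ecos_sum_sq)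
    also have "\<dots> \<le> (\<Sum>k\<in>?I. \<rho>\<^sup>2 * B\<^sup>2)"
    proof (rule sum_mono)
      fix k assume k: "k \<in> ?I"
      have "(lam k)\<^sup>2 \<le> B\<^sup>2" using B(2)[OF k] lam_pos[of k] by (intro power_mono) auto
      then show "(\<rho> * \<epsilon> k * lam k)\<^sup>2 \<le> \<rho>\<^sup>2 * B\<^sup>2"
        using \<epsilon>(1)[OF k] by (simp add: power_mult_distrib mult_left_mono)
    qed
    also have "\<dots> = 1" using \<rho>2 by (simp add: cI mult_ac)
    finally have "(l2norm g)\<^sup>2 \<le> 1\<^sup>2" by simp
    then show "l2norm g \<le> 1" by (rule power2_le_imp_le) simp
  qed
  then show "ennreal (1 / (40 * B)) \<le> (SUP f\<in>Phi_ball \<phi>. INF c. INF y\<in>{y. \<forall>l\<in>{1..n}. y l \<in> torus}.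
       ennreal (l2norm (\<lambda>x. f x - (\<Sum>l = 1..n. c l * \<psi> (x - y l)))))"
  proof (rule SUP_upper2, intro INF_greatest ennreal_leI)
    fix c :: "nat \<Rightarrow> real" and y :: "nat \<Rightarrow> real ^ 'd"
    let ?h = "\<lambda>x. f x - (\<Sum>l = 1..n. c l * \<psi> (x - y l))"
    have sL: "(\<lambda>x. \<Sum>l = 1..n. c l * \<psi> (x - y l)) \<in> L2"
      by (intro L2_sum L2_scale L2_translate \<psi>)
    have hL: "?h \<in> L2" by (rule L2_diff[OF fL sL])
    have he: "(LINT x|tmeas. ?h x * ecos k x) = \<rho> * (\<epsilon> k - ?P k (c, y))" if k: "k \<in> ?I" for k
    proof -
      note e = L2_D(2)[OF ecos_L2[of k]]
      have "(LINT x|tmeas. ?h x * ecos k x) = (LINT x|tmeas. f x * ecos k x) - (LINT x|tmeas. (\<Sum>l = 1..n. c l * \<psi> (x - y l)) * ecos k x)"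
        unfolding left_diff_distrib
        by (rule Bochner_Integration.integral_diff[OF sqint_integrable_mult[OF L2_D(2)[OF fL] e] sqint_integrable_mult[OF L2_D(2)[OF sL] e]])
      also have "(LINT x|tmeas. f x * ecos k x) = \<rho> * \<epsilon> k"
        unfolding f_def by (rule integral_ecos_sum_mult[OF k])
      also have "(LINT x|tmeas. (\<Sum>l = 1..n. c l * \<psi> (x - y l)) * ecos k x) = (LINT x|tmeas. (\<Sum>l = 1..n. c l * (\<psi> (x - y l) * ecos k x)))"
        by (simp only: sum_distrib_right mult.assoc)
      also have "\<dots> = (\<Sum>l = 1..n. c l * (LINT x|tmeas. \<psi> (x - y l) * ecos k x))"
        using sqint_integrable_mult[OF L2_D(2)[OF L2_translate[OF \<psi>]] e] by simp
      finally show ?thesis using \<rho> by (simp add: right_diff_distrib)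
    qed
    have "\<rho>\<^sup>2 * (real N / 1600) \<le> \<rho>\<^sup>2 * (\<Sum>k\<in>?I. (\<epsilon> k - ?P k (c, y))\<^sup>2)"
      using \<epsilon>(2)[of "(c, y)"] by (intro mult_left_mono) (simp_all add: cI)
    also have "\<dots> = (\<Sum>k\<in>?I. (LINT x|tmeas. ?h x * ecos k x)\<^sup>2)"
      by (simp only: he power_mult_distrib sum_distrib_left cong: sum.cong)
    also have "\<dots> \<le> (l2norm ?h)\<^sup>2"
      using ecos_bessel[OF hL, of m] by (simp only: l2norm_sq[OF L2_D(3)[OF hL]])
    also have "\<rho>\<^sup>2 * (real N / 1600) = (1 / (40 * B))\<^sup>2"
      using \<rho>2 B(1) by (simp add: field_simps power2_eq_square)
    finally show "1 / (40 * B) \<le> l2norm ?h"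
      by (rule power2_le_imp_le) (rule l2norm_nonneg)
  qed
qed

end

text \<open>\<open>T\<close> stands for the number of frequencies and may exceed
  \<open>n * ln (n + 1)\<close> by any factor, so \<open>ln T\<close> is not controlled by
  \<open>ln n\<close> alone. The excess is absorbed through
  \<open>n * ln (r / L) \<le> n * r / L\<close>, which is of order \<open>r\<close> because
  \<open>n\<close> is at most a multiple of \<open>L\<close>. Taking \<open>ln (n + 1)\<close> keeps
  \<open>L\<close> positive at \<open>n = 1\<close>.\<close>

lemma shift_count_bound:
  fixes d n T m :: nat
  assumes n: "n \<ge> 1" and m: "1 \<le> m" "m \<le> T"
    and T: "(100 * (real d + 1))\<^sup>2 * (real n * ln (real n + 1)) \<le> real T"
  shows "2 * ((2 * real T + 1) * (4 * real T * real m + 1) ^ d) ^ n \<le> exp (2/5 * real T)"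
proof -
  define D where "D = real d + 1"
  \<comment> \<open>Quadratic in \<open>D\<close>: one factor comes from the exponent
    \<open>d + 1\<close>, the other from the crude bound \<open>ln A \<le> 200 * D\<close>. With
    \<open>100\<^sup>2\<close> the final comparison is \<open>613 * D\<^sup>2\<close> against
    \<open>4000 * D\<^sup>2\<close>.\<close>
  define A where "A = (100 * D)\<^sup>2"
  define L where "L = real n * ln (real n + 1)"
  have D: "D \<ge> 1" by (simp add: D_def)
  have A: "A \<ge> 1" using D unfolding A_def by (intro one_le_power) simp
  have T1: "real T \<ge> 1" using m by simp
  have ln2: "2/3 \<le> ln (real n + 1)"
  proof -
    have "ln 2 \<le> ln (real n + 1)" using n by simp
    then show ?thesis using ln2_ge_two_thirds by linarith
  qed
  have Ln: "real n \<le> 3/2 * L"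
  proof -
    have "real n * (2/3) \<le> L" unfolding L_def using ln2 by (intro mult_left_mono) auto
    then show ?thesis by simp
  qed
  have L0: "L \<ge> 2/3" using Ln n by simp
  have AL: "A * L \<le> real T" using T by (simp add: A_def L_def D_def)
  define r where "r = real T / A"
  have Lr: "L \<le> r" using AL A by (simp add: r_def field_simps)
  have nr: "real n \<le> 3/2 * r" using Ln Lr by linarith
  have lnL: "ln L \<le> 2 * ln (real n + 1)"
  proof -
    have "L \<le> (real n + 1) * (real n + 1)"
      unfolding L_def using ln_le_minus_one[of "real n + 1"] n by (intro mult_mono) auto
    then have "ln L \<le> ln ((real n + 1) * (real n + 1))" using L0 by simp
    then show ?thesis by (simp add: ln_mult)
  qed
  have lnA: "ln A \<le> 200 * D"
  proof -
    have "ln A = 2 * ln (100 * D)" unfolding A_def using D by (subst ln_realpow) auto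
    also have "\<dots> \<le> 2 * (100 * D)" using ln_bound[of "100 * D"] D by simp
    finally show ?thesis by simp
  qed
  have lnT: "ln (real T) \<le> 200 * D + 2 * ln (real n + 1) + r / L"
  proof -
    have "real T = (A * L) * (r / L)" using A L0 by (simp add: r_def)
    then have "ln (real T) = ln A + ln L + ln (r / L)"
      using A L0 Lr by (simp add: ln_mult ln_div)
    also have "ln (r / L) \<le> r / L" using L0 Lr by (intro ln_bound) auto
    finally show ?thesis using lnA lnL by linarith
  qed
  have nlnT: "real n * ln (real T) \<le> r * (300 * D + 7/2)"
  proof -
    have "real n * ln (real T) \<le> real n * (200 * D + 2 * ln (real n + 1) + r / L)"
      using lnT by (intro mult_left_mono) auto
    also have "\<dots> = real n * (200 * D) + 2 * L + (real n / L) * r"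
      by (simp add: L_def algebra_simps)
    also have "\<dots> \<le> (3/2 * r) * (200 * D) + 2 * r + 3/2 * r"
      using nr Lr Ln L0 D by (intro add_mono mult_right_mono) (auto simp: field_simps)
    finally show ?thesis by (simp add: algebra_simps)
  qed
  have b1: "(2 * real T + 1) * (4 * real T * real m + 1) ^ d \<le> (5 * real T ^ 2) ^ (d + 1)"
  proof -
    have TT: "real T \<le> real T ^ 2" "1 \<le> real T ^ 2"
      using T1 self_le_power[of "real T" 2] one_le_power[of "real T" 2] by auto
    have "real T * real m \<le> real T * real T" using m by (intro mult_left_mono) auto
    then have 1: "4 * real T * real m + 1 \<le> 5 * real T ^ 2"
      using TT by (simp add: power2_eq_square)
    have "(4 * real T * real m + 1) ^ d \<le> (5 * real T ^ 2) ^ d" using 1 by (intro power_mono) auto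
    moreover have "2 * real T + 1 \<le> 5 * real T ^ 2" using TT by linarith
    ultimately show ?thesis by (simp add: mult_mono)
  qed
  have pos: "5 * real T ^ 2 > 0" using T1 by simp
  have ln5: "ln (5::real) \<le> 3"
  proof -
    have "ln (5::real) \<le> ln (2 ^ 3)" by simp
    also have "\<dots> = 3 * ln 2" by (simp only: ln_realpow zero_less_numeral of_nat_numeral)
    finally show ?thesis using ln_2_less_1 by linarith
  qed
  have r23: "2/3 \<le> r" using L0 Lr by linarith
  have "2 * ((2 * real T + 1) * (4 * real T * real m + 1) ^ d) ^ n \<le> 2 * ((5 * real T ^ 2) ^ (d + 1)) ^ n"
    using b1 by (intro mult_left_mono power_mono) auto
  also have "\<dots> = exp (ln (2 * ((5 * real T ^ 2) ^ (d + 1)) ^ n))"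
    using pos by (subst exp_ln) (auto intro!: mult_pos_pos zero_less_power)
  also have "\<dots> \<le> exp (2/5 * real T)"
  proof -
    have "ln (2 * ((5 * real T ^ 2) ^ (d + 1)) ^ n) = ln 2 + D * (real n * (ln 5 + 2 * ln (real T)))"
      using pos T1 by (simp add: ln_mult ln_realpow D_def algebra_simps)
    also have "\<dots> \<le> 3/2 * r + D * (9/2 * r + 2 * (r * (300 * D + 7/2)))"
    proof (intro add_mono mult_left_mono)
      show "ln 2 \<le> 3/2 * r" using ln_2_less_1 r23 by linarith
      have "real n * ln 5 \<le> (3/2 * r) * 3" using nr ln5 r23 by (intro mult_mono) auto
      then show "real n * (ln 5 + 2 * ln (real T)) \<le> 9/2 * r + 2 * (r * (300 * D + 7/2))"
        using nlnT by (simp add: algebra_simps)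
    qed (use D in simp)
    also have "\<dots> = r * (3/2 + 23/2 * D + 600 * D\<^sup>2)" by (simp add: algebra_simps power2_eq_square)
    also have "\<dots> \<le> r * (2/5 * A)"
    proof (intro mult_left_mono)
      have "1 \<le> D\<^sup>2" "D \<le> D\<^sup>2"
        using D self_le_power[of D 2] one_le_power[of D 2] by auto
      then show "3/2 + 23/2 * D + 600 * D\<^sup>2 \<le> 2/5 * A" by (simp add: A_def power_mult_distrib)
    qed (use r23 in simp)
    also have "\<dots> = 2/5 * real T" using A by (simp add: r_def)
    finally show ?thesis by simp
  qed
  finally show ?thesis .
qed

text \<open>Iterated doubling works from 1 on; below 1, monotonicity costs the ratio
  \<open>\<Psi> 1 / \<Psi> 0\<close>. Small arguments do occur, since \<open>n * ln n\<close> is 0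
  at \<open>n = 1\<close>.\<close>

lemma doubling_growth:
  fixes \<Psi> :: "real \<Rightarrow> real"
  assumes mono: "mono_on {0..} \<Psi>" and pos: "\<Psi> 0 > 0"
    and dbl: "\<exists>c. \<forall>t > 1. \<Psi> (2 * t) \<le> c * \<Psi> t"
  obtains D where "D > 0" "\<And>u t. 0 \<le> u \<Longrightarrow> 0 \<le> t \<Longrightarrow> u \<le> C * max 1 t \<Longrightarrow> \<Psi> u \<le> D * \<Psi> t"
proof -
  have mn: "\<Psi> s \<le> \<Psi> t" if "0 \<le> s" "s \<le> t" for s t
    using mono that by (auto simp: mono_on_def)
  have p: "\<Psi> t > 0" if "t \<ge> 0" for t using mn[of 0 t] pos that by simp
  obtain c where c: "\<And>t. t > 1 \<Longrightarrow> \<Psi> (2 * t) \<le> c * \<Psi> t" using dbl by blast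
  \<comment> \<open>The quotient supplies the doubling bound at \<open>t = 1\<close>, which the
    hypothesis leaves out; the entry 1 keeps all powers of \<open>c1\<close> positive.\<close>
  define c1 where "c1 = max 1 (max c (\<Psi> 2 / \<Psi> 1))"
  have c1: "c1 \<ge> 1" "c1 \<ge> c" "c1 \<ge> \<Psi> 2 / \<Psi> 1" by (auto simp: c1_def)
  have d1: "\<Psi> (2 * t) \<le> c1 * \<Psi> t" if "t \<ge> 1" for t
  proof (cases "t = 1")
    case True
    then show ?thesis using c1(3) p[of 1] by (simp add: field_simps)
  next
    case False
    then have "\<Psi> (2 * t) \<le> c * \<Psi> t" using that c by simp
    also have "\<dots> \<le> c1 * \<Psi> t" using c1(2) p[of t] that by (intro mult_right_mono) auto
    finally show ?thesis .
  qed
  have dj: "\<Psi> (2 ^ j * t) \<le> c1 ^ j * \<Psi> t" if "t \<ge> 1" for j t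
  proof (induction j)
    case (Suc j)
    have "1 * 1 \<le> 2 ^ j * t" using that by (intro mult_mono) auto
    then have "\<Psi> (2 * (2 ^ j * t)) \<le> c1 * \<Psi> (2 ^ j * t)" by (intro d1) simp
    also have "\<dots> \<le> c1 * (c1 ^ j * \<Psi> t)" using Suc c1 by (intro mult_left_mono) auto
    finally show ?case by (simp add: mult_ac)
  qed simp
  obtain j where j: "C < 2 ^ j" using real_arch_pow[of 2 C] by auto
  define D where "D = c1 ^ j * (\<Psi> 1 / \<Psi> 0)"
  show thesis
  proof (rule that)
    show "D > 0" using c1 p by (auto simp: D_def intro!: mult_pos_pos divide_pos_pos)
    fix u t :: real assume u: "0 \<le> u" "0 \<le> t" "u \<le> C * max 1 t"
    have "u \<le> 2 ^ j * max 1 t"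
      using u(3) j by (meson less_imp_le max.cobounded1 mult_right_mono order_trans zero_le_one)
    then have "\<Psi> u \<le> \<Psi> (2 ^ j * max 1 t)" using u by (intro mn)
    also have "\<dots> \<le> c1 ^ j * \<Psi> (max 1 t)" by (rule dj) simp
    also have "\<Psi> (max 1 t) \<le> \<Psi> 1 / \<Psi> 0 * \<Psi> t"
    proof (cases "t \<ge> 1")
      case True
      have "1 * \<Psi> t \<le> \<Psi> 1 / \<Psi> 0 * \<Psi> t"
        using mn[of 0 1] pos p[of t] u by (intro mult_right_mono) auto
      then show ?thesis using True by (simp add: max_def)
    next
      case False
      have "\<Psi> 1 / \<Psi> 0 * \<Psi> 0 \<le> \<Psi> 1 / \<Psi> 0 * \<Psi> t"
        using mn[of 0 t] p u pos by (intro mult_left_mono) (auto intro: less_imp_le)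
      then show ?thesis using False pos by (simp add: max_def)
    qed
    finally show "\<Psi> u \<le> D * \<Psi> t"
      using c1 by (simp add: D_def mult_left_mono mult.assoc)
  qed
qed

theorem theorem3p8:
  fixes \<Psi> :: "real \<Rightarrow> real"
    and lam :: "int ^ 'd \<Rightarrow> real"
    and \<phi> :: "real ^ 'd \<Rightarrow> real"
  assumes "\<And>t. t \<ge> 0 \<Longrightarrow> \<Psi> t \<ge> 0"
    and "mono_on {0..} \<Psi>"
    and "\<exists>c. \<forall>t > 1. \<Psi> (2 * t) \<le> c * \<Psi> t"
    and "\<And>k. lam k = \<Psi> (norm (freq k))"
    and "\<And>k. lam k \<noteq> 0"
    and "\<phi> \<in> L2"
    and "is_kernel lam \<phi>"
  shows "\<exists>c' > 0. \<exists>c'' > 0. \<forall>n :: nat. n \<ge> 1 \<longrightarrow>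
    ennreal (c' / \<Psi> ((real n * ln (real n)) powr (1 / real CARD('d)))) \<le> M n (Phi_ball \<phi>) \<and>
    M n (Phi_ball \<phi>) \<le> ennreal (c'' / \<Psi> (real n powr (1 / real CARD('d))))"
proof -
  let ?d = "CARD('d)"
  have d: "?d \<ge> 1" by simp
  have lp: "lam k > 0" for k using assms(1)[of "norm (freq k)"] assms(4,5)[of k] by auto
  have \<Psi>0: "\<Psi> 0 > 0" using lp[of 0] by (simp add: assms(4) freq_zero)
  have mn: "\<Psi> s \<le> \<Psi> t" if "0 \<le> s" "s \<le> t" for s t
    using assms(2) that by (auto simp: mono_on_def)
  have p: "\<Psi> t > 0" if "t \<ge> 0" for t using mn[of 0 t] \<Psi>0 that by simp
  have sym: "lam (- k) = lam k" for k by (simp add: assms(4) freq_minus)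
  interpret torus_kernel lam \<phi>
    by unfold_locales (use assms(6) is_kernel_coef[OF assms(7,6) sym] sym lp in auto)

  \<comment> \<open>The factor 4 covers \<open>r < 2 * m + 3 \<le> 4 * (m + 1)\<close>, used below
    with \<open>u = r\<close> and \<open>t = m + 1\<close>.\<close>
  obtain D2 where D2: "D2 > 0" "\<And>u t. 0 \<le> u \<Longrightarrow> 0 \<le> t \<Longrightarrow> u \<le> 4 * max 1 t \<Longrightarrow> \<Psi> u \<le> D2 * \<Psi> t"
    using doubling_growth[OF assms(2) \<Psi>0 assms(3), of 4] by blast
  have upper: "M n (Phi_ball \<phi>) \<le> ennreal (D2 / \<Psi> (real n powr (1 / real ?d)))" if n: "n \<ge> 1" for n
  proof -
    define r where "r = real n powr (1 / real ?d)"
    have r1: "r \<ge> 1" unfolding r_def using n by (intro ge_one_powr_ge_zero) auto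
    have rd: "r ^ ?d = real n" using n by (simp add: r_def powr_power)
    \<comment> \<open>The largest degree for which \<open>2 * m + 1\<close> nodes per coordinate do
      not exceed \<open>r\<close>, so that the grid has at most \<open>n\<close> nodes.\<close>
    define m where "m = nat \<lfloor>(r - 1) / 2\<rfloor>"
    have m: "real (2 * m + 1) \<le> r" "r < real (2 * m + 1) + 2"
    proof -
      have "real m = of_int \<lfloor>(r - 1) / 2\<rfloor>" using r1 by (simp add: m_def)
      then show "real (2 * m + 1) \<le> r" "r < real (2 * m + 1) + 2"
        using of_int_floor_le[of "(r - 1) / 2"] floor_correct[of "(r - 1) / 2"] by (simp_all add: field_simps)
    qed
    have "real ((2 * m + 1) ^ ?d) \<le> r ^ ?d"
      unfolding of_nat_power using m(1) by (intro power_mono) auto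
    then have mn_le: "(2 * m + 1) ^ ?d \<le> n" unfolding rd by (simp only: of_nat_le_iff)
    let ?B = "\<Psi> (real m + 1)"
    have "M n (Phi_ball \<phi>) \<le> ennreal (1 / ?B)"
    proof (rule M_upper[OF _ _ mn_le])
      show "?B > 0" by (rule p) simp
      fix k :: "int ^ 'd" assume "k \<notin> freq_box (int m)"
      then obtain i where "\<bar>k $ i\<bar> > int m" by (auto simp: freq_box_def not_le)
      then have "real m + 1 \<le> \<bar>freq k $ i\<bar>" by (simp add: freq_def flip: of_int_abs)
      also have "\<dots> \<le> norm (freq k)" by (rule component_le_norm_cart)
      finally show "?B \<le> lam k" unfolding assms(4) by (intro mn) auto
    qed
    also have "\<dots> \<le> ennreal (D2 / \<Psi> r)"
    proof (rule ennreal_leI)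
      have "\<Psi> r \<le> D2 * ?B" using m r1 by (intro D2(2)) auto
      then show "1 / ?B \<le> D2 / \<Psi> r" using p[of r] p[of "real m + 1"] r1 by (simp add: field_simps)
    qed
    finally show ?thesis by (simp add: r_def)
  qed

  define A where "A = (100 * (real ?d + 1))\<^sup>2"
  have A: "A \<ge> 1" unfolding A_def by (intro one_le_power) simp
  \<comment> \<open>The summand 1 pays for rounding up in \<open>m\<close>, the factor 2 for passing
    from \<open>ln (n + 1)\<close> to \<open>ln n\<close>, and the dimension for bounding the
    Euclidean norm by the sum of the coordinates.\<close>
  define C where "C = ((2 * A) powr (1 / real ?d) + 1) * real ?d"
  obtain D1 where D1: "D1 > 0" "\<And>u t. 0 \<le> u \<Longrightarrow> 0 \<le> t \<Longrightarrow> u \<le> C * max 1 t \<Longrightarrow> \<Psi> u \<le> D1 * \<Psi> t"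
    using doubling_growth[OF assms(2) \<Psi>0 assms(3), of C] by blast
  have lower: "ennreal (1 / (40 * D1) / \<Psi> ((real n * ln (real n)) powr (1 / real ?d))) \<le> M n (Phi_ball \<phi>)" if n: "n \<ge> 1" for n
  proof -
    define x where "x = (real n * ln (real n)) powr (1 / real ?d)"
    define L where "L = real n * ln (real n + 1)"
    have L0: "L > 0" using n by (simp add: L_def)
    \<comment> \<open>The least \<open>m\<close> whose power \<open>m ^ CARD('d)\<close> reaches
      \<open>A * L\<close>, the size demanded by \<open>shift_count_bound\<close>.\<close>
    define m where "m = nat \<lceil>(A * L) powr (1 / real ?d)\<rceil>"
    have ALpos: "(A * L) powr (1 / real ?d) > 0" using A L0 by simp
    have m1: "m \<ge> 1" using ALpos unfolding m_def by linarith
    have m_ge: "(A * L) powr (1 / real ?d) \<le> real m" unfolding m_def by linarith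
    have m_le: "real m \<le> (A * L) powr (1 / real ?d) + 1" using ALpos unfolding m_def by linarith
    let ?N = "m ^ ?d"
    have "A * L = ((A * L) powr (1 / real ?d)) ^ ?d" using A L0 by (simp add: powr_power)
    also have "\<dots> \<le> real m ^ ?d" using m_ge by (intro power_mono) auto
    finally have AL: "A * L \<le> real ?N" by simp
    have mN: "m \<le> ?N" using m1 d by (metis One_nat_def power_increasing power_one_right)
    let ?B = "\<Psi> (real m * real ?d)"
    have "ennreal (1 / (40 * ?B)) \<le> M n (Phi_ball \<phi>)"
    proof (rule M_lower[OF m1])
      show "?B > 0" by (rule p) simp
      fix k :: "int ^ 'd" assume k: "k \<in> freq_cube m"
      have "norm (freq k) \<le> (\<Sum>i\<in>UNIV. \<bar>freq k $ i\<bar>)" by (rule norm_le_l1_cart)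
      also have "\<dots> \<le> (\<Sum>i\<in>(UNIV :: 'd set). real m)"
      proof (rule sum_mono)
        fix i
        have "0 \<le> k $ i" "k $ i \<le> int m" using k by (auto simp: freq_cube_def intro: order_trans[of _ 1])
        then have "0 \<le> real_of_int (k $ i)" "real_of_int (k $ i) \<le> real_of_int (int m)"
          by (simp_all only: of_int_le_iff of_int_0_le_iff)
        then show "\<bar>freq k $ i\<bar> \<le> real m" by (simp add: freq_def)
      qed
      finally have "norm (freq k) \<le> real m * real ?d" by (simp add: mult.commute)
      then show "lam k \<le> ?B" unfolding assms(4) by (intro mn) auto
    next
      show "2 * ((2 * real ?N + 1) * (4 * real ?N * real m + 1) ^ ?d) ^ n \<le> exp (2/5 * real ?N)"
        using AL by (intro shift_count_bound n m1 mN) (simp add: A_def L_def)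
    qed
    moreover have "ennreal (1 / (40 * D1) / \<Psi> x) \<le> ennreal (1 / (40 * ?B))"
    proof (rule ennreal_leI)
      have x0: "x \<ge> 0" by (simp add: x_def)
      have "real m \<le> ((2 * A) powr (1 / real ?d) + 1) * max 1 x"
      proof -
        have "L powr (1 / real ?d) \<le> 2 powr (1 / real ?d) * max 1 x"
        \<comment> \<open>At \<open>n = 1\<close> the value of \<open>x\<close> is 0, and the bound
          rests on the 1 in \<open>max 1 x\<close>. For larger \<open>n\<close> the logarithms
          compare through \<open>n + 1 \<le> n * n\<close>.\<close>
        proof (cases "n = 1")
          case True
          have "ln (2::real) \<le> 2" using ln_2_less_1 by linarith
          then have "L powr (1 / real ?d) \<le> 2 powr (1 / real ?d)"
            using L0 by (intro powr_mono2) (auto simp: L_def True)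
          also have "\<dots> * 1 \<le> 2 powr (1 / real ?d) * max 1 x" by (intro mult_left_mono) auto
          finally show ?thesis by simp
        next
          case False
          with n have n2: "real n \<ge> 2" by simp
          have "real n + 1 \<le> real n * 2" using n2 by simp
          also have "\<dots> \<le> real n * real n" using n2 by (intro mult_left_mono) auto
          finally have "ln (real n + 1) \<le> ln (real n * real n)" using n2 by simp
          then have "ln (real n + 1) \<le> 2 * ln (real n)" using n2 by (simp add: ln_mult)
          then have "L \<le> real n * (2 * ln (real n))" unfolding L_def by (intro mult_left_mono) auto
          then have "L powr (1 / real ?d) \<le> (2 * (real n * ln (real n))) powr (1 / real ?d)"
            using L0 by (intro powr_mono2) auto
          also have "\<dots> = 2 powr (1 / real ?d) * x"
            using n2 unfolding x_def by (intro powr_mult)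
          also have "\<dots> \<le> 2 powr (1 / real ?d) * max 1 x" by (intro mult_left_mono) auto
          finally show ?thesis .
        qed
        then have "A powr (1 / real ?d) * L powr (1 / real ?d) \<le> A powr (1 / real ?d) * (2 powr (1 / real ?d) * max 1 x)"
          by (intro mult_left_mono) auto
        then have "(A * L) powr (1 / real ?d) \<le> (2 * A) powr (1 / real ?d) * max 1 x"
          using A L0 by (simp add: powr_mult mult_ac)
        then show ?thesis using m_le by (simp add: distrib_right)
      qed
      then have "real m * real ?d \<le> ((2 * A) powr (1 / real ?d) + 1) * max 1 x * real ?d"
        by (rule mult_right_mono) simp
      then have "real m * real ?d \<le> C * max 1 x"
        by (simp only: C_def mult.assoc mult.commute[of "real ?d"])
      then have "?B \<le> D1 * \<Psi> x" using x0 by (intro D1(2)) auto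
      then show "1 / (40 * D1) / \<Psi> x \<le> 1 / (40 * ?B)"
        using p[of x] p[of "real m * real ?d"] x0 D1(1) by (simp add: field_simps)
    qed
    ultimately show ?thesis unfolding x_def by (rule order_trans[rotated])
  qed
  show ?thesis
    using upper lower D1(1) D2(1) by (intro exI[of _ "1 / (40 * D1)"] conjI exI[of _ D2]) auto
qed

end
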